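(* Let $\Omega\subset\mathbb{R}^2$ be a domain which is star-shaped with respect to a disc of radius $r>0$ and is contained in a concentric disc of radius $R$, and let $\eta=\frac{R}{r}$. Then the improved Poincaré constant $P_\Omega$ of $\Omega$ satisfies $$P_\Omega\le 16\left(\eta+\sqrt{\eta^2-1}\right)^2\le 64\,\eta^2 .$$
   Context: $\|\cdot\|$ is the $L_2(\Omega)$ norm, $u_\Omega=\frac1{|\Omega|}\int_\Omega u$ is the integral mean of $u$ on $\Omega$, and $d_\Omega(x)=\mathrm{dist}(x,\partial\Omega)$ is the distance of $x\in\Omega$ to the boundary. The improved Poincaré constant $P_\Omega$ is the least positive constant $P$ such that $\|u-u_\Omega\|^2\le P\|d_\Omega\nabla u\|^2$ holds for every $u\in L_{1,loc}(\Omega)$ such that $d_\Omega\nabla u\in L_2(\Omega)$. A domain is star-shaped with respect to a disc $B\subset\Omega$ if for every $x\in\Omega$ and $y\in B$ the segment from $x$ to $y$ lies in $\Omega$. *)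

theory Defs
  imports "HOL-Analysis.Analysis"
begin

primrec C_k :: "nat \<Rightarrow> ('a::euclidean_space \<Rightarrow> real) \<Rightarrow> bool" where
  "C_k 0 f \<longleftrightarrow> continuous_on UNIV f"
| "C_k (Suc k) f \<longleftrightarrow> f differentiable_on UNIV \<and>
     (\<forall>b\<in>Basis. C_k k (\<lambda>x. frechet_derivative f (at x) b))"

definition test_function :: "'a::euclidean_space set \<Rightarrow> ('a \<Rightarrow> real) \<Rightarrow> bool" where
  "test_function \<Omega> \<phi> \<longleftrightarrow>
     (\<forall>k. C_k k \<phi>) \<and> compact (closure {x. \<phi> x \<noteq> 0}) \<and> closure {x. \<phi> x \<noteq> 0} \<subseteq> \<Omega>"

definition L1_loc :: "'a::euclidean_space set \<Rightarrow> ('a \<Rightarrow> 'b::euclidean_space) \<Rightarrow> bool" where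
  "L1_loc \<Omega> f \<longleftrightarrow> (\<forall>K. compact K \<and> K \<subseteq> \<Omega> \<longrightarrow> f absolutely_integrable_on K)"

definition weak_gradient ::
    "'a::euclidean_space set \<Rightarrow> ('a \<Rightarrow> real) \<Rightarrow> ('a \<Rightarrow> 'a) \<Rightarrow> bool" where
  "weak_gradient \<Omega> u g \<longleftrightarrow> L1_loc \<Omega> g \<and>
     (\<forall>\<phi>. test_function \<Omega> \<phi> \<longrightarrow> (\<forall>b\<in>Basis.
        (LINT x:\<Omega>|lebesgue. u x * frechet_derivative \<phi> (at x) b)
          = - (LINT x:\<Omega>|lebesgue. (g x \<bullet> b) * \<phi> x)))"

text \<open>The squared norm of \<open>L\<^sub>2(\<Omega>)\<close> takes the value \<open>\<infinity>\<close> for measurable functions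
  that are not square integrable.\<close>

definition L2_norm_sq :: "'a::euclidean_space set \<Rightarrow> ('a \<Rightarrow> 'b::euclidean_space) \<Rightarrow> ennreal" where
  "L2_norm_sq \<Omega> f = (\<integral>\<^sup>+x\<in>\<Omega>. ennreal ((norm (f x))\<^sup>2) \<partial>lebesgue)"

definition integral_mean :: "'a::euclidean_space set \<Rightarrow> ('a \<Rightarrow> real) \<Rightarrow> real" where
  "integral_mean \<Omega> u = 1 / measure lebesgue \<Omega> * (LINT x:\<Omega>|lebesgue. u x)"

definition boundary_dist :: "'a::euclidean_space set \<Rightarrow> 'a \<Rightarrow> real" where
  "boundary_dist \<Omega> x = infdist x (frontier \<Omega>)"

text \<open>If \<open>u\<close> is not integrable on \<open>\<Omega>\<close>, then \<open>integral_mean\<close> is a dummy value; for open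
  \<open>\<Omega>\<close> of finite measure the left-hand side below is then \<open>\<infinity>\<close>, because square integrable
  functions are integrable. So the inequality also asserts that \<open>u\<close> lies in \<open>L\<^sub>2(\<Omega>)\<close>.\<close>

definition improved_poincare_ineq :: "'a::euclidean_space set \<Rightarrow> real \<Rightarrow> bool" where
  "improved_poincare_ineq \<Omega> P \<longleftrightarrow>
     (\<forall>u g. L1_loc \<Omega> u \<and> weak_gradient \<Omega> u g
         \<and> L2_norm_sq \<Omega> (\<lambda>x. boundary_dist \<Omega> x *\<^sub>R g x) < \<infinity> \<longrightarrow>
       L2_norm_sq \<Omega> (\<lambda>x. u x - integral_mean \<Omega> u)
         \<le> ennreal P * L2_norm_sq \<Omega> (\<lambda>x. boundary_dist \<Omega> x *\<^sub>R g x))"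

text \<open>The value is \<open>\<infinity>\<close> if no constant is admissible; otherwise the infimum satisfies the
  inequality itself, see \<open>improved_poincare_ineq_constant\<close>, so it is the least
  constant.\<close>

definition improved_poincare_constant :: "'a::euclidean_space set \<Rightarrow> ennreal" where
  "improved_poincare_constant \<Omega> = (INF P\<in>{P. 0 < P \<and> improved_poincare_ineq \<Omega> P}. ennreal P)"

lemma improved_poincare_ineq_constant:
  assumes "improved_poincare_constant \<Omega> < \<infinity>"
  shows "improved_poincare_ineq \<Omega> (enn2real (improved_poincare_constant \<Omega>))"
  unfolding improved_poincare_ineq_def
proof (intro allI impI, elim conjE)
  fix u :: "'a \<Rightarrow> real" and g :: "'a \<Rightarrow> 'a"
  let ?S = "{P. 0 < P \<and> improved_poincare_ineq \<Omega> P}"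
  let ?L = "L2_norm_sq \<Omega> (\<lambda>x. u x - integral_mean \<Omega> u)"
  let ?G = "L2_norm_sq \<Omega> (\<lambda>x. boundary_dist \<Omega> x *\<^sub>R g x)"
  assume u: "L1_loc \<Omega> u" "weak_gradient \<Omega> u g" and G: "?G < \<infinity>"
  have ne: "?S \<noteq> {}"
  proof
    assume "?S = {}"
    then show False
      using assms unfolding improved_poincare_constant_def by (simp only: image_empty) simp
  qed
  have "?L \<le> (INF P\<in>?S. ennreal P * ?G)"
    using u G by (intro INF_greatest) (auto simp: improved_poincare_ineq_def)
  also have "\<dots> = (INF P\<in>?S. ennreal P) * ?G"
  proof -
    have "mono (\<lambda>x. ?G * x)"
      by (simp add: mono_def mult_left_mono)
    moreover have "continuous (at_right (Inf (ennreal ` ?S))) (\<lambda>x. ?G * x)"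
      using G unfolding continuous_within
      by (intro ennreal_tendsto_cmult tendsto_ident_at) (simp add: less_top)
    ultimately have "?G * Inf (ennreal ` ?S) = (INF s\<in>ennreal ` ?S. ?G * s)"
      by (rule continuous_at_Inf_mono) (use ne in auto)
    then show ?thesis
      by (simp add: image_image mult.commute)
  qed
  finally show "?L \<le> ennreal (enn2real (improved_poincare_constant \<Omega>)) * ?G"
    using assms by (simp add: improved_poincare_constant_def)
qed

definition star_shaped_wrt :: "'a::euclidean_space set \<Rightarrow> 'a set \<Rightarrow> bool" where
  "star_shaped_wrt \<Omega> B \<longleftrightarrow> B \<subseteq> \<Omega> \<and> (\<forall>x\<in>\<Omega>. \<forall>y\<in>B. closed_segment x y \<subseteq> \<Omega>)"

end

theory Submission imports Defs "HOL-Complex_Analysis.Complex_Analysis"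
begin

text \<open>Identify \<open>\<real>\<^sup>2\<close> with the complex plane, let \<open>f\<close> map the unit disc conformally onto \<open>\<Omega>\<close>,
  let \<open>sin \<epsilon> = r / R\<close> and \<open>\<Gamma> = (\<eta> + sqrt (\<eta>\<^sup>2 - 1))\<^sup>2\<close>, and write \<open>d\<close> for the distance to the boundary.

  Every boundary point is the vertex of an exterior cone of half-angle \<open>\<epsilon>\<close>. Opening the complement of
  the cone to a half-plane by a power and applying the Schwarz--Pick lemma gives
  \<open>(1 - |z|\<^sup>2) |f' z| \<le> 4 (1 - \<epsilon>/\<pi>) d (f z)\<close>.

  On the disc, every \<open>V\<close> in \<open>L\<^sub>2\<close> can be approximated by polynomials up to the norm of
  \<open>(1 - |z|\<^sup>2) (V\<^sub>x + \<i> V\<^sub>y)\<close>; the Fourier modes decouple, and each one is a weighted inequality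
  in the radial variable. For \<open>V = (u \<circ> f) f'\<close> this yields a holomorphic \<open>F\<close> on \<open>\<Omega>\<close> for which
  \<open>\<parallel>u - F\<parallel>\<^sup>2\<close> exceeds \<open>16 (1 - \<epsilon>/\<pi>)\<^sup>2 \<parallel>d \<nabla>u\<parallel>\<^sup>2\<close> by arbitrarily little.

  The Friedrichs inequality \<open>\<parallel>Re F - Re F(0)\<parallel>\<^sup>2 \<le> \<Gamma> \<parallel>Im F\<parallel>\<^sup>2\<close> follows by integrating
  \<open>(F\<^sup>2 - F(0)\<^sup>2) / z\<close> along dilated copies of the boundary. For \<open>c = Re F(0)\<close> the two combine to
  \<open>\<parallel>u - c\<parallel>\<^sup>2 \<le> (1 + \<Gamma>) \<parallel>u - F\<parallel>\<^sup>2\<close>, and \<open>(1 + \<Gamma>) (1 - \<epsilon>/\<pi>)\<^sup>2 \<le> \<Gamma>\<close>.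

  A general \<open>u\<close> is mollified on a dilated copy of \<open>\<Omega>\<close>, whose distance function is dominated by \<open>d\<close> at
  nearby points; Fatou's lemma removes the mollification and the dilation.\<close>

section \<open>Coordinates and changes of variables\<close>

text \<open>Two losses have to be balanced. As \<open>u\<close> is real, |u - F|^2 = (u - Re F)^2 +
  (Im F)^2, and the Friedrichs inequality turns the imaginary part into control of Re F - c, at the
  price of the factor 1 + \<Gamma>. With the classical Koebe constant 4 the result would be 16 (1 +
  \<Gamma>), so the exterior cone has to win back the extra 1. It does: \<Gamma> = cot^2
  (\<epsilon>/2), hence \<Gamma> / (1 + \<Gamma>) = cos^2 (\<epsilon>/2), and 1 - \<epsilon>/pi lies
  below cos (\<epsilon>/2).

  The factor f' in V makes the norms on the disc and on \<Omega> agree. Being holomorphic, it is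
  invisible to V_x + i V_y, whose modulus is |f'|^2 |grad u|: one f' joins the weight 1 - |z|^2 and
  becomes the distance, the other squares to the Jacobian.

  The radial inequality with constant 1 holds for the modes n \<ge> 0 only after a multiple of z^n
  is subtracted; matching the mode with that multiple on the circle |z|^2 = (n+1)/(n+2) is enough.

  The boundary is merely a Lipschitz polar graph, so the contour argument works with difference
  quotients of the logarithm of the radius, bounded geometrically by tangents to the disc.\<close>

definition vec_of_complex :: "complex \<Rightarrow> real^2" where
  "vec_of_complex z = vector [Re z, Im z]"

definition complex_of_vec :: "real^2 \<Rightarrow> complex" where
  "complex_of_vec v = Complex (v $ 1) (v $ 2)"

lemma complex_of_vec_inverse [simp]: "vec_of_complex (complex_of_vec v) = v"
  by (simp add: vec_of_complex_def complex_of_vec_def vec_eq_iff forall_2)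

lemma vec_of_complex_inverse [simp]: "complex_of_vec (vec_of_complex z) = z"
  by (simp add: vec_of_complex_def complex_of_vec_def)

lemma linear_complex_of_vec: "linear complex_of_vec"
  by (intro linearI) (simp_all add: complex_of_vec_def complex_eq_iff)

lemma linear_vec_of_complex: "linear vec_of_complex"
  by (intro linearI) (simp_all add: vec_of_complex_def vec_eq_iff forall_2)

lemma inner_complex_of_vec: "complex_of_vec v \<bullet> complex_of_vec w = v \<bullet> w"
  by (simp add: complex_of_vec_def inner_complex_def inner_vec_def sum_2)

lemma norm_complex_of_vec [simp]: "norm (complex_of_vec v) = norm v"
  by (simp add: norm_eq_sqrt_inner inner_complex_of_vec)

lemma norm_vec_of_complex [simp]: "norm (vec_of_complex z) = norm z"
  by (metis norm_complex_of_vec vec_of_complex_inverse)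

lemma bounded_linear_complex_of_vec: "bounded_linear complex_of_vec"
  using linear_complex_of_vec linear_conv_bounded_linear by blast

lemma bounded_linear_vec_of_complex: "bounded_linear vec_of_complex"
  using linear_vec_of_complex linear_conv_bounded_linear by blast

lemma continuous_on_complex_of_vec: "continuous_on S complex_of_vec"
  by (simp add: bounded_linear_complex_of_vec linear_continuous_on)

lemma continuous_on_vec_of_complex: "continuous_on S vec_of_complex"
  by (simp add: bounded_linear_vec_of_complex linear_continuous_on)

lemma borel_measurable_complex_of_vec [measurable]: "complex_of_vec \<in> borel_measurable borel"
  by (simp add: borel_measurable_continuous_onI continuous_on_complex_of_vec)

lemma borel_measurable_vec_of_complex [measurable]: "vec_of_complex \<in> borel_measurable borel"
  by (simp add: borel_measurable_continuous_onI continuous_on_vec_of_complex)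

text \<open>Lebesgue measure is determined by the volumes of boxes, and the preimage of a box under
  the coordinate map is the box between the preimages of its corners.\<close>

lemma distr_complex_of_vec: "distr lborel borel complex_of_vec = lborel"
proof (rule lborel_eqI [symmetric])
  fix l u :: complex
  assume lu: "\<And>b. b \<in> Basis \<Longrightarrow> l \<bullet> b \<le> u \<bullet> b"
  have vim: "complex_of_vec -` box l u = box (vec_of_complex l) (vec_of_complex u)"
    by (auto simp: box_def Basis_complex_def Basis_vec_def forall_2 vec_of_complex_def complex_of_vec_def
        inner_axis)
  have "emeasure (distr lborel borel complex_of_vec) (box l u)
      = emeasure lborel (box (vec_of_complex l) (vec_of_complex u))"
    by (subst emeasure_distr) (auto simp: vim)
  also have "\<dots> = (\<Prod>b\<in>Basis. (u - l) \<bullet> b)"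
  proof -
    have "(\<Prod>b\<in>Basis. (vec_of_complex u - vec_of_complex l) \<bullet> b) = (\<Prod>b\<in>Basis. (u - l) \<bullet> b)"
    proof -
      have B: "(Basis :: (real^2) set) = {axis 1 1, axis 2 1}"
        by (auto simp: Basis_vec_def UNIV_2)
      have "axis (1::2) (1::real) \<noteq> axis 2 1"
        by (simp add: axis_eq_axis)
      then show ?thesis
        unfolding B by (subst prod.insert) (auto simp: Basis_complex_def inner_axis vec_of_complex_def)
    qed
    moreover have "vec_of_complex l \<bullet> b \<le> vec_of_complex u \<bullet> b" if "b \<in> Basis" for b
      using lu[of 1] lu[of \<i>] that
      by (auto simp: Basis_complex_def Basis_vec_def vec_of_complex_def inner_axis UNIV_2)
    ultimately show ?thesis
      by (simp add: emeasure_lborel_box)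
  qed
  finally show "emeasure (distr lborel borel complex_of_vec) (box l u) = (\<Prod>b\<in>Basis. (u - l) \<bullet> b)" .
qed simp

lemma nn_integral_complex_of_vec:
  assumes [measurable]: "H \<in> borel_measurable borel"
  shows "(\<integral>\<^sup>+z. H z \<partial>lborel) = (\<integral>\<^sup>+v. H (complex_of_vec v) \<partial>lborel)"
  by (subst distr_complex_of_vec [symmetric], subst nn_integral_distr) auto

text \<open>Multiplication by \<open>c\<close> is a rotation combined with scaling by |c|; this is
  the Jacobian of a holomorphic map with derivative \<open>c\<close>.\<close>

lemma det_complex_mult:
  "det (matrix (\<lambda>v. vec_of_complex (c * complex_of_vec v))) = (cmod c)\<^sup>2"
  by (simp add: det_2 matrix_def vec_of_complex_def complex_of_vec_def axis_def cmod_def power2_eq_square)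

text \<open>\<open>has_measure_differentiable_image\<close> speaks of maps of \<open>real^'n\<close>
  and asks for an integrable Jacobian. So \<open>f\<close> is conjugated with the coordinate maps,
  and the bounds on \<open>A\<close> and on the derivative supply integrability;
  \<open>emeasure_conformal_image\<close> removes both bounds.\<close>

lemma emeasure_conformal_image_bounded:
  assumes f: "f holomorphic_on S" "inj_on f S" "open S"
    and A [measurable]: "A \<in> sets borel" "A \<subseteq> S" "bounded A" and fA: "f ` A \<in> sets borel"
    and bd: "\<And>z. z \<in> A \<Longrightarrow> norm (deriv f z) \<le> B"
  shows "emeasure lborel (f ` A) = (\<integral>\<^sup>+z\<in>A. ennreal ((norm (deriv f z))\<^sup>2) \<partial>lborel)"
proof -
  define h where "h = (\<lambda>z. if z \<in> A then (norm (deriv f z))\<^sup>2 else 0)"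
  have cd: "continuous_on A (deriv f)"
    using f A(2) holomorphic_deriv holomorphic_on_imp_continuous_on continuous_on_subset by blast
  have hm [measurable]: "h \<in> borel_measurable borel"
    unfolding h_def
    by (rule borel_measurable_continuous_on_if) (use cd in \<open>auto intro!: continuous_intros\<close>)
  define A' where "A' = vec_of_complex ` A"
  have A'v: "A' = complex_of_vec -` A"
    unfolding A'_def by (metis (no_types, opaque_lifting) complex_of_vec_inverse vec_of_complex_inverse image_eqI vimageE vimageI2 subsetI antisym image_subsetI)
  define F where "F = (\<lambda>v. vec_of_complex (f (complex_of_vec v)))"
  define F' where "F' = (\<lambda>v w. vec_of_complex (deriv f (complex_of_vec v) * complex_of_vec w))"
  have A'b: "A' \<in> sets borel"
    using measurable_sets_borel[OF borel_measurable_complex_of_vec A(1)] A'v by simp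
  have der: "(F has_derivative F' v) (at v within A')" if "v \<in> A'" for v
  proof -
    have "complex_of_vec v \<in> S" using that A'v A(2) by auto
    then have 1: "(f has_derivative (\<lambda>h. deriv f (complex_of_vec v) * h)) (at (complex_of_vec v))"
      using f by (metis has_field_derivative_def holomorphic_derivI)
    have 2: "(complex_of_vec has_derivative complex_of_vec) (at v within A')"
      by (simp add: bounded_linear_complex_of_vec bounded_linear_imp_has_derivative)
    have 3: "((\<lambda>v. f (complex_of_vec v)) has_derivative (\<lambda>w. deriv f (complex_of_vec v) * complex_of_vec w)) (at v within A')"
      by (rule has_derivative_compose[OF 2 1, unfolded o_def])
    show ?thesis
      unfolding F_def F'_def
      by (rule bounded_linear.has_derivative[OF bounded_linear_vec_of_complex 3])
  qed
  have inj: "inj_on F A'"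
    using f(2) A(2) A'v unfolding F_def inj_on_def
    by (metis complex_of_vec_inverse vec_of_complex_inverse subsetD vimageD)
  have detF: "\<bar>det (matrix (F' v))\<bar> = h (complex_of_vec v)" if "v \<in> A'" for v
    using that A'v by (simp add: F'_def det_complex_mult h_def)
  have bdd: "bounded A'"
    using A(3) by (auto simp: A'_def bounded_iff)
  have A'lm: "A' \<in> lmeasurable"
    using A'b bdd by (simp add: bounded_set_imp_lmeasurable)
  have hle: "\<bar>h z\<bar> \<le> B\<^sup>2" for z
    unfolding h_def using bd by (auto intro: power_mono)
  have int: "(\<lambda>v. h (complex_of_vec v)) absolutely_integrable_on A'"
  proof (rule measurable_bounded_by_integrable_imp_absolutely_integrable)
    show "(\<lambda>v. h (complex_of_vec v)) \<in> borel_measurable (lebesgue_on A')"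
      by (intro measurable_restrict_space1 measurable_completion) measurable
    show "A' \<in> sets lebesgue" using A'lm by auto
    show "(\<lambda>v. B\<^sup>2) integrable_on A'"
      using A'lm by (rule integrable_on_const)
  qed (use hle in auto)
  have int': "(\<lambda>v. \<bar>det (matrix (F' v))\<bar>) integrable_on A'"
    using integrable_eq[OF set_lebesgue_integral_eq_integral(1)[OF int]] detF by simp
  have L: "F ` A' \<in> lmeasurable \<and> measure lebesgue (F ` A') = integral A' (\<lambda>v. \<bar>det (matrix (F' v))\<bar>)"
    using has_measure_differentiable_image[OF _ der inj] int' A'lm by (meson fmeasurableD integrable_integral)
  have FA: "F ` A' = complex_of_vec -` (f ` A)"
    unfolding F_def A'_def by (auto simp: image_image image_iff) (metis complex_of_vec_inverse)
  have "emeasure lborel (f ` A) = emeasure lborel (F ` A')"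
    by (subst distr_complex_of_vec[symmetric], subst emeasure_distr) (auto simp: fA FA)
  also have "\<dots> = emeasure lebesgue (F ` A')"
    by (simp add: FA emeasure_completion measurable_sets_borel[OF borel_measurable_complex_of_vec fA])
  also have "\<dots> = ennreal (integral A' (\<lambda>v. \<bar>det (matrix (F' v))\<bar>))"
    using L by (simp add: emeasure_eq_measure2)
  also have "integral A' (\<lambda>v. \<bar>det (matrix (F' v))\<bar>) = integral A' (\<lambda>v. h (complex_of_vec v))"
    by (rule integral_cong) (simp add: detF)
  also have "ennreal \<dots> = (\<integral>\<^sup>+v. ennreal (h (complex_of_vec v)) \<partial>lborel)"
  proof -
    have h0: "h (complex_of_vec v) = (if v \<in> A' then h (complex_of_vec v) else 0)" for v
      by (simp add: A'v h_def)
    have "((\<lambda>v. h (complex_of_vec v)) has_integral integral A' (\<lambda>v. h (complex_of_vec v))) UNIV"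
      by (subst h0, subst has_integral_restrict_UNIV)
        (use int in \<open>simp add: absolutely_integrable_on_def integrable_integral\<close>)
    moreover have "(\<lambda>v. h (complex_of_vec v)) \<in> borel_measurable borel"
      by measurable
    moreover have "0 \<le> h z" for z
      by (simp add: h_def)
    ultimately show ?thesis
      by (intro nn_integral_has_integral_lborel [symmetric])
  qed
  also have "\<dots> = (\<integral>\<^sup>+z. ennreal (h z) \<partial>lborel)"
    by (subst nn_integral_complex_of_vec) auto
  also have "\<dots> = (\<integral>\<^sup>+z\<in>A. ennreal ((norm (deriv f z))\<^sup>2) \<partial>lborel)"
    by (intro nn_integral_cong) (auto simp: h_def indicator_def)
  finally show ?thesis .
qed

text \<open>Images of Borel sets are Borel because they are preimages under the holomorphic inverse.
  For the area, \<open>A\<close> is cut into countably many disjoint pieces on which both z and the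
  derivative are bounded.\<close>

lemma emeasure_conformal_image:
  assumes f: "f holomorphic_on S" "inj_on f S" "open S"
    and A [measurable]: "A \<in> sets borel" "A \<subseteq> S"
  shows "f ` A \<in> sets borel"
    and "emeasure lborel (f ` A) = (\<integral>\<^sup>+z\<in>A. ennreal ((norm (deriv f z))\<^sup>2) \<partial>lborel)"
proof -
  have of: "open (f ` S)" 
    using open_mapping_thm3[OF f(1,3,2)] .
  obtain g where g: "g holomorphic_on (f ` S)" "\<And>z. z \<in> S \<Longrightarrow> g (f z) = z"
    using holomorphic_has_inverse[OF f(1,3,2)] by metis
  have im: "f ` B \<in> sets borel" if B: "B \<in> sets borel" "B \<subseteq> S" for B
  proof -
    have "f ` B = g -` B \<inter> f ` S" using g B by (auto simp: subset_iff image_iff) 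
    moreover have "g -` B \<inter> f ` S \<in> sets borel"
    proof -
      have "continuous_on (f ` S) g" using g(1) holomorphic_on_imp_continuous_on by blast
      then have "g \<in> borel_measurable (restrict_space borel (f ` S))"
        by (rule borel_measurable_continuous_on_restrict)
      then have "g -` B \<inter> space (restrict_space borel (f ` S)) \<in> sets (restrict_space borel (f ` S))"
        using B(1) by (rule measurable_sets)
      then show ?thesis using of by (auto simp: space_restrict_space sets_restrict_space_iff borel_open)
    qed
    ultimately show ?thesis by simp
  qed
  show "f ` A \<in> sets borel" using im A by auto
  have cd: "continuous_on S (deriv f)"
    using f holomorphic_deriv holomorphic_on_imp_continuous_on by blast
  define h where "h = (\<lambda>z. if z \<in> S then norm (deriv f z) else 0)"
  have hm [measurable]: "h \<in> borel_measurable borel"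
    unfolding h_def
    by (rule borel_measurable_continuous_on_if) (use cd f(3) in \<open>auto intro!: continuous_intros\<close>)
  define D where "D = (\<lambda>n. {z \<in> A. norm z \<le> real n \<and> h z \<le> real n})"
  define E where "E = disjointed D"
  have D [measurable]: "D n \<in> sets borel" for n
    unfolding D_def by measurable
  have E [measurable]: "E n \<in> sets borel" for n
    unfolding E_def using sets.range_disjointed_sets[of D borel] D by blast
  have ED: "E n \<subseteq> D n" for n
    unfolding E_def by (rule disjointed_subset)
  have dj: "disjoint_family E"
    unfolding E_def by (rule disjoint_family_disjointed)
  have UE: "(\<Union>n. E n) = A"
  proof -
    have "(\<Union>n. D n) = A"
    proof safe
      fix z assume "z \<in> A"
      obtain n where "max (norm z) (h z) \<le> real n" using real_arch_simple by blast
      then show "z \<in> (\<Union>n. D n)" using \<open>z \<in> A\<close> by (auto simp: D_def)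
    qed (auto simp: D_def)
    then show ?thesis unfolding E_def by (simp add: UN_disjointed_eq)
  qed
  have ES: "E n \<subseteq> S" for n using UE A(2) by auto
  have dj': "disjoint_family (\<lambda>n. f ` E n)"
    unfolding disjoint_family_on_def
  proof (intro ballI impI)
    fix m n :: nat assume "m \<noteq> n"
    then have "E m \<inter> E n = {}" using dj by (auto simp: disjoint_family_on_def)
    then show "f ` E m \<inter> f ` E n = {}"
      using inj_on_image_Int[OF f(2) ES ES, of m n] by simp
  qed
  have "emeasure lborel (f ` A) = emeasure lborel (\<Union>n. f ` E n)"
    by (simp add: UE[symmetric] image_UN)
  also have "\<dots> = (\<Sum>n. emeasure lborel (f ` E n))"
    by (rule suminf_emeasure[symmetric]) (use im E ES dj' in auto)
  also have "\<dots> = (\<Sum>n. \<integral>\<^sup>+z\<in>E n. ennreal ((norm (deriv f z))\<^sup>2) \<partial>lborel)"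
  proof (rule suminf_cong)
    fix n
    show "emeasure lborel (f ` E n) = (\<integral>\<^sup>+z\<in>E n. ennreal ((norm (deriv f z))\<^sup>2) \<partial>lborel)"
    proof (rule emeasure_conformal_image_bounded[OF f E ES])
      show "bounded (E n)" using ED[of n] by (auto simp: D_def bounded_iff)
      show "f ` E n \<in> sets borel" by (rule im[OF E ES])
      show "norm (deriv f z) \<le> real n" if "z \<in> E n" for z
        using that ED[of n] A(2) by (auto simp: D_def h_def split: if_splits)
    qed
  qed
  also have "\<dots> = (\<Sum>n. \<integral>\<^sup>+z\<in>E n. ennreal ((h z)\<^sup>2) \<partial>lborel)"
    using ES by (intro suminf_cong nn_integral_cong) (auto simp: h_def indicator_def)
  also have "\<dots> = (\<integral>\<^sup>+z\<in>(\<Union>n. E n). ennreal ((h z)\<^sup>2) \<partial>lborel)"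
    by (rule nn_integral_disjoint_family[symmetric]) (use dj in auto)
  also have "\<dots> = (\<integral>\<^sup>+z\<in>A. ennreal ((norm (deriv f z))\<^sup>2) \<partial>lborel)"
    using A(2) unfolding UE by (intro nn_integral_cong) (auto simp: h_def indicator_def)
  finally show "emeasure lborel (f ` A) = (\<integral>\<^sup>+z\<in>A. ennreal ((norm (deriv f z))\<^sup>2) \<partial>lborel)" .
qed

text \<open>The area formula says that Lebesgue measure on the image is the push-forward of |f'|^2
  dz; integrating \<open>H\<close> against both descriptions of this measure gives the
  claim.\<close>

lemma nn_integral_conformal_image:
  assumes f: "f holomorphic_on S" "inj_on f S" "open S"
    and H [measurable]: "H \<in> borel_measurable borel"
  shows "(\<integral>\<^sup>+w\<in>f ` S. H w \<partial>lborel) = (\<integral>\<^sup>+z\<in>S. H (f z) * ennreal ((norm (deriv f z))\<^sup>2) \<partial>lborel)"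
proof -
  have of: "open (f ` S)" 
    using open_mapping_thm3[OF f(1,3,2)] .
  have [measurable]: "S \<in> sets borel" "f ` S \<in> sets borel"
    using f of by auto
  define h where "h = (\<lambda>z. if z \<in> S then (norm (deriv f z))\<^sup>2 else 0)"
  have cd: "continuous_on S (deriv f)"
    using f holomorphic_deriv holomorphic_on_imp_continuous_on by blast
  have hm [measurable]: "h \<in> borel_measurable borel"
    unfolding h_def
    by (rule borel_measurable_continuous_on_if) (use cd f(3) in \<open>auto intro!: continuous_intros\<close>)
  \<comment> \<open>Extension by 0 makes \<open>F\<close> Borel on the whole plane; the density
    \<open>h\<close> vanishes outside \<open>S\<close>, so the values there do not count.\<close>
  define F where "F = (\<lambda>z. if z \<in> S then f z else 0)"
  have Fm [measurable]: "F \<in> borel_measurable borel"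
    unfolding F_def
    by (rule borel_measurable_continuous_on_if)
      (use f in \<open>auto intro!: continuous_intros holomorphic_on_imp_continuous_on\<close>)
  have eq: "density lborel (indicator (f ` S)) = distr (density lborel (\<lambda>z. ennreal (h z))) borel F"
  proof (rule measure_eqI)
    fix B assume "B \<in> sets (density lborel (indicator (f ` S)))"
    then have B [measurable]: "B \<in> sets borel" by simp
    define A where "A = F -` B \<inter> S"
    have A [measurable]: "A \<in> sets borel"
      unfolding A_def using measurable_sets_borel[OF Fm B] by auto
    have "emeasure (density lborel (indicator (f ` S))) B = emeasure lborel (f ` S \<inter> B)"
      by (subst emeasure_density) (auto simp: nn_integral_indicator[symmetric] indicator_inter_arith simp del: nn_integral_indicator)
    also have "f ` S \<inter> B = f ` A"
      by (auto simp: A_def F_def)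
    also have "emeasure lborel (f ` A) = (\<integral>\<^sup>+z\<in>A. ennreal ((norm (deriv f z))\<^sup>2) \<partial>lborel)"
      by (rule emeasure_conformal_image[OF f A]) (auto simp: A_def)
    also have "\<dots> = (\<integral>\<^sup>+z. ennreal (h z) * indicator (F -` B) z \<partial>lborel)"
      by (intro nn_integral_cong) (auto simp: h_def A_def indicator_def)
    also have "\<dots> = emeasure (distr (density lborel (\<lambda>z. ennreal (h z))) borel F) B"
      using measurable_sets_borel[OF Fm B]
      by (subst emeasure_distr) (auto simp: emeasure_density)
    finally show "emeasure (density lborel (indicator (f ` S))) B
      = emeasure (distr (density lborel (\<lambda>z. ennreal (h z))) borel F) B" .
  qed simp
  have "(\<integral>\<^sup>+w\<in>f ` S. H w \<partial>lborel) = (\<integral>\<^sup>+w. H w \<partial>density lborel (indicator (f ` S)))"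
    by (simp add: nn_integral_density mult.commute)
  also have "\<dots> = (\<integral>\<^sup>+z. ennreal (h z) * H (F z) \<partial>lborel)"
    by (simp add: eq nn_integral_distr nn_integral_density)
  also have "\<dots> = (\<integral>\<^sup>+z\<in>S. H (f z) * ennreal ((norm (deriv f z))\<^sup>2) \<partial>lborel)"
    by (intro nn_integral_cong) (auto simp: h_def F_def indicator_def mult.commute)
  finally show ?thesis .
qed

lemma nn_integral_complex_iterated:
  assumes [measurable]: "H \<in> borel_measurable borel"
  shows "(\<integral>\<^sup>+z. H z \<partial>lborel) = (\<integral>\<^sup>+y. (\<integral>\<^sup>+x. H (Complex x y) \<partial>lborel) \<partial>lborel)"
proof -
  have C: "(\<lambda>(x,y). Complex x y) \<in> borel_measurable (borel :: (real\<times>real) measure)"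
    by (intro borel_measurable_continuous_onI)
      (auto simp: case_prod_beta Complex_eq intro!: continuous_intros)
  then have C' [measurable]: "(\<lambda>(x,y). Complex x y) \<in> borel_measurable (lborel \<Otimes>\<^sub>M lborel)"
    by (simp add: lborel_prod)
  have d: "lborel = distr (lborel :: (real\<times>real) measure) borel (\<lambda>(x,y). Complex x y)"
  proof (rule lborel_eqI)
    fix l u :: complex
    assume lu: "\<And>b. b \<in> Basis \<Longrightarrow> l \<bullet> b \<le> u \<bullet> b"
    have vim: "(\<lambda>(x,y). Complex x y) -` box l u = box (Re l, Im l) (Re u, Im u)"
      by (auto simp: box_def Basis_complex_def Basis_prod_def)
    have "emeasure (distr (lborel :: (real\<times>real) measure) borel (\<lambda>(x,y). Complex x y)) (box l u)
        = emeasure lborel (box (Re l, Im l) (Re u, Im u))"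
      using C by (subst emeasure_distr) (auto simp: vim)
    also have "\<dots> = (\<Prod>b\<in>Basis. (u - l) \<bullet> b)"
    proof -
      have B: "(Basis :: (real\<times>real) set) = {(1,0), (0,1)}"
        by (auto simp: Basis_prod_def)
      have "(Re l, Im l) \<bullet> b \<le> (Re u, Im u) \<bullet> b" if "b \<in> Basis" for b
        using lu[of 1] lu[of \<i>] that by (auto simp: Basis_complex_def B)
      moreover have "(\<Prod>b\<in>Basis. ((Re u, Im u) - (Re l, Im l)) \<bullet> b) = (\<Prod>b\<in>Basis. (u - l) \<bullet> b)"
        unfolding B by (subst prod.insert) (auto simp: Basis_complex_def)
      ultimately show ?thesis
        by (simp add: emeasure_lborel_box)
    qed
    finally show "emeasure (distr lborel borel (\<lambda>(x, y). Complex x y)) (box l u) = (\<Prod>b\<in>Basis. (u - l) \<bullet> b)" .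
  qed simp
  have "(\<integral>\<^sup>+z. H z \<partial>lborel) = (\<integral>\<^sup>+p. H ((\<lambda>(x,y). Complex x y) p) \<partial>(lborel :: (real\<times>real) measure))"
    using C by (subst d, subst nn_integral_distr) auto
  also have "\<dots> = (\<integral>\<^sup>+p. H ((\<lambda>(x,y). Complex x y) p) \<partial>(lborel \<Otimes>\<^sub>M lborel))"
    by (simp add: lborel_prod)
  also have "\<dots> = (\<integral>\<^sup>+y. (\<integral>\<^sup>+x. H (Complex x y) \<partial>lborel) \<partial>lborel)"
    by (subst lborel_pair.nn_integral_snd[symmetric]) auto
  finally show ?thesis .
qed

lemma emeasure_lborel_Reals_nonpos: "emeasure lborel {z::complex. Im z = 0 \<and> Re z \<le> 0} = 0"
proof -
  have "emeasure lborel {z::complex. Im z = 0 \<and> Re z \<le> 0} \<le> emeasure lborel {z::complex. \<i> \<bullet> z = 0}"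
    by (intro emeasure_mono) auto
  also have "\<dots> = 0"
  proof -
    have "negligible {z::complex. \<i> \<bullet> z = 0}" by (rule negligible_hyperplane) auto
    then have "emeasure lebesgue {z::complex. \<i> \<bullet> z = 0} = 0"
      by (simp add: negligible_iff_null_sets null_sets_def)
    moreover have "{z::complex. \<i> \<bullet> z = 0} \<in> sets lborel" by measurable
    ultimately show ?thesis by (simp add: emeasure_completion)
  qed
  finally show ?thesis by simp
qed

text \<open>\<open>exp\<close> is injective on the strip |Im w| < pi, its image is the plane without
  the null set of nonpositive reals, and its Jacobian is |exp w|^2 = exp (2 Re w). Logarithmic polar
  coordinates are preferred because dilations of the plane become translations in \<sigma>.\<close>

lemma nn_integral_log_polar:
  assumes H [measurable]: "H \<in> borel_measurable borel"
  shows "(\<integral>\<^sup>+z. H z \<partial>lborel)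
    = (\<integral>\<^sup>+\<theta>\<in>{-pi<..<pi}. (\<integral>\<^sup>+\<sigma>. H (exp (Complex \<sigma> \<theta>)) * ennreal (exp (2*\<sigma>)) \<partial>lborel) \<partial>lborel)"
proof -
  define S where "S = {w::complex. -pi < Im w \<and> Im w < pi}"
  have oS: "open S" unfolding S_def
    by (intro open_Collect_conj open_Collect_less continuous_intros)
  have img: "exp ` S = - {z::complex. Im z = 0 \<and> Re z \<le> 0}"
  proof -
    have "False" if w: "w \<in> S" "Im (exp w) = 0" "Re (exp w) \<le> 0" for w
    proof -
      have "exp w \<in> \<real>\<^sub>\<le>\<^sub>0" using w by (simp add: complex_nonpos_Reals_iff)
      moreover have "Ln (exp w) = w" using w by (simp add: S_def)
      ultimately show False
        using w(1) Im_Ln_less_pi[of "exp w"] unfolding S_def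
        by (metis (mono_tags, lifting) Im_Ln_eq_pi exp_not_eq_zero less_irrefl mem_Collect_eq w(2,3)
            complex_eq_iff zero_complex.sel order_le_less)
    qed
    moreover have "z \<in> exp ` S" if "\<not> (Im z = 0 \<and> Re z \<le> 0)" for z :: complex
    proof -
      have n: "z \<notin> \<real>\<^sub>\<le>\<^sub>0" using that by (auto simp: complex_nonpos_Reals_iff)
      then have "z \<noteq> 0" by auto
      with n have "Ln z \<in> S"
        using mpi_less_Im_Ln[of z] Im_Ln_less_pi[of z] by (auto simp: S_def)
      with \<open>z \<noteq> 0\<close> show "z \<in> exp ` S" by (metis exp_Ln imageI)
    qed
    ultimately show ?thesis by blast
  qed
  have inj: "inj_on exp S"
    unfolding S_def by (rule inj_onI) (metis (mono_tags, lifting) Ln_exp less_imp_le mem_Collect_eq)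
  have "(\<integral>\<^sup>+z. H z \<partial>lborel) = (\<integral>\<^sup>+z\<in>exp ` S. H z \<partial>lborel)"
  proof (rule nn_integral_cong_AE)
    have "{z::complex. Im z = 0 \<and> Re z \<le> 0} \<in> null_sets lborel"
      using emeasure_lborel_Reals_nonpos by (auto simp: null_sets_def)
    then show "AE z in lborel. H z = H z * indicator (exp ` S) z"
      by (rule AE_I') (auto simp: img indicator_def)
  qed
  also have "\<dots> = (\<integral>\<^sup>+w\<in>S. H (exp w) * ennreal ((norm (deriv exp w))\<^sup>2) \<partial>lborel)"
    by (rule nn_integral_conformal_image) (use inj oS in \<open>auto intro: holomorphic_intros\<close>)
  also have "\<dots> = (\<integral>\<^sup>+w. H (exp w) * ennreal (exp (2 * Re w)) * indicator S w \<partial>lborel)"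
  proof (rule nn_integral_cong)
    fix w :: complex
    have "deriv exp w = exp w" by (simp add: DERIV_imp_deriv)
    then show "H (exp w) * ennreal ((norm (deriv exp w))\<^sup>2) * indicator S w = H (exp w) * ennreal (exp (2 * Re w)) * indicator S w"
      by (simp add: exp_double)
  qed
  also have "\<dots> = (\<integral>\<^sup>+\<theta>. (\<integral>\<^sup>+\<sigma>. H (exp (Complex \<sigma> \<theta>)) * ennreal (exp (2*\<sigma>)) * indicator {-pi<..<pi} \<theta> \<partial>lborel) \<partial>lborel)"
  proof -
    have [measurable]: "S \<in> sets borel" using oS by auto
    show ?thesis
      by (subst nn_integral_complex_iterated) (auto simp: S_def indicator_def intro!: nn_integral_cong)
  qed
  also have "\<dots> = (\<integral>\<^sup>+\<theta>\<in>{-pi<..<pi}. (\<integral>\<^sup>+\<sigma>. H (exp (Complex \<sigma> \<theta>)) * ennreal (exp (2*\<sigma>)) \<partial>lborel) \<partial>lborel)"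
    by (intro nn_integral_cong) (auto simp: indicator_def)
  finally show ?thesis .
qed

section \<open>The Koebe estimate on star-shaped domains\<close>

text \<open>\<open>m\<close> moves 0 to z, and A \<mapsto> (A - G z) / (A + cnj (G z)) sends the
  right half-plane to the unit disc and \<open>G z\<close> to 0. The Schwarz lemma bounds the
  derivative at 0 of the composition \<open>H\<close>, which is G'(z) (1 - |z|^2) / (2 Re (G
  z)).\<close>

lemma Schwarz_Pick_half_plane_strict:
  assumes G: "G holomorphic_on ball 0 1" and pos: "\<And>w. w \<in> ball 0 1 \<Longrightarrow> Re (G w) > 0"
    and z: "z \<in> ball 0 1"
  shows "(1 - (norm z)\<^sup>2) * norm (deriv G z) \<le> 2 * Re (G z)"
proof -
  define m where "m = Moebius_function 0 (- z)"
  have z1: "norm z < 1" "norm (-z) < 1" using z by auto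
  have m0: "m 0 = z" by (simp add: m_def Moebius_function_of_zero)
  have mb: "m w \<in> ball 0 1" if "w \<in> ball 0 1" for w
    using Moebius_function_norm_lt_1[OF z1(2), of w 0] that by (simp add: m_def)
  have mh: "m holomorphic_on ball 0 1"
    unfolding m_def by (rule Moebius_function_holomorphic) (use z1 in auto)
  have dm: "(m has_field_derivative of_real (1 - (norm z)\<^sup>2)) (at 0)"
  proof -
    have "m = (\<lambda>w. (w + z) / (1 + cnj z * w))"
      by (auto simp: m_def Moebius_function_simple)
    moreover have "((\<lambda>w. (w + z) / (1 + cnj z * w)) has_field_derivative of_real (1 - (norm z)\<^sup>2)) (at 0)"
      by (rule derivative_eq_intros refl | simp)+ (simp add: complex_norm_square[symmetric] flip: of_real_power)
    ultimately show ?thesis by simp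
  qed
  have dG: "(G has_field_derivative deriv G z) (at (m 0))"
    using G z unfolding m0 by (metis holomorphic_derivI open_ball)
  define H where "H = (\<lambda>w. (G (m w) - G z) / (G (m w) + cnj (G z)))"
  have ne: "G (m w) + cnj (G z) \<noteq> 0" if "w \<in> ball 0 1" for w
  proof -
    have "Re (G (m w) + cnj (G z)) > 0" using pos[OF mb[OF that]] pos[OF z] by simp
    then show ?thesis by (metis less_irrefl zero_complex.sel(1))
  qed
  have Gm: "(\<lambda>w. G (m w)) holomorphic_on ball 0 1"
    using holomorphic_on_compose_gen[OF mh G] mb by (simp add: o_def image_subset_iff)
  have Hh: "H holomorphic_on ball 0 1"
    unfolding H_def by (intro holomorphic_intros Gm ne)
  have H0: "H 0 = 0" by (simp add: H_def m0)
  have Hlt: "norm (H w) < 1" if "norm w < 1" for w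
  proof -
    define A where "A = G (m w)"
    define B where "B = G z"
    have "Re A > 0" "Re B > 0" using pos[OF mb] pos[OF z] that by (auto simp: A_def B_def)
    then have "Re A * Re B > 0" by simp
    \<comment> \<open>The two squares differ by 4 Re A Re B.\<close>
    then have "(norm (A - B))\<^sup>2 < (norm (A + cnj B))\<^sup>2"
      unfolding cmod_power2 by (simp add: power2_eq_square algebra_simps)
    then have "norm (A - B) < norm (A + cnj B)"
      by (rule power_less_imp_less_base) simp
    then show ?thesis
      using ne[of w] that by (simp add: H_def norm_divide A_def B_def)
  qed
  have "norm (deriv H 0) \<le> 1"
    by (rule Schwarz_Lemma(2)[OF Hh H0 Hlt, of 0]) auto
  moreover have "(H has_field_derivative (deriv G z * of_real (1 - (norm z)\<^sup>2) / of_real (2 * Re (G z)))) (at 0)"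
  proof -
    have c: "((\<lambda>w. G (m w)) has_field_derivative (deriv G z * of_real (1 - (norm z)\<^sup>2))) (at 0)"
      by (rule DERIV_chain2[OF dG dm])
    have n0: "G z + cnj (G z) \<noteq> 0" using ne[of 0] by (simp add: m0)
    have "(H has_field_derivative ((deriv G z * of_real (1 - (norm z)\<^sup>2)) * (G (m 0) + cnj (G z)) - (G (m 0) - G z) * (deriv G z * of_real (1 - (norm z)\<^sup>2)))
       / ((G (m 0) + cnj (G z)) * (G (m 0) + cnj (G z)))) (at 0)"
      unfolding H_def by (rule derivative_eq_intros c refl | use ne[of 0] in simp)+
    moreover have "G z + cnj (G z) = of_real (2 * Re (G z))" by (simp add: complex_add_cnj)
    moreover have "(X * B - (G z - G z) * X) / (B * B) = X / B" if "B \<noteq> 0" for X B :: complex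
      using that by simp
    ultimately show ?thesis using n0 by (metis m0)
  qed
  ultimately have "norm (deriv G z * of_real (1 - (norm z)\<^sup>2) / of_real (2 * Re (G z))) \<le> 1"
    using DERIV_imp_deriv by metis
  moreover have "(norm z)\<^sup>2 \<le> 1" using z1 by (simp add: power_le_one)
  ultimately show ?thesis
    using pos[OF z] by (simp add: norm_mult norm_divide divide_le_eq mult.commute del: of_real_diff of_real_mult of_real_power)
qed

text \<open>Adding a small positive constant to \<open>G\<close> leads to the strict case. The weak
  form suits the cone estimate, whose bound on the argument is not strict.\<close>

lemma Schwarz_Pick_half_plane:
  assumes G: "G holomorphic_on ball 0 1" and pos: "\<And>w. w \<in> ball 0 1 \<Longrightarrow> Re (G w) \<ge> 0"
    and z: "z \<in> ball 0 1"
  shows "(1 - (norm z)\<^sup>2) * norm (deriv G z) \<le> 2 * Re (G z)"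
proof (rule field_le_epsilon)
  fix e :: real assume e: "e > 0"
  have "deriv (\<lambda>w. G w + of_real (e/2)) z = deriv G z"
    using G z by (subst deriv_add) (auto intro: holomorphic_on_imp_differentiable_at[OF _ open_ball])
  moreover have "(1 - (norm z)\<^sup>2) * norm (deriv (\<lambda>w. G w + of_real (e/2)) z) \<le> 2 * Re (G z + of_real (e/2))"
  proof (rule Schwarz_Pick_half_plane_strict[OF _ _ z])
    show "(\<lambda>w. G w + of_real (e/2)) holomorphic_on ball 0 1" by (intro holomorphic_intros G)
    show "Re (G w + of_real (e/2)) > 0" if "w \<in> ball 0 1" for w using pos[OF that] e by simp
  qed
  ultimately show "(1 - (norm z)\<^sup>2) * norm (deriv G z) \<le> 2 * Re (G z) + e" by simp
qed

text \<open>From a point \<open>p\<close> at distance at most R from the centre, the disc is seen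
  under a half-angle of at least \<epsilon>. If \<open>y\<close> lay in the cone of that half-angle
  behind \<open>p\<close>, the line from \<open>y\<close> through \<open>p\<close> would enter the
  disc, and star-shapedness would put \<open>p\<close> into \<Omega>.\<close>

lemma Arg_avoids_exterior_cone:
  fixes a p y :: complex
  assumes st: "\<And>x y. x \<in> \<Omega> \<Longrightarrow> y \<in> ball a r \<Longrightarrow> closed_segment x y \<subseteq> \<Omega>"
    and y: "y \<in> \<Omega>" and p: "p \<notin> \<Omega>" "norm (p - a) \<le> R"
    and \<epsilon>: "0 < \<epsilon>" "\<epsilon> \<le> pi/2" "R * sin \<epsilon> = r" and R: "R > 0" and ap: "a \<noteq> p"
  shows "\<bar>Arg ((y - p) / (a - p))\<bar> \<le> pi - \<epsilon>"
proof (rule ccontr)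
  define q where "q = (y - p) / (a - p)"
  define \<theta> where "\<theta> = Arg q"
  assume "\<not> \<bar>Arg ((y - p) / (a - p))\<bar> \<le> pi - \<epsilon>"
  then have th: "\<bar>\<theta>\<bar> > pi - \<epsilon>" by (simp add: \<theta>_def q_def)
  have q0: "q \<noteq> 0" using y p ap by (auto simp: q_def)
  \<comment> \<open>\<open>\<alpha>\<close> is the argument of -q: the direction from
    \<open>p\<close> away from \<open>y\<close>, measured against the direction from
    \<open>p\<close> to the centre.\<close>
  define \<alpha> where "\<alpha> = (if \<theta> > 0 then \<theta> - pi else \<theta> + pi)"
  have "-pi < \<theta>" "\<theta> \<le> pi" using Arg_bounded[of q] by (auto simp: \<theta>_def)
  then have \<alpha>: "\<bar>\<alpha>\<bar> < \<epsilon>" using th by (auto simp: \<alpha>_def)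
  have cis: "cis \<alpha> = - cis \<theta>"
    by (auto simp: \<alpha>_def complex_eq_iff)
  have qe: "q = - of_real (norm q) * cis \<alpha>"
    using q0 by (simp add: cis \<theta>_def cis_Arg sgn_eq)
  have c: "cos \<alpha> > 0" using \<alpha> \<epsilon> by (intro cos_gt_zero_pi) auto
  \<comment> \<open>\<open>\<zeta>\<close> is the foot of the perpendicular from the centre to the
    ray that starts at \<open>p\<close> and points away from \<open>y\<close>; its distance to the
    centre is |p - a| |sin \<alpha>| < r.\<close>
  define \<zeta> where "\<zeta> = p + (a - p) * of_real (cos \<alpha>) * cis \<alpha>"
  have n1: "(norm (of_real (cos \<alpha>) * cis \<alpha> - 1))\<^sup>2 = (sin \<alpha>)\<^sup>2"
  proof -
    have "(norm (of_real (cos \<alpha>) * cis \<alpha> - 1))\<^sup>2 = (cos \<alpha> * cos \<alpha> - 1)\<^sup>2 + (cos \<alpha> * sin \<alpha>)\<^sup>2"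
      by (simp add: cmod_power2)
    also have "\<dots> = (1 - (cos \<alpha>)\<^sup>2)\<^sup>2 + (cos \<alpha>)\<^sup>2 * (sin \<alpha>)\<^sup>2" by (simp add: power2_eq_square algebra_simps)
    also have "1 - (cos \<alpha>)\<^sup>2 = (sin \<alpha>)\<^sup>2" by (simp add: sin_squared_eq)
    also have "((sin \<alpha>)\<^sup>2)\<^sup>2 + (cos \<alpha>)\<^sup>2 * (sin \<alpha>)\<^sup>2 = (sin \<alpha>)\<^sup>2 * ((sin \<alpha>)\<^sup>2 + (cos \<alpha>)\<^sup>2)"
      by algebra
    finally show ?thesis by simp
  qed
  then have n2: "norm (of_real (cos \<alpha>) * cis \<alpha> - 1) = \<bar>sin \<alpha>\<bar>"
    by (metis abs_norm_cancel real_sqrt_abs)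
  have sl: "\<bar>sin \<alpha>\<bar> < sin \<epsilon>"
  proof -
    have "sin \<bar>\<alpha>\<bar> < sin \<epsilon>" using \<alpha> \<epsilon> by (intro sin_monotone_2pi) auto
    moreover have "\<bar>sin \<alpha>\<bar> = sin \<bar>\<alpha>\<bar>"
      using \<alpha> \<epsilon> sin_ge_zero[of "\<bar>\<alpha>\<bar>"] by (cases "\<alpha> \<ge> 0") auto
    ultimately show ?thesis by simp
  qed
  have "\<zeta> - a = (a - p) * (of_real (cos \<alpha>) * cis \<alpha> - 1)"
    by (simp add: \<zeta>_def algebra_simps)
  then have "norm (\<zeta> - a) = norm (p - a) * \<bar>sin \<alpha>\<bar>"
    by (simp only: norm_mult n2 norm_minus_commute[of a p])
  also have "\<dots> \<le> R * \<bar>sin \<alpha>\<bar>" using p by (simp add: mult_right_mono)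
  also have "\<dots> < R * sin \<epsilon>" using sl R by simp
  finally have \<zeta>: "\<zeta> \<in> ball a r" using \<epsilon> by (simp add: dist_norm norm_minus_commute)
  \<comment> \<open>\<open>y\<close> and \<open>\<zeta>\<close> lie on a line through
    \<open>p\<close>, on opposite sides, at distances proportional to norm q and cos \<alpha>; the
    weight makes \<open>p\<close> the corresponding convex combination.\<close>
  define t where "t = norm q / (norm q + cos \<alpha>)"
  have t: "0 \<le> t" "t \<le> 1" using c by (auto simp: t_def field_simps add_nonneg_pos)
  have tt: "(1 - t) * norm q = t * cos \<alpha>"
  proof -
    have "norm q + cos \<alpha> > 0" using c by (simp add: add_nonneg_pos)
    then show ?thesis by (simp add: t_def divide_simps)
  qed
  have yp: "y = p + (a - p) * q" using ap by (simp add: q_def)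
  have "p = (1 - t) *\<^sub>R y + t *\<^sub>R \<zeta>"
  proof -
    have "(1 - t) *\<^sub>R y + t *\<^sub>R \<zeta> = p + (a - p) * cis \<alpha> * of_real (t * cos \<alpha> - (1 - t) * norm q)"
      unfolding yp \<zeta>_def by (subst qe) (simp add: scaleR_conv_of_real algebra_simps)
    then show ?thesis by (simp add: tt)
  qed
  then have "p \<in> closed_segment y \<zeta>" using t by (auto simp: closed_segment_def)
  then show False using st[OF y \<zeta>] p by auto
qed

lemma Koebe_star_shaped:
  fixes a :: complex
  assumes \<Omega>: "open \<Omega>" "\<Omega> \<subseteq> ball a R"
    and st: "\<And>x y. x \<in> \<Omega> \<Longrightarrow> y \<in> ball a r \<Longrightarrow> closed_segment x y \<subseteq> \<Omega>"
    and a: "a \<in> \<Omega>"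
    and \<epsilon>: "0 < \<epsilon>" "\<epsilon> \<le> pi/2" "R * sin \<epsilon> = r"
    and f: "f holomorphic_on ball 0 1" "f ` ball 0 1 \<subseteq> \<Omega>" and z: "z \<in> ball 0 1"
  shows "(1 - (norm z)\<^sup>2) * norm (deriv f z) \<le> 4 * (1 - \<epsilon> / pi) * infdist (f z) (frontier \<Omega>)"
proof -
  have R: "R > 0" using a \<Omega> by (metis ball_eq_empty empty_iff not_le subsetD)
  have "\<Omega> \<noteq> UNIV" using \<Omega>(2) bounded_ball[of a R] not_bounded_UNIV bounded_subset by blast
  then have "frontier \<Omega> \<noteq> {}" using a by (auto simp: frontier_eq_empty)
  \<comment> \<open>The nearest boundary point realises the distance and serves as the vertex of the
    exterior cone.\<close>
  then obtain p where p: "p \<in> frontier \<Omega>" "infdist (f z) (frontier \<Omega>) = dist (f z) p"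
    using infdist_attains_inf[OF frontier_closed] by metis
  have pn: "p \<notin> \<Omega>" using p(1) \<Omega>(1) by (simp add: frontier_def interior_open)
  have "p \<in> closure \<Omega>" using p(1) by (simp add: frontier_def)
  then have "p \<in> cball a R" using \<Omega>(2) by (metis closure_mono closure_ball R subsetD)
  then have pR: "norm (p - a) \<le> R" by (simp add: dist_norm norm_minus_commute)
  have ap: "a \<noteq> p" using a pn by auto
  define q where "q = (\<lambda>w. (f w - p) / (a - p))"
  have qh: "q holomorphic_on ball 0 1"
    unfolding q_def by (intro holomorphic_intros f) (use ap in auto)
  have arg: "\<bar>Arg (q w)\<bar> \<le> pi - \<epsilon>" if "w \<in> ball 0 1" for w
    unfolding q_def by (rule Arg_avoids_exterior_cone[OF st _ pn pR \<epsilon> R ap]) (use f that in auto)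
  have q0: "q w \<noteq> 0" if "w \<in> ball 0 1" for w
    using f(2) that pn ap unfolding q_def by (metis divide_eq_0_iff eq_iff_diff_eq_0 image_subset_iff)
  have qn: "q w \<notin> \<real>\<^sub>\<le>\<^sub>0" if "w \<in> ball 0 1" for w
  proof
    assume "q w \<in> \<real>\<^sub>\<le>\<^sub>0"
    then have "Arg (q w) = pi"
      using q0[OF that] by (metis Arg_eq_pi complex_nonpos_Reals_iff complex_eq_iff order_le_less zero_complex.sel)
    then show False using arg[OF that] \<epsilon> by simp
  qed
  \<comment> \<open>The exponent that opens the sector |Arg| \<le> pi - \<epsilon> to the right
    half-plane.\<close>
  define \<kappa> where "\<kappa> = pi / (2 * (pi - \<epsilon>))"
  have pe: "pi - \<epsilon> > 0" using \<epsilon> pi_gt_zero by linarith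
  have k: "\<kappa> > 0" using pe by (simp add: \<kappa>_def)
  define G where "G = (\<lambda>w. exp (of_real \<kappa> * Ln (q w)))"
  have Gh: "G holomorphic_on ball 0 1"
    unfolding G_def by (intro holomorphic_intros qh qn)
  have ReG: "Re (G w) \<ge> 0" if "w \<in> ball 0 1" for w
  proof -
    have "\<bar>\<kappa> * Arg (q w)\<bar> \<le> \<kappa> * (pi - \<epsilon>)"
      using arg[OF that] k by (simp add: abs_mult)
    also have "\<dots> = pi / 2" using pe unfolding \<kappa>_def by (simp add: divide_simps)
    finally have "\<bar>\<kappa> * Arg (q w)\<bar> \<le> pi/2" .
    then have "cos (\<kappa> * Arg (q w)) \<ge> 0" by (intro cos_ge_zero) auto
    then show ?thesis
      using q0[OF that] by (simp add: G_def Re_exp Arg_eq_Im_Ln)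
  qed
  have fd: "(f has_field_derivative deriv f z) (at z)"
    using f z by (metis holomorphic_derivI open_ball)
  have fz: "f z \<noteq> p" using q0[OF z] by (auto simp: q_def)
  have dG: "(G has_field_derivative G z * (of_real \<kappa> * (deriv f z / (f z - p)))) (at z)"
  proof -
    have 1: "(q has_field_derivative deriv f z / (a - p)) (at z)"
      unfolding q_def by (rule derivative_eq_intros fd refl | use ap in simp)+
    have 2: "((\<lambda>w. Ln (q w)) has_field_derivative inverse (q z) * (deriv f z / (a - p))) (at z)"
      by (rule DERIV_chain2[OF has_field_derivative_Ln[OF qn[OF z]] 1])
    have 3: "inverse (q z) * (deriv f z / (a - p)) = deriv f z / (f z - p)"
      using ap fz by (simp add: q_def)
    show ?thesis
      unfolding G_def by (rule derivative_eq_intros 2[unfolded 3] refl | simp)+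
  qed
  have "(1 - (norm z)\<^sup>2) * norm (deriv G z) \<le> 2 * Re (G z)"
    by (rule Schwarz_Pick_half_plane[OF Gh ReG z])
  \<comment> \<open>Since G'/G = \<kappa> f' / (f - p), replacing Re G by |G| lets \<open>G\<close>
    cancel from the estimate.\<close>
  also have "\<dots> \<le> 2 * norm (G z)" using complex_Re_le_cmod by simp
  finally have "(1 - (norm z)\<^sup>2) * (norm (G z) * (\<kappa> * (norm (deriv f z) / norm (f z - p)))) \<le> 2 * norm (G z)"
    using k by (simp add: DERIV_imp_deriv[OF dG] norm_mult norm_divide)
  then have "norm (G z) * ((1 - (norm z)\<^sup>2) * (\<kappa> * (norm (deriv f z) / norm (f z - p)))) \<le> norm (G z) * 2"
    by (simp add: mult_ac)
  moreover have "norm (G z) > 0" by (simp add: G_def)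
  ultimately have "(1 - (norm z)\<^sup>2) * (\<kappa> * (norm (deriv f z) / norm (f z - p))) \<le> 2"
    by (simp only: mult_le_cancel_left_pos)
  then have "(1 - (norm z)\<^sup>2) * norm (deriv f z) \<le> (2 / \<kappa>) * norm (f z - p)"
    using k fz by (simp add: field_simps)
  also have "2 / \<kappa> = 4 * (1 - \<epsilon> / pi)" using pe by (simp add: \<kappa>_def field_simps)
  also have "norm (f z - p) = infdist (f z) (frontier \<Omega>)" by (simp add: p(2) dist_norm)
  finally show ?thesis .
qed

section \<open>Weighted one-dimensional inequalities\<close>

text \<open>Fatou's lemma along intervals that exhaust the negative half-line. The remainder
  \<open>r A\<close> absorbs a boundary term at minus infinity; the thresholds \<open>a\<close> and
  \<open>b\<close> let the caller assume that the interval contains a prescribed point.\<close>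

lemma nn_integral_le_of_interval_integrals:
  fixes g h r :: "real \<Rightarrow> real"
  assumes g: "continuous_on {..<0} g" "\<And>x. x < 0 \<Longrightarrow> g x \<ge> 0"
    and h: "continuous_on {..<0} h" "\<And>x. x < 0 \<Longrightarrow> h x \<ge> 0"
    and le: "\<And>A B. A < a \<Longrightarrow> b < B \<Longrightarrow> A < B \<Longrightarrow> B < 0 \<Longrightarrow>
        integral {A..B} g \<le> integral {A..B} h + r A"
    and r: "(r \<longlongrightarrow> 0) at_bot" and b: "b < 0"
  shows "(\<integral>\<^sup>+x\<in>{..<0}. ennreal (g x) \<partial>lborel) \<le> (\<integral>\<^sup>+x\<in>{..<0}. ennreal (h x) \<partial>lborel)"
proof -
  \<comment> \<open>The summand 2 puts \<open>A k\<close> strictly below \<open>B k\<close> already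
    at k = 0, where \<open>B k\<close> is -1.\<close>
  define A where "A = (\<lambda>k::nat. - real k - 2)"
  define B where "B = (\<lambda>k::nat. - inverse (real (Suc k)))"
  have AB: "A k < B k" "B k < 0" for k
  proof -
    have "inverse (real (Suc k)) \<le> 1" by (simp add: field_simps)
    then show "A k < B k" by (simp add: A_def B_def)
    show "B k < 0" by (simp add: B_def)
  qed
  define G where "G = (\<lambda>x. if x < 0 then g x else 0)"
  define H where "H = (\<lambda>x. if x < 0 then h x else 0)"
  have Gm [measurable]: "G \<in> borel_measurable borel"
    unfolding G_def using borel_measurable_continuous_on_if[of "{..<0}" g "\<lambda>_. 0"] g by auto
  have Hm [measurable]: "H \<in> borel_measurable borel"
    unfolding H_def using borel_measurable_continuous_on_if[of "{..<0}" h "\<lambda>_. 0"] h by auto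
  have nn: "(\<integral>\<^sup>+x\<in>{A k..B k}. ennreal (F x) \<partial>lborel) = ennreal (integral {A k..B k} f)"
    if "continuous_on {..<0} f" "\<And>x. x < 0 \<Longrightarrow> f x \<ge> 0" "F = (\<lambda>x. if x < 0 then f x else 0)"
      "F \<in> borel_measurable borel" for f F k
  proof -
    have sub: "{A k..B k} \<subseteq> {..<0}" using AB[of k] by auto
    have "continuous_on {A k..B k} f" using that(1) sub continuous_on_subset by blast
    then have "(f has_integral integral {A k..B k} f) {A k..B k}"
      by (simp add: integrable_continuous_real integrable_integral)
    then have "(F has_integral integral {A k..B k} f) {A k..B k}"
      by (rule has_integral_eq[rotated]) (use sub that in auto)
    then show ?thesis
      using nn_integral_has_integral_lebesgue'[of "{A k..B k}" F "integral {A k..B k} f"] that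
      by (simp add: nn_integral_completion)
  qed
  have evA: "eventually (\<lambda>k. A k < a) sequentially"
  proof -
    obtain N where "- a < real N" using reals_Archimedean2 by blast
    then show ?thesis by (intro eventually_sequentiallyI[of N]) (auto simp: A_def)
  qed
  have evB: "eventually (\<lambda>k. b < B k) sequentially"
  proof -
    have "B \<longlonglongrightarrow> - 0" unfolding B_def by (intro tendsto_minus LIMSEQ_inverse_real_of_nat)
    then show ?thesis using b by (intro order_tendstoD(1)) auto
  qed
  have Abot: "filterlim A at_bot sequentially"
    unfolding A_def by real_asymp
  have rlim: "(\<lambda>k. r (A k)) \<longlonglongrightarrow> 0" using filterlim_compose[OF r Abot] .
  have "(\<integral>\<^sup>+x\<in>{..<0}. ennreal (g x) \<partial>lborel) = (\<integral>\<^sup>+x. ennreal (G x) \<partial>lborel)"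
    by (intro nn_integral_cong) (auto simp: G_def indicator_def)
  also have "\<dots> \<le> (\<integral>\<^sup>+x. liminf (\<lambda>k. ennreal (G x) * indicator {A k..B k} x) \<partial>lborel)"
  proof (rule nn_integral_mono)
    fix x :: real
    have "(\<lambda>k. ennreal (G x) * indicator {A k..B k} x) \<longlonglongrightarrow> ennreal (G x)"
    proof (cases "x < 0")
      case False
      then show ?thesis by (simp add: G_def)
    next
      case True
      have "eventually (\<lambda>k. A k < x) sequentially"
        using Abot by (simp add: filterlim_at_bot_dense)
      moreover have "eventually (\<lambda>k. x < B k) sequentially"
      proof -
        have "B \<longlonglongrightarrow> - 0" unfolding B_def by (intro tendsto_minus LIMSEQ_inverse_real_of_nat)
        then show ?thesis using True by (intro order_tendstoD(1)) auto
      qed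
      ultimately have "eventually (\<lambda>k. ennreal (G x) * indicator {A k..B k} x = ennreal (G x)) sequentially"
        by eventually_elim auto
      then show ?thesis by (rule tendsto_eventually)
    qed
    then show "ennreal (G x) \<le> liminf (\<lambda>k. ennreal (G x) * indicator {A k..B k} x)"
      by (simp add: lim_imp_Liminf)
  qed
  also have "\<dots> \<le> liminf (\<lambda>k. \<integral>\<^sup>+x. ennreal (G x) * indicator {A k..B k} x \<partial>lborel)"
    by (rule nn_integral_liminf) auto
  also have "\<dots> \<le> liminf (\<lambda>k. (\<integral>\<^sup>+x. ennreal (H x) \<partial>lborel) + ennreal (r (A k)))"
  proof (rule Liminf_mono)
    show "\<forall>\<^sub>F k in sequentially. (\<integral>\<^sup>+x. ennreal (G x) * indicator {A k..B k} x \<partial>lborel)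
        \<le> (\<integral>\<^sup>+x. ennreal (H x) \<partial>lborel) + ennreal (r (A k))"
      using evA evB
    proof eventually_elim
      case (elim k)
      have "0 \<le> integral {A k..B k} h"
        using AB[of k] h(2) by (intro integral_nonneg integrable_continuous_real continuous_on_subset[OF h(1)]) auto
      have "(\<integral>\<^sup>+x. ennreal (G x) * indicator {A k..B k} x \<partial>lborel) = ennreal (integral {A k..B k} g)"
        using nn[OF g G_def Gm] by simp
      also have "\<dots> \<le> ennreal (integral {A k..B k} h + r (A k))"
        using le[OF elim AB] by (rule ennreal_leI)
      also have "\<dots> \<le> ennreal (integral {A k..B k} h) + ennreal (r (A k))"
      proof (cases "r (A k) \<ge> 0")
        case True
        then show ?thesis using \<open>0 \<le> integral {A k..B k} h\<close> by (simp add: ennreal_plus)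
      next
        case False
        then show ?thesis by (simp add: ennreal_neg ennreal_leI)
      qed
      also have "ennreal (integral {A k..B k} h) = (\<integral>\<^sup>+x\<in>{A k..B k}. ennreal (H x) \<partial>lborel)"
        using nn[OF h H_def Hm] by simp
      also have "\<dots> \<le> (\<integral>\<^sup>+x. ennreal (H x) \<partial>lborel)"
        by (intro nn_integral_mono) (auto simp: indicator_def)
      finally show ?case by (simp add: add_right_mono)
    qed
  qed
  also have "\<dots> = (\<integral>\<^sup>+x. ennreal (H x) \<partial>lborel) + ennreal 0"
    by (intro lim_imp_Liminf tendsto_add tendsto_const tendsto_ennrealI rlim) simp
  also have "\<dots> = (\<integral>\<^sup>+x\<in>{..<0}. ennreal (h x) \<partial>lborel)"
    by simp (intro nn_integral_cong, auto simp: H_def indicator_def)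
  finally show ?thesis .
qed

lemma has_real_derivative_norm_sq:
  fixes P :: "real \<Rightarrow> complex"
  assumes "(P has_vector_derivative P') (at s)"
  shows "((\<lambda>s. (norm (P s))\<^sup>2) has_real_derivative 2 * Re (cnj (P s) * P')) (at s)"
proof -
  have "((\<lambda>s. (Re (P s))\<^sup>2 + (Im (P s))\<^sup>2) has_real_derivative 2 * Re (cnj (P s) * P')) (at s)"
    using bounded_linear.has_vector_derivative[OF bounded_linear_Re assms] bounded_linear.has_vector_derivative[OF bounded_linear_Im assms]
    by (auto simp flip: has_real_derivative_iff_has_vector_derivative
        intro!: DERIV_cong[OF DERIV_add[OF DERIV_power DERIV_power]])
  then show ?thesis by (simp add: cmod_power2)
qed

text \<open>The square |y p + t d|^2 is nonnegative. In both applications \<open>t\<close> is the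
  weight 1 - x, and \<open>y\<close> is the coefficient of |P|^2 in \<open>Z\<close> divided by 1 -
  x.\<close>

lemma young_Re:
  fixes p d :: complex
  shows "- (y\<^sup>2 * (norm p)\<^sup>2) - t\<^sup>2 * (norm d)\<^sup>2 \<le> 2 * y * (t * Re (cnj p * d))"
proof -
  have "0 \<le> (norm (of_real y * p + of_real t * d))\<^sup>2" by simp
  also have "\<dots> = y\<^sup>2 * (norm p)\<^sup>2 + t\<^sup>2 * (norm d)\<^sup>2 + 2 * y * (t * Re (cnj p * d))"
    unfolding cmod_power2 by (simp add: power2_eq_square algebra_simps)
  finally show ?thesis by simp
qed

text \<open>The pointwise inequality is the derivative estimate for \<open>Z = - (1 - e\<^sup>2\<^sup>s) |P|\<^sup>2\<close>.\<close>

lemma mode_neg: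
  fixes P d :: "real \<Rightarrow> complex" and n :: real
  assumes n: "n \<le> -1"
    and P: "\<And>s. s < 0 \<Longrightarrow> (P has_vector_derivative (of_real n * P s + d s)) (at s)"
    and d: "continuous_on {..<0} d"
    and lim: "(P \<longlongrightarrow> 0) at_bot"
  shows "(\<integral>\<^sup>+s\<in>{..<0}. ennreal (exp (2 * s) * (norm (P s))\<^sup>2) \<partial>lborel)
    \<le> (\<integral>\<^sup>+s\<in>{..<0}. ennreal ((1 - exp (2 * s))\<^sup>2 * (norm (d s))\<^sup>2) \<partial>lborel)"
proof (rule nn_integral_le_of_interval_integrals[where r = "\<lambda>A. (norm (P A))\<^sup>2" and a = 0 and b = "-1"])
  have cP: "continuous_on {..<0} P"
    by (meson P continuous_at_imp_continuous_on has_vector_derivative_continuous lessThan_iff)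
  show "continuous_on {..<0} (\<lambda>s. exp (2 * s) * (norm (P s))\<^sup>2)"
    by (intro continuous_intros cP)
  show "continuous_on {..<0} (\<lambda>s. (1 - exp (2 * s))\<^sup>2 * (norm (d s))\<^sup>2)"
    by (intro continuous_intros d)
  show "((\<lambda>A. (norm (P A))\<^sup>2) \<longlongrightarrow> 0) at_bot"
    using tendsto_power[OF tendsto_norm[OF lim], of 2] by simp
  fix A B :: real assume AB: "A < B" "B < 0"
  define Z where "Z = (\<lambda>s. - (1 - exp (2 * s)) * (norm (P s))\<^sup>2)"
  define Z' where "Z' = (\<lambda>s. 2 * exp (2 * s) * (norm (P s))\<^sup>2
      - (1 - exp (2 * s)) * (2 * Re (cnj (P s) * (of_real n * P s + d s))))"
  have Z: "(Z has_real_derivative Z' s) (at s)" if "s < 0" for s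
    unfolding Z_def Z'_def
    by (rule DERIV_cong[OF DERIV_mult[OF _ has_real_derivative_norm_sq[OF P[OF that]]]])
      (auto intro!: derivative_eq_intros simp: algebra_simps)
  have ZI: "(Z' has_integral (Z B - Z A)) {A..B}"
    by (rule fundamental_theorem_of_calculus)
      (use Z AB in \<open>auto simp: has_real_derivative_iff_has_vector_derivative[symmetric] intro: has_field_derivative_at_within\<close>)
  have sub: "{A..B} \<subseteq> {..<0}" using AB by auto
  have cs: "continuous_on {A..B} P" "continuous_on {A..B} d"
    using cP d sub continuous_on_subset by blast+
  have "integral {A..B} (\<lambda>s. exp (2 * s) * (norm (P s))\<^sup>2)
      \<le> integral {A..B} (\<lambda>s. Z' s + (1 - exp (2 * s))\<^sup>2 * (norm (d s))\<^sup>2)"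
  proof (rule integral_le)
    show "(\<lambda>s. exp (2 * s) * (norm (P s))\<^sup>2) integrable_on {A..B}"
      by (intro integrable_continuous_real continuous_intros cs)
    show "(\<lambda>s. Z' s + (1 - exp (2 * s))\<^sup>2 * (norm (d s))\<^sup>2) integrable_on {A..B}"
      unfolding Z'_def by (intro integrable_continuous_real continuous_intros cs)
    fix s assume "s \<in> {A..B}"
    then have s: "s < 0" using AB by auto
    define x where "x = exp (2 * s)"
    have x: "0 < x" "x < 1" using s by (auto simp: x_def)
    \<comment> \<open>The coefficient of |P|^2 in \<open>Z\<close> is -(1 - x), which means y =
      -1.\<close>
    have yr: "- (1 * (norm (P s))\<^sup>2) - (1-x)\<^sup>2 * (norm (d s))\<^sup>2 \<le> 2 * (-1) * ((1-x) * Re (cnj (P s) * d s))"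
      using young_Re[of "-1" "P s" "1-x" "d s"] by (simp only: power2_minus power_one)
    \<comment> \<open>What is left over is |P|^2 times (1 - x) (-2 n - 1), nonnegative because n
      \<le> -1.\<close>
    have "(norm (P s))\<^sup>2 * (x + 2 * (1-x) * (-n) - 1) \<ge> 0"
    proof (rule mult_nonneg_nonneg)
      have "(1-x) * (-n) \<ge> (1-x) * 1" using n x by (intro mult_left_mono) auto
      then show "x + 2 * (1-x) * (-n) - 1 \<ge> 0" 
      proof -
        have "x + 2 * (1-x) * (-n) - 1 = ((1-x) * (-n) - (1-x) * 1) + (1-x) * (-n)" by algebra
        moreover have "0 \<le> (1-x) * (-n)" using n x by (intro mult_nonneg_nonneg) auto
        ultimately show ?thesis using \<open>(1-x) * (-n) \<ge> (1-x) * 1\<close> by linarith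
      qed
    qed simp
    moreover have "Re (cnj (P s) * (of_real n * P s + d s)) = n * (norm (P s))\<^sup>2 + Re (cnj (P s) * d s)"
      unfolding cmod_power2 by (simp add: power2_eq_square algebra_simps)
    ultimately show "exp (2 * s) * (norm (P s))\<^sup>2 \<le> Z' s + (1 - exp (2 * s))\<^sup>2 * (norm (d s))\<^sup>2"
      using yr unfolding Z'_def x_def[symmetric] by (simp add: algebra_simps)
  qed
  also have "\<dots> = (Z B - Z A) + integral {A..B} (\<lambda>s. (1 - exp (2 * s))\<^sup>2 * (norm (d s))\<^sup>2)"
  proof -
    have "(\<lambda>s. (1 - exp (2 * s))\<^sup>2 * (norm (d s))\<^sup>2) integrable_on {A..B}"
      by (intro integrable_continuous_real continuous_intros cs)
    then show ?thesis using ZI by (simp add: integral_add has_integral_iff)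
  qed
  \<comment> \<open>The boundary term at \<open>B\<close> has the favourable sign. The one at
    \<open>A\<close> is at most |P A|^2, which tends to 0 at minus infinity and is the remainder of
    the interval lemma.\<close>
  also have "Z B - Z A \<le> (norm (P A))\<^sup>2"
  proof -
    have "Z B \<le> 0" using AB by (simp add: Z_def mult_nonpos_nonneg)
    moreover have "- Z A \<le> 1 * (norm (P A))\<^sup>2"
      unfolding Z_def by (simp only: minus_mult_left[symmetric] minus_minus) (intro mult_right_mono, auto)
    ultimately show ?thesis by simp
  qed
  finally show "integral {A..B} (\<lambda>s. exp (2 * s) * (norm (P s))\<^sup>2)
     \<le> integral {A..B} (\<lambda>s. (1 - exp (2 * s))\<^sup>2 * (norm (d s))\<^sup>2) + (norm (P A))\<^sup>2" by simp
qed auto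

text \<open>With \<open>x = e\<^sup>2\<^sup>s\<close>, the function \<open>(1 - x)\<^sup>-\<^sup>1\<^sup>/\<^sup>2 (x - c)\<close> is a supersolution of the
  Euler--Lagrange equation that changes sign once, at \<open>x = c\<close>; \<open>Y\<close> is the associated
  solution of the Riccati inequality.\<close>

lemma mode_nonneg:
  fixes P d :: "real \<Rightarrow> complex" and n :: real
  assumes n: "n \<ge> 0"
    and P: "\<And>s. s < 0 \<Longrightarrow> (P has_vector_derivative (of_real n * P s + d s)) (at s)"
    and d: "continuous_on {..<0} d"
    and s0: "exp (2 * s0) = (n + 1) / (n + 2)" "P s0 = 0"
  shows "(\<integral>\<^sup>+s\<in>{..<0}. ennreal (exp (2 * s) * (norm (P s))\<^sup>2) \<partial>lborel)
    \<le> (\<integral>\<^sup>+s\<in>{..<0}. ennreal ((1 - exp (2 * s))\<^sup>2 * (norm (d s))\<^sup>2) \<partial>lborel)"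
proof -
  define c where "c = (n + 1) / (n + 2)"
  have c: "0 < c" "c < 1" "c * (n + 2) = n + 1" using n by (auto simp: c_def)
  have es0: "exp (2 * s0) = c" using s0 by (simp add: c_def)
  have s0neg: "s0 < 0" using es0 c(2) by (metis exp_less_one_iff mult_less_0_iff zero_less_numeral not_numeral_less_zero)
  have ec: "exp (2 * s) = c \<longleftrightarrow> s = s0" "exp (2 * s) < c \<longleftrightarrow> s < s0" for s
    by (simp_all flip: es0)
  show ?thesis
  proof (rule nn_integral_le_of_interval_integrals[where r = "\<lambda>_. 0" and a = s0 and b = s0])
    have cP: "continuous_on {..<0} P"
      by (meson P continuous_at_imp_continuous_on has_vector_derivative_continuous lessThan_iff)
    show "continuous_on {..<0} (\<lambda>s. exp (2 * s) * (norm (P s))\<^sup>2)"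
      by (intro continuous_intros cP)
    show "continuous_on {..<0} (\<lambda>s. (1 - exp (2 * s))\<^sup>2 * (norm (d s))\<^sup>2)"
      by (intro continuous_intros d)
    fix A B :: real assume AB: "A < s0" "s0 < B" "A < B" "B < 0"
    \<comment> \<open>The supersolution belongs to Q = exp (-n s) P, for which the weights are exp
      (2 n s) (1 - x)^2 and exp (2 n s) x. \<open>Y\<close> is -(1 - x)^2 times its logarithmic
      derivative in s and has a simple pole at the node x = c.\<close>
    define N where "N = (\<lambda>x. - x * (1 - x) * (2 - c - x))"
    define N' where "N' = (\<lambda>x. - ((1 - x) * (2 - c - x) - x * (2 - c - x) - x * (1 - x)))"
    define Y where "Y = (\<lambda>x. N x / (x - c))"
    define Y' where "Y' = (\<lambda>x. (N' x * (x - c) - N x) / (x - c)\<^sup>2)"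
    define Z where "Z = (\<lambda>s. Y (exp (2 * s)) * (norm (P s))\<^sup>2)"
    define Z' where "Z' = (\<lambda>s. 2 * exp (2 * s) * Y' (exp (2 * s)) * (norm (P s))\<^sup>2
        + Y (exp (2 * s)) * (2 * Re (cnj (P s) * (of_real n * P s + d s))))"
    have dY: "(Y has_real_derivative Y' x) (at x)" if "x \<noteq> c" for x
      unfolding Y_def Y'_def N_def N'_def
      using that by (auto intro!: derivative_eq_intros simp: power2_eq_square algebra_simps)
    have Z: "(Z has_real_derivative Z' s) (at s)" if "s < 0" "s \<noteq> s0" for s
    proof -
      have "((\<lambda>s. exp (2 * s)) has_real_derivative 2 * exp (2 * s)) (at s)"
        by (auto intro!: derivative_eq_intros)
      moreover have "exp (2 * s) \<noteq> c" using that ec by simp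
      ultimately have "((\<lambda>s. Y (exp (2 * s))) has_real_derivative Y' (exp (2 * s)) * (2 * exp (2 * s))) (at s)"
        by (intro DERIV_chain2[OF dY, where g = "\<lambda>s. exp (2 * s)"])
      then show ?thesis
        unfolding Z_def Z'_def
        by (intro DERIV_cong[OF DERIV_mult[OF _ has_real_derivative_norm_sq[OF P[OF that(1)]]]]) auto
    qed
    \<comment> \<open>The simple pole of \<open>Y\<close> is compensated: |P|^2 vanishes at the node
      together with its derivative because P s0 = 0, so \<open>Z\<close> tends to 0 there.\<close>
    have Zs0: "isCont Z s0"
    proof -
      have 1: "((\<lambda>s. (norm (P s))\<^sup>2 / (s - s0)) \<longlongrightarrow> 0) (at s0)"
        using has_real_derivative_norm_sq[OF P[OF s0neg]] s0(2)
        by (simp add: has_field_derivative_iff)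
      have "((\<lambda>s. exp (2 * s)) has_real_derivative 2 * c) (at s0)"
        using es0 by (auto intro!: derivative_eq_intros)
      then have 2: "((\<lambda>s. (exp (2 * s) - c) / (s - s0)) \<longlongrightarrow> 2 * c) (at s0)"
        by (simp add: has_field_derivative_iff es0)
      have 3: "((\<lambda>s. N (exp (2 * s))) \<longlongrightarrow> N (exp (2 * s0))) (at s0)"
        unfolding N_def by (intro tendsto_intros)
      have "((\<lambda>s. N (exp (2 * s)) * (((norm (P s))\<^sup>2 / (s - s0)) / ((exp (2 * s) - c) / (s - s0)))) \<longlongrightarrow> N (exp (2 * s0)) * (0 / (2 * c))) (at s0)"
        using c by (intro tendsto_intros 1 2 3) auto
      moreover have "eventually (\<lambda>s. N (exp (2 * s)) * (((norm (P s))\<^sup>2 / (s - s0)) / ((exp (2 * s) - c) / (s - s0))) = Z s) (at s0)"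
        unfolding eventually_at_filter
        by (rule always_eventually) (auto simp: Z_def Y_def divide_simps)
      ultimately have "(Z \<longlongrightarrow> N (exp (2 * s0)) * (0 / (2 * c))) (at s0)"
        using Lim_transform_eventually by blast
      then show ?thesis by (simp add: isCont_def Z_def s0)
    qed
    have ZI: "(Z' has_integral (Z B - Z A)) {A..B}"
    proof (rule fundamental_theorem_of_calculus_interior_strong[of "{s0}"])
      show "continuous_on {A..B} Z"
      proof (rule continuous_at_imp_continuous_on, rule ballI)
        fix s assume "s \<in> {A..B}"
        then have "s < 0" using AB by auto
        then show "isCont Z s" using Zs0 Z DERIV_isCont by (cases "s = s0") blast+
      qed
    qed (use Z AB in \<open>auto simp: has_real_derivative_iff_has_vector_derivative[symmetric]\<close>)
    have sub: "{A..B} \<subseteq> {..<0}" using AB by auto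
    have cs: "continuous_on {A..B} P" "continuous_on {A..B} d"
      using cP d sub continuous_on_subset by blast+
    have hi: "(\<lambda>s. (1 - exp (2 * s))\<^sup>2 * (norm (d s))\<^sup>2) integrable_on {A..B}"
      by (intro integrable_continuous_real continuous_intros cs)
    have "integral {A..B} (\<lambda>s. exp (2 * s) * (norm (P s))\<^sup>2)
        \<le> integral {A..B} (\<lambda>s. Z' s + (1 - exp (2 * s))\<^sup>2 * (norm (d s))\<^sup>2)"
    proof (rule integral_le)
      show "(\<lambda>s. exp (2 * s) * (norm (P s))\<^sup>2) integrable_on {A..B}"
        by (intro integrable_continuous_real continuous_intros cs)
      show "(\<lambda>s. Z' s + (1 - exp (2 * s))\<^sup>2 * (norm (d s))\<^sup>2) integrable_on {A..B}"
        using ZI hi by (intro integrable_add) auto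
      fix s assume "s \<in> {A..B}"
      then have s: "s < 0" using AB by auto
      define x where "x = exp (2 * s)"
      have x: "0 < x" "x < 1" using s by (auto simp: x_def)
      show "exp (2 * s) * (norm (P s))\<^sup>2 \<le> Z' s + (1 - exp (2 * s))\<^sup>2 * (norm (d s))\<^sup>2"
      proof (cases "s = s0")
        case True
        \<comment> \<open>Division by zero gives \<open>Y\<close> the value 0 at the node, so
          \<open>Z'\<close> is 0 there and the inequality reduces to nonnegativity of the last
          term.\<close>
        have "Y (exp (2 * s)) = 0" using True es0 by (simp add: Y_def)
        then show ?thesis using True s0 by (simp add: Z'_def)
      next
        case False
        then have xc: "x - c \<noteq> 0" using ec by (simp add: x_def)
        define y where "y = - x * (2 - c - x) / (x - c)"
        have Yy: "Y x = y * (1 - x)" by (simp add: Y_def y_def N_def)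
        have yr: "- (y\<^sup>2 * (norm (P s))\<^sup>2) - (1-x)\<^sup>2 * (norm (d s))\<^sup>2 \<le> 2 * y * ((1-x) * Re (cnj (P s) * d s))"
          by (rule young_Re)
        \<comment> \<open>The double pole at x = c cancels whatever c is; the relation c (n + 2) = n
          + 1 removes the simple pole as well. This is where the position of the node comes
          from.\<close>
        have id: "2 * x * Y' x + 2 * n * Y x - y\<^sup>2 - x = x * (2 * n + 5) * (1 - x)"
        proof -
          have "2 * x * (N' x * (x - c) - N x) + 2 * n * N x * (x - c) - (x * (2 - c - x))\<^sup>2 - x * (x - c)\<^sup>2
              = x * (2 * n + 5) * (1 - x) * (x - c)\<^sup>2"
            using c(3) unfolding N_def N'_def by algebra
          then have "(2 * x * (N' x * (x - c) - N x) + 2 * n * N x * (x - c) - (x * (2 - c - x))\<^sup>2 - x * (x - c)\<^sup>2) / (x - c)\<^sup>2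
              = x * (2 * n + 5) * (1 - x)"
            using xc by (simp add: divide_eq_eq)
          moreover have "2 * x * Y' x + 2 * n * Y x - y\<^sup>2 - x =
            (2 * x * (N' x * (x - c) - N x) + 2 * n * N x * (x - c) - (x * (2 - c - x))\<^sup>2 - x * (x - c)\<^sup>2) / (x - c)\<^sup>2"
          proof -
            have "2 * x * ((a * u - b) / u\<^sup>2) + 2 * n * (b / u) - (q / u)\<^sup>2 - x
                = (2 * x * (a * u - b) + 2 * n * b * u - q\<^sup>2 - x * u\<^sup>2) / u\<^sup>2" if "u \<noteq> 0" for a b u q :: real
              using that by (simp add: field_simps power2_eq_square)
            from this[OF xc, of "N' x" "N x" "- x * (2 - c - x)"] show ?thesis
              by (simp add: Y_def Y'_def y_def)
          qed
          ultimately show ?thesis by simp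
        qed
        have "0 \<le> (norm (P s))\<^sup>2 * (x * (2 * n + 5) * (1 - x))" using x n by simp
        then have "0 \<le> (norm (P s))\<^sup>2 * (2 * x * Y' x + 2 * n * Y x - y\<^sup>2 - x)" by (simp only: id)
        moreover have "Re (cnj (P s) * (of_real n * P s + d s)) = n * (norm (P s))\<^sup>2 + Re (cnj (P s) * d s)"
          unfolding cmod_power2 by (simp add: power2_eq_square algebra_simps)
        ultimately show ?thesis
          using yr unfolding Z'_def x_def[symmetric] by (simp add: Yy algebra_simps)
      qed
    qed
    also have "\<dots> = (Z B - Z A) + integral {A..B} (\<lambda>s. (1 - exp (2 * s))\<^sup>2 * (norm (d s))\<^sup>2)"
      using ZI hi by (simp add: integral_add has_integral_iff)
    \<comment> \<open>\<open>Y\<close> is nonnegative before the node and nonpositive after it, and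
      the interval contains the node. Both boundary terms therefore have the favourable sign and no
      remainder is left.\<close>
    also have "Z B - Z A \<le> 0"
    proof -
      have "Y (exp (2 * B)) \<le> 0"
      proof -
        have "exp (2 * B) > c" "exp (2 * B) < 1" using AB es0 by auto
        moreover from this have "exp (2 * B) \<le> 2 - c" using c by linarith
        ultimately show ?thesis using c unfolding Y_def N_def
          by (intro divide_nonpos_pos) (auto intro!: mult_nonneg_nonneg)
      qed
      then have "Z B \<le> 0" by (simp add: Z_def mult_nonpos_nonneg)
      moreover have "Y (exp (2 * A)) \<ge> 0"
      proof -
        have "exp (2 * A) < c" using AB ec by simp
        moreover from this have "exp (2 * A) \<le> 2 - c" "exp (2 * A) \<le> 1" using c by linarith+
        ultimately show ?thesis using c unfolding Y_def N_def
          by (intro divide_nonpos_neg) (auto intro!: mult_nonneg_nonneg)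
      qed
      then have "Z A \<ge> 0" by (simp add: Z_def)
      ultimately show ?thesis by simp
    qed
    finally show "integral {A..B} (\<lambda>s. exp (2 * s) * (norm (P s))\<^sup>2)
       \<le> integral {A..B} (\<lambda>s. (1 - exp (2 * s))\<^sup>2 * (norm (d s))\<^sup>2) + 0" by simp
  qed (use s0neg in auto)
qed

section \<open>Fourier coefficients\<close>

definition fourier_coeff :: "(real \<Rightarrow> complex) \<Rightarrow> int \<Rightarrow> complex" where
  "fourier_coeff g n = integral {-pi..pi} (\<lambda>\<theta>. g \<theta> * cis (- (of_int n * \<theta>))) / of_real (2 * pi)"

lemma integral_cis:
  "integral {-pi..pi} (\<lambda>\<theta>. cis (of_int n * \<theta>)) = (if n = 0 then of_real (2 * pi) else 0)"
proof (cases "n = 0")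
  case True
  then show ?thesis by (simp add: scaleR_conv_of_real)
next
  case False
  define F where "F = (\<lambda>\<theta>::real. cis (of_int n * \<theta>) / (\<i> * of_int n))"
  have "((\<lambda>\<theta>. cis (of_int n * \<theta>)) has_integral (F pi - F (-pi))) {-pi..pi}"
  proof (rule fundamental_theorem_of_calculus)
    fix \<theta> assume "\<theta> \<in> {-pi..pi}"
    have "((\<lambda>\<theta>. exp (\<i> * (of_int n * of_real \<theta>)) / (\<i> * of_int n)) has_vector_derivative
        exp (\<i> * (of_int n * of_real \<theta>))) (at \<theta> within {-pi..pi})"
      using False by (auto intro!: derivative_eq_intros has_vector_derivative_real_field simp: mult.commute mult.left_commute)
    then show "(F has_vector_derivative cis (of_int n * \<theta>)) (at \<theta> within {-pi..pi})"
      by (simp add: F_def cis_conv_exp)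
  qed simp
  moreover have "cis (of_int n * pi) = cis (- (of_int n * pi))"
    using sin_npi_int[of n] by (simp add: complex_eq_iff mult.commute)
  then have "F pi = F (-pi)"
    by (simp add: F_def)
  ultimately show ?thesis using False by (simp add: integral_unique)
qed

lemma cis_continuous [continuous_intros]:
  "continuous_on S f \<Longrightarrow> continuous_on S (\<lambda>x. cis (f x))"
  by (simp add: cis_conv_exp) (intro continuous_intros)

text \<open>The square is expanded, orthogonality removes the mixed terms, and each coefficient is
  completed to a square separately. One identity then serves Bessel's inequality, the best
  approximation property of Fourier sums and, with coefficients of a polynomial on the disc,
  \<open>circle_expansion\<close>.\<close>

lemma integral_norm_sq_diff_trig:
  assumes g: "continuous_on {-pi..pi} g" and F: "finite F"
  shows "integral {-pi..pi} (\<lambda>\<theta>. (norm (g \<theta> - (\<Sum>n\<in>F. a n * cis (of_int n * \<theta>))))\<^sup>2)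
    = integral {-pi..pi} (\<lambda>\<theta>. (norm (g \<theta>))\<^sup>2) - 2 * pi * (\<Sum>n\<in>F. (norm (fourier_coeff g n))\<^sup>2)
      + 2 * pi * (\<Sum>n\<in>F. (norm (fourier_coeff g n - a n))\<^sup>2)"
proof -
  define S where "S = (\<lambda>\<theta>. \<Sum>n\<in>F. a n * cis (of_int n * \<theta>))"
  have cS: "continuous_on {-pi..pi} S" unfolding S_def by (intro continuous_intros)
  have pt: "(norm (g \<theta> - S \<theta>))\<^sup>2 = (norm (g \<theta>))\<^sup>2 - 2 * Re (g \<theta> * cnj (S \<theta>)) + Re (S \<theta> * cnj (S \<theta>))" for \<theta>
    unfolding cmod_power2 by (simp add: power2_eq_square algebra_simps)
  have gS: "integral {-pi..pi} (\<lambda>\<theta>. g \<theta> * cnj (S \<theta>)) = of_real (2 * pi) * (\<Sum>n\<in>F. cnj (a n) * fourier_coeff g n)"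
  proof -
    have "integral {-pi..pi} (\<lambda>\<theta>. g \<theta> * cnj (S \<theta>))
      = integral {-pi..pi} (\<lambda>\<theta>. \<Sum>n\<in>F. cnj (a n) * (g \<theta> * cis (- (of_int n * \<theta>))))"
      by (rule integral_cong) (simp add: S_def sum_distrib_left cis_cnj mult_ac)
    also have "\<dots> = (\<Sum>n\<in>F. integral {-pi..pi} (\<lambda>\<theta>. cnj (a n) * (g \<theta> * cis (- (of_int n * \<theta>)))))"
      by (rule integral_sum) (use F in \<open>auto intro!: integrable_continuous_real continuous_intros g\<close>)
    also have "\<dots> = (\<Sum>n\<in>F. of_real (2 * pi) * (cnj (a n) * fourier_coeff g n))"
      by (rule sum.cong) (auto simp: fourier_coeff_def)
    finally show ?thesis by (simp add: sum_distrib_left)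
  qed
  have SS: "integral {-pi..pi} (\<lambda>\<theta>. S \<theta> * cnj (S \<theta>)) = of_real (2 * pi * (\<Sum>n\<in>F. (norm (a n))\<^sup>2))"
  proof -
    have "integral {-pi..pi} (\<lambda>\<theta>. S \<theta> * cnj (S \<theta>))
      = integral {-pi..pi} (\<lambda>\<theta>. \<Sum>n\<in>F. \<Sum>m\<in>F. a n * cnj (a m) * cis (of_int (n - m) * \<theta>))"
    proof (rule integral_cong)
      fix \<theta>
      have "a n * cis (of_int n * \<theta>) * cnj (a m * cis (of_int m * \<theta>)) = a n * cnj (a m) * cis (of_int (n - m) * \<theta>)" for n m
        by (simp add: left_diff_distrib flip: cis_divide cis_cnj) (simp add: cis_cnj divide_inverse)
      then show "S \<theta> * cnj (S \<theta>) = (\<Sum>n\<in>F. \<Sum>m\<in>F. a n * cnj (a m) * cis (of_int (n - m) * \<theta>))"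
        unfolding S_def cnj_sum sum_product by (simp only:)
    qed
    also have "\<dots> = (\<Sum>n\<in>F. \<Sum>m\<in>F. integral {-pi..pi} (\<lambda>\<theta>. a n * cnj (a m) * cis (of_int (n - m) * \<theta>)))"
      using F by (subst integral_sum; (intro sum.cong refl integral_sum)?)
        (auto intro!: integrable_continuous_real continuous_intros)
    also have "\<dots> = (\<Sum>n\<in>F. \<Sum>m\<in>F. if m = n then of_real (2 * pi) * (a n * cnj (a n)) else 0)"
      by (intro sum.cong refl) (simp only: integral_mult_right integral_cis, auto)
    also have "\<dots> = (\<Sum>n\<in>F. of_real (2 * pi) * (a n * cnj (a n)))"
      using F by (simp add: sum.delta')
    also have "\<dots> = of_real (2 * pi * (\<Sum>n\<in>F. (norm (a n))\<^sup>2))"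
      by (simp add: sum_distrib_left complex_norm_square flip: of_real_power)
    finally show ?thesis .
  qed
  have i1: "(\<lambda>\<theta>. (norm (g \<theta>))\<^sup>2) integrable_on {-pi..pi}"
    and i2: "(\<lambda>\<theta>. g \<theta> * cnj (S \<theta>)) integrable_on {-pi..pi}"
    and i3: "(\<lambda>\<theta>. S \<theta> * cnj (S \<theta>)) integrable_on {-pi..pi}"
    by (auto intro!: integrable_continuous_real continuous_intros g cS)
  have r2: "((\<lambda>\<theta>. Re (g \<theta> * cnj (S \<theta>))) has_integral Re (of_real (2 * pi) * (\<Sum>n\<in>F. cnj (a n) * fourier_coeff g n))) {-pi..pi}"
    unfolding gS[symmetric] by (rule has_integral_Re[OF integrable_integral[OF i2]])
  have r3: "((\<lambda>\<theta>. Re (S \<theta> * cnj (S \<theta>))) has_integral (2 * pi * (\<Sum>n\<in>F. (norm (a n))\<^sup>2))) {-pi..pi}"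
    using has_integral_Re[OF integrable_integral[OF i3]] unfolding SS by (simp only: Re_complex_of_real)
  have "((\<lambda>\<theta>. (norm (g \<theta> - S \<theta>))\<^sup>2) has_integral
     (integral {-pi..pi} (\<lambda>\<theta>. (norm (g \<theta>))\<^sup>2) - 2 * Re (of_real (2 * pi) * (\<Sum>n\<in>F. cnj (a n) * fourier_coeff g n))
      + 2 * pi * (\<Sum>n\<in>F. (norm (a n))\<^sup>2))) {-pi..pi}"
    unfolding pt
    by (intro has_integral_add has_integral_diff has_integral_mult_right integrable_integral i1 r2 r3)
  then have "integral {-pi..pi} (\<lambda>\<theta>. (norm (g \<theta> - S \<theta>))\<^sup>2) =
     integral {-pi..pi} (\<lambda>\<theta>. (norm (g \<theta>))\<^sup>2) - 2 * Re (of_real (2 * pi) * (\<Sum>n\<in>F. cnj (a n) * fourier_coeff g n))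
      + 2 * pi * (\<Sum>n\<in>F. (norm (a n))\<^sup>2)"
    by (rule integral_unique)
  also have "\<dots> = integral {-pi..pi} (\<lambda>\<theta>. (norm (g \<theta>))\<^sup>2) - 2 * pi * (\<Sum>n\<in>F. (norm (fourier_coeff g n))\<^sup>2)
      + 2 * pi * (\<Sum>n\<in>F. (norm (fourier_coeff g n - a n))\<^sup>2)"
  proof -
    have "(norm (fourier_coeff g n - a n))\<^sup>2 - (norm (fourier_coeff g n))\<^sup>2
       = (norm (a n))\<^sup>2 - 2 * Re (cnj (a n) * fourier_coeff g n)" for n
      unfolding cmod_power2 by (simp add: power2_eq_square algebra_simps)
    then have "(\<Sum>n\<in>F. (norm (fourier_coeff g n - a n))\<^sup>2) - (\<Sum>n\<in>F. (norm (fourier_coeff g n))\<^sup>2)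
      = (\<Sum>n\<in>F. (norm (a n))\<^sup>2) - 2 * Re (\<Sum>n\<in>F. cnj (a n) * fourier_coeff g n)"
      by (simp only: sum_subtractf[symmetric] Re_sum sum_distrib_left)
    then have "2 * pi * ((\<Sum>n\<in>F. (norm (fourier_coeff g n - a n))\<^sup>2) - (\<Sum>n\<in>F. (norm (fourier_coeff g n))\<^sup>2))
      = 2 * pi * ((\<Sum>n\<in>F. (norm (a n))\<^sup>2) - 2 * Re (\<Sum>n\<in>F. cnj (a n) * fourier_coeff g n))" by (simp only:)
    moreover have "Re (of_real (2 * pi) * X) = 2 * pi * Re X" for X by simp
    ultimately show ?thesis by (simp add: algebra_simps)
  qed
  finally show ?thesis unfolding S_def .
qed

lemma bessel_fourier:
  assumes "continuous_on {-pi..pi} g" "finite F"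
  shows "2 * pi * (\<Sum>n\<in>F. (norm (fourier_coeff g n))\<^sup>2) \<le> integral {-pi..pi} (\<lambda>\<theta>. (norm (g \<theta>))\<^sup>2)"
proof -
  have "0 \<le> integral {-pi..pi} (\<lambda>\<theta>. (norm (g \<theta> - (\<Sum>n\<in>F. fourier_coeff g n * cis (of_int n * \<theta>))))\<^sup>2)"
    by (intro integral_nonneg integrable_continuous_real continuous_intros assms) auto
  then show ?thesis
    by (simp add: integral_norm_sq_diff_trig[OF assms])
qed

section \<open>Trigonometric polynomials and Parseval's identity\<close>

inductive trig_poly :: "(real \<Rightarrow> complex) \<Rightarrow> bool" where
  cis: "trig_poly (\<lambda>\<theta>. cis (of_int n * \<theta>))"
| cmult: "trig_poly f \<Longrightarrow> trig_poly (\<lambda>\<theta>. c * f \<theta>)"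
| add: "trig_poly f \<Longrightarrow> trig_poly g \<Longrightarrow> trig_poly (\<lambda>\<theta>. f \<theta> + g \<theta>)"

lemma trig_poly_const: "trig_poly (\<lambda>\<theta>. c)"
  using trig_poly.cmult[OF trig_poly.cis[of 0], of c] by simp

text \<open>Closure under products is what carries polynomials in the two real coordinates over to
  trigonometric polynomials on the circle.\<close>

lemma trig_poly_mult:
  assumes "trig_poly f" "trig_poly g"
  shows "trig_poly (\<lambda>\<theta>. f \<theta> * g \<theta>)"
  using assms(1)
proof induction
  case (cis n)
  show ?case
    using assms(2)
  proof induction
    case (cis m)
    have "(\<lambda>\<theta>. cis (of_int n * \<theta>) * cis (of_int m * \<theta>)) = (\<lambda>\<theta>. cis (of_int (n + m) * \<theta>))"
      by (simp add: cis_mult distrib_right)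
    then show ?case by (simp only: trig_poly.cis)
  next
    case (cmult f c)
    then show ?case using trig_poly.cmult[of _ c] by (simp add: mult_ac)
  next
    case (add f g)
    then show ?case using trig_poly.add by (simp add: distrib_left)
  qed
next
  case (cmult f c)
  then show ?case using trig_poly.cmult[of _ c] by (simp add: mult_ac)
next
  case (add f g)
  then show ?case using trig_poly.add by (simp add: distrib_right)
qed

lemma trig_poly_real_polynomial:
  fixes p :: "complex \<Rightarrow> real"
  assumes "real_polynomial_function p"
  shows "trig_poly (\<lambda>\<theta>. of_real (p (cis \<theta>)))"
  using assms
proof induction
  case (linear f)
  interpret bounded_linear f by fact
  \<comment> \<open>On the circle a real-linear functional is f(1) cos \<theta> + f(i) sin \<theta>,
    rewritten in terms of cis \<theta> and cis (-\<theta>).\<close>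
  have "(\<lambda>\<theta>. complex_of_real (f (cis \<theta>))) = (\<lambda>\<theta>. (of_real (f 1) - \<i> * of_real (f \<i>)) / 2 * cis (of_int 1 * \<theta>)
      + (of_real (f 1) + \<i> * of_real (f \<i>)) / 2 * cis (of_int (-1) * \<theta>))"
  proof
    fix \<theta>
    have "cis \<theta> = cos \<theta> *\<^sub>R 1 + sin \<theta> *\<^sub>R \<i>" by (simp add: complex_eq_iff)
    then have "f (cis \<theta>) = cos \<theta> * f 1 + sin \<theta> * f \<i>" by (simp only: add scale real_scaleR_def)
    then show "complex_of_real (f (cis \<theta>)) = (of_real (f 1) - \<i> * of_real (f \<i>)) / 2 * cis (of_int 1 * \<theta>)
      + (of_real (f 1) + \<i> * of_real (f \<i>)) / 2 * cis (of_int (-1) * \<theta>)"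
      by (simp add: complex_eq_iff field_simps)
  qed
  then show ?case by (simp only: trig_poly.intros)
next
  case (const c)
  then show ?case by (rule trig_poly_const)
next
  case (add f g)
  then show ?case by (simp add: trig_poly.add)
next
  case (mult f g)
  then show ?case by (simp add: trig_poly_mult)
qed

lemma trig_poly_eq_sum:
  assumes "trig_poly f"
  obtains a N where "f = (\<lambda>\<theta>. \<Sum>n\<in>{-int N..int N}. a n * cis (of_int n * \<theta>))"
proof -
  \<comment> \<open>Claimed for all large \<open>M\<close> instead of a single \<open>N\<close>, so
    that two sums can be brought to a common range in the induction.\<close>
  have "\<exists>a N. \<forall>M\<ge>N. \<forall>\<theta>. f \<theta> = (\<Sum>n\<in>{-int M..int M}. a n * cis (of_int n * \<theta>))"
    using assms
  proof induction
    case (cis k)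
    show ?case
    proof (intro exI allI impI)
      fix M \<theta> assume "M \<ge> nat \<bar>k\<bar>"
      then have "k \<in> {-int M..int M}" by auto
      then show "cis (of_int k * \<theta>) = (\<Sum>n\<in>{-int M..int M}. (if n = k then 1 else 0) * cis (of_int n * \<theta>))"
        by (simp add: if_distrib[of "\<lambda>x. x * _"] cong: if_cong)
    qed
  next
    case (cmult f c)
    then obtain a N where "\<forall>M\<ge>N. \<forall>\<theta>. f \<theta> = (\<Sum>n\<in>{-int M..int M}. a n * cis (of_int n * \<theta>))" by blast
    then show ?case
      by (intro exI[of _ "\<lambda>n. c * a n"] exI[of _ N]) (simp add: sum_distrib_left mult_ac)
  next
    case (add f g)
    then obtain a N b L where ab: "\<forall>M\<ge>N. \<forall>\<theta>. f \<theta> = (\<Sum>n\<in>{-int M..int M}. a n * cis (of_int n * \<theta>))"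
      "\<forall>M\<ge>L. \<forall>\<theta>. g \<theta> = (\<Sum>n\<in>{-int M..int M}. b n * cis (of_int n * \<theta>))" by blast
    show ?case
    proof (intro exI allI impI)
      fix M \<theta> assume "M \<ge> max N L"
      then have "f \<theta> = (\<Sum>n\<in>{-int M..int M}. a n * cis (of_int n * \<theta>))"
        "g \<theta> = (\<Sum>n\<in>{-int M..int M}. b n * cis (of_int n * \<theta>))"
        using ab by auto
      then show "f \<theta> + g \<theta> = (\<Sum>n\<in>{-int M..int M}. (a n + b n) * cis (of_int n * \<theta>))"
        by (simp add: sum.distrib distrib_right)
    qed
  qed
  then show ?thesis using that by blast
qed

lemma trig_poly_dense:
  fixes \<phi> :: "complex \<Rightarrow> complex"
  assumes \<phi>: "continuous_on (sphere 0 1) \<phi>" and e: "e > 0"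
  obtains f where "trig_poly f" "\<And>\<theta>. norm (\<phi> (cis \<theta>) - f \<theta>) < e"
proof -
  obtain p where p: "polynomial_function p" "\<And>z. z \<in> sphere 0 1 \<Longrightarrow> norm (\<phi> z - p z) < e"
    using Stone_Weierstrass_polynomial_function[OF _ \<phi> e] by (metis compact_sphere)
  have "real_polynomial_function (\<lambda>z. Re (p z))" "real_polynomial_function (\<lambda>z. Im (p z))"
    using p(1) bounded_linear_Re bounded_linear_Im by (auto simp: polynomial_function_def o_def)
  then have "trig_poly (\<lambda>\<theta>. of_real (Re (p (cis \<theta>))) + \<i> * of_real (Im (p (cis \<theta>))))"
    by (intro trig_poly.add trig_poly.cmult trig_poly_real_polynomial)
  moreover have "(\<lambda>\<theta>. of_real (Re (p (cis \<theta>))) + \<i> * of_real (Im (p (cis \<theta>)))) = (\<lambda>\<theta>. p (cis \<theta>))"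
    using complex_eq by metis
  ultimately have "trig_poly (\<lambda>\<theta>. p (cis \<theta>))" by simp
  then show ?thesis using that p(2) by auto
qed

text \<open>The remainder decreases in N. Stone-Weierstrass provides a trigonometric polynomial
  uniformly close to \<open>g\<close>, and from its degree on the Fourier sum is at least as good in
  mean square.\<close>

lemma parseval_limit:
  fixes \<phi> :: "complex \<Rightarrow> complex"
  assumes \<phi>: "continuous_on (sphere 0 1) \<phi>"
  defines "g \<equiv> (\<lambda>\<theta>. \<phi> (cis \<theta>))"
  shows "(\<lambda>N. integral {-pi..pi} (\<lambda>\<theta>. (norm (g \<theta>))\<^sup>2)
      - 2 * pi * (\<Sum>n\<in>{-int N..int N}. (norm (fourier_coeff g n))\<^sup>2)) \<longlonglongrightarrow> 0"
proof (rule LIMSEQ_I)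
  have cg: "continuous_on {-pi..pi} g"
    unfolding g_def by (rule continuous_on_compose2[OF \<phi>]) (auto intro!: continuous_intros)
  fix r :: real assume r: "r > 0"
  \<comment> \<open>Then e^2 times the length 2 pi of the interval equals r / 2.\<close>
  define e where "e = sqrt (r / (4 * pi))"
  have e: "e > 0" "e\<^sup>2 = r / (4 * pi)" using r by (auto simp: e_def)
  obtain f where f: "trig_poly f" "\<And>\<theta>. norm (\<phi> (cis \<theta>) - f \<theta>) < e"
    using trig_poly_dense[OF \<phi> e(1)] by metis
  obtain a N where a: "f = (\<lambda>\<theta>. \<Sum>n\<in>{-int N..int N}. a n * cis (of_int n * \<theta>))"
    using trig_poly_eq_sum[OF f(1)] by metis
  let ?R = "\<lambda>N. integral {-pi..pi} (\<lambda>\<theta>. (norm (g \<theta>))\<^sup>2)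
      - 2 * pi * (\<Sum>n\<in>{-int N..int N}. (norm (fourier_coeff g n))\<^sup>2)"
  have "norm (?R M - 0) < r" if "M \<ge> N" for M
  proof -
    have "?R M \<le> ?R N"
      using that by (auto intro!: mult_left_mono sum_mono2)
    also have "\<dots> \<le> integral {-pi..pi} (\<lambda>\<theta>. (norm (g \<theta> - f \<theta>))\<^sup>2)"
      unfolding a integral_norm_sq_diff_trig[OF cg finite_atLeastAtMost_int]
      by (simp add: sum_nonneg)
    also have "\<dots> \<le> integral {-pi..pi} (\<lambda>\<theta>. e\<^sup>2)"
    proof (rule integral_le)
      show "(\<lambda>\<theta>. (norm (g \<theta> - f \<theta>))\<^sup>2) integrable_on {-pi..pi}"
        unfolding a by (intro integrable_continuous_real continuous_intros cg)
      show "(norm (g \<theta> - f \<theta>))\<^sup>2 \<le> e\<^sup>2" for \<theta>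
        using f(2)[of \<theta>] by (intro power_mono) (auto simp: g_def)
    qed auto
    also have "\<dots> = r / 2" by (simp add: e(2))
    finally have "?R M \<le> r / 2" .
    moreover have "?R M \<ge> 0" using bessel_fourier[OF cg, of "{-int M..int M}"] by simp
    ultimately show ?thesis using r by simp
  qed
  then show "\<exists>no. \<forall>n\<ge>no. norm (?R n - 0) < r" by blast
qed

section \<open>The Friedrichs inequality on star-shaped domains\<close>

lemma sqrt_one_plus_sq_le: "sqrt (1 + x\<^sup>2) \<le> 1 + x\<^sup>2 / 2" for x :: real
  by (rule real_le_lsqrt) (auto simp: power2_eq_square algebra_simps mult_nonneg_nonneg[OF zero_le_square zero_le_square, simplified mult.assoc])

section \<open>Star-shaped domains in polar coordinates\<close>

locale star_domain =
  fixes \<Omega> :: "complex set" and r R :: real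
  assumes open_\<Omega>: "open \<Omega>" and r_pos: "r > 0" and r_sub: "ball 0 r \<subseteq> \<Omega>" and sub_R: "\<Omega> \<subseteq> ball 0 R"
    and star: "\<And>x y. x \<in> \<Omega> \<Longrightarrow> y \<in> ball 0 r \<Longrightarrow> closed_segment x y \<subseteq> \<Omega>"
begin

definition radius :: "real \<Rightarrow> real" where
  "radius \<theta> = Sup {s. 0 \<le> s \<and> of_real s * cis \<theta> \<in> \<Omega>}"

text \<open>From the boundary point in direction \<theta> the disc is seen under the half-angle
  \<beta> with sin \<beta> = r / radius \<theta>, and this is cot \<beta>. It plays the role of a
  bound for |(ln radius)'|.\<close>

definition slope :: "real \<Rightarrow> real" where
  "slope \<theta> = sqrt ((radius \<theta> / r)\<^sup>2 - 1)"

lemma ray_set: "bdd_above {s. 0 \<le> s \<and> of_real s * cis \<theta> \<in> \<Omega>}" "0 \<in> {s. 0 \<le> s \<and> of_real s * cis \<theta> \<in> \<Omega>}"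
proof -
  show "bdd_above {s. 0 \<le> s \<and> of_real s * cis \<theta> \<in> \<Omega>}"
  proof (rule bdd_aboveI)
    fix s assume "s \<in> {s. 0 \<le> s \<and> of_real s * cis \<theta> \<in> \<Omega>}"
    then have "of_real s * cis \<theta> \<in> ball 0 R" "0 \<le> s" using sub_R by auto
    then show "s \<le> R" by (simp add: norm_mult)
  qed
  show "0 \<in> {s. 0 \<le> s \<and> of_real s * cis \<theta> \<in> \<Omega>}" using r_sub r_pos by auto
qed

lemma scale_in: "x \<in> \<Omega> \<Longrightarrow> 0 \<le> l \<Longrightarrow> l \<le> 1 \<Longrightarrow> of_real l * x \<in> \<Omega>"
proof -
  assume x: "x \<in> \<Omega>" "0 \<le> l" "l \<le> 1"
  have "closed_segment x 0 \<subseteq> \<Omega>" using star[OF x(1), of 0] r_pos by simp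
  moreover have "of_real l * x \<in> closed_segment x 0"
    using x unfolding closed_segment_def by (auto simp: scaleR_conv_of_real intro!: exI[of _ "1 - l"])
  ultimately show ?thesis by auto
qed

text \<open>Star-shapedness with respect to 0 makes the part of the ray inside \<Omega> an interval,
  and openness excludes its right end.\<close>

lemma ray_in_iff:
  assumes "0 \<le> s"
  shows "of_real s * cis \<theta> \<in> \<Omega> \<longleftrightarrow> s < radius \<theta>"
proof
  assume "s < radius \<theta>"
  then obtain s' where s': "0 \<le> s'" "of_real s' * cis \<theta> \<in> \<Omega>" "s < s'"
    unfolding radius_def using less_cSup_iff[OF _ ray_set(1)[of \<theta>], of s] ray_set(2)[of \<theta>] by blast
  have "of_real (s / s') * (of_real s' * cis \<theta>) \<in> \<Omega>"
    using s' assms by (intro scale_in s'(2)) auto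
  then show "of_real s * cis \<theta> \<in> \<Omega>" using s' assms by simp
next
  assume s: "of_real s * cis \<theta> \<in> \<Omega>"
  obtain e where e: "e > 0" "ball (of_real s * cis \<theta>) e \<subseteq> \<Omega>"
    using open_\<Omega> s openE by blast
  have "dist (of_real s * cis \<theta>) (of_real (s + e/2) * cis \<theta>) = e/2"
    using e by (simp add: dist_norm norm_mult ring_distribs flip: left_diff_distrib)
  then have "of_real (s + e/2) * cis \<theta> \<in> \<Omega>" using e by auto
  then have "s + e/2 \<le> radius \<theta>"
    unfolding radius_def using assms e ray_set(1) by (intro cSup_upper) auto
  then show "s < radius \<theta>" using e by simp
qed

lemma radius_bounds: "r \<le> radius \<theta>" "radius \<theta> \<le> R"
proof -
  show "r \<le> radius \<theta>"
  proof (rule dense_le_bounded[OF r_pos])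
    fix s assume "0 < s" "s < r"
    then have "of_real s * cis \<theta> \<in> \<Omega>" using r_sub by (auto simp: norm_mult subset_iff)
    then show "s \<le> radius \<theta>" using ray_in_iff[of s \<theta>] \<open>0 < s\<close> by simp
  qed
  show "radius \<theta> \<le> R"
    unfolding radius_def
  proof (rule cSup_least)
    fix s assume "s \<in> {s. 0 \<le> s \<and> of_real s * cis \<theta> \<in> \<Omega>}"
    then have "of_real s * cis \<theta> \<in> ball 0 R" "0 \<le> s" using sub_R by auto
    then show "s \<le> R" by (simp add: norm_mult)
  qed (use ray_set(2) in blast)
qed

lemma radius_pos: "radius \<theta> > 0" using radius_bounds(1)[of \<theta>] r_pos by simp

lemma R_pos: "R > 0" using radius_bounds[of 0] r_pos by simp

lemma radius_periodic: "radius (\<theta> + 2 * pi) = radius \<theta>"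
  by (simp add: radius_def cis.code)

lemma slope_sq: "radius \<theta> = r * sqrt (1 + (slope \<theta>)\<^sup>2)" and slope_nonneg: "slope \<theta> \<ge> 0"
proof -
  have "1 \<le> radius \<theta> / r" using radius_bounds(1) r_pos by simp
  then have "1 \<le> (radius \<theta> / r)\<^sup>2" using power_mono[of 1 _ 2] by simp
  then show "radius \<theta> = r * sqrt (1 + (slope \<theta>)\<^sup>2)" "slope \<theta> \<ge> 0"
    using radius_pos[of \<theta>] r_pos by (simp_all add: slope_def)
qed

lemma slope_le: "slope \<theta> \<le> R / r"
proof -
  have "slope \<theta> \<le> sqrt ((radius \<theta> / r)\<^sup>2)" unfolding slope_def by (intro real_sqrt_le_mono) simp
  also have "\<dots> = radius \<theta> / r" using radius_pos[of \<theta>] r_pos by simp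
  finally show ?thesis using radius_bounds(2)[of \<theta>] r_pos by (simp add: divide_right_mono order_trans)
qed

text \<open>The convex hull of the boundary point in direction \<open>\<theta>\<close> and the disc is bounded by
  the tangents from that point, which have slope \<open>\<plusminus> slope \<theta>\<close> there.\<close>

lemma radius_lower:
  assumes d: "0 \<le> d" "d \<le> 1" and \<kappa>: "\<kappa> = 1 \<or> \<kappa> = -1"
  shows "radius \<theta> \<le> radius (\<theta> + \<kappa> * d) * (1 + d * slope \<theta>)"
proof -
  define \<rho> where "\<rho> = radius \<theta>"
  define M where "M = slope \<theta>"
  have M: "M \<ge> 0" "\<rho> = r * sqrt (1 + M\<^sup>2)" using slope_sq slope_nonneg by (auto simp: M_def \<rho>_def)
  have \<rho>: "\<rho> > 0" using radius_pos by (simp add: \<rho>_def)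
  have "cos (pi / 3) \<le> cos d" using d pi_gt3 by (intro cos_monotone_0_pi_le) auto
  then have c: "cos d \<ge> 1 / 2" by (simp add: cos_60)
  have s: "0 \<le> sin d" "sin d \<le> d"
    using d pi_gt3 by (auto intro!: sin_ge_zero sin_x_le_x)
  define t where "t = tan d"
  have t: "t \<ge> 0" "t \<le> 2 * d"
  proof -
    show "t \<ge> 0" using c s by (simp add: t_def tan_def)
    have "sin d \<le> d * (2 * cos d)" using s c d mult_left_mono[of 1 "2 * cos d" d] by simp
    then show "t \<le> 2 * d" using c by (simp add: t_def tan_def divide_le_eq mult_ac)
  qed
  show ?thesis
  \<comment> \<open>The tangent touches the disc at angular distance arctan M. Beyond that the disc
    alone suffices: M < tan d \<le> 2 d gives r sqrt (1 + M^2) \<le> r (1 + d M).\<close>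
  proof (cases "t \<le> M")
    case False
    have "sqrt (1 + M\<^sup>2) \<le> 1 + M\<^sup>2 / 2" by (rule sqrt_one_plus_sq_le)
    also have "\<dots> \<le> 1 + d * M"
    proof -
      have "M * M \<le> (2 * d) * M" using False t M by (intro mult_right_mono) auto
      then show ?thesis by (simp add: power2_eq_square)
    qed
    finally have "\<rho> \<le> r * (1 + d * M)" using M r_pos by simp
    also have "\<dots> \<le> radius (\<theta> + \<kappa> * d) * (1 + d * M)"
      using radius_bounds(1) d M by (intro mult_right_mono) auto
    finally show ?thesis by (simp add: \<rho>_def M_def)
  next
    case True
    define \<xi> where "\<xi> = t / (1 + M * t)"
    have Mt: "1 + M * t > 0" using M t by (simp add: add_pos_nonneg)
    define k where "k = 1 / (1 + M\<^sup>2)"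
    have k: "k > 0" "k * (1 + M\<^sup>2) = 1" by (auto simp: k_def add_pos_nonneg add_nonneg_eq_0_iff)
    have \<xi>: "0 \<le> \<xi>" "\<xi> \<le> k * M"
    proof -
      show "0 \<le> \<xi>" using t Mt by (simp add: \<xi>_def)
      have "t * (1 + M * M) \<le> M * (1 + M * t)" using True by (simp add: algebra_simps)
      then show "\<xi> \<le> k * M" using Mt
        by (simp add: \<xi>_def k_def power2_eq_square divide_simps add_pos_nonneg mult_ac)
    qed
    \<comment> \<open>\<open>p\<close> is the boundary point, \<open>z0\<close> the point where a
      tangent from \<open>p\<close> touches the disc, and \<open>q\<close> the point of this tangent
      in direction \<theta> + \<kappa> d; \<open>\<xi>\<close> is the parameter that gives
      \<open>q\<close> this argument.\<close>
    define p where "p = of_real \<rho> * cis \<theta>"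
    define z0 where "z0 = of_real (\<rho> * k) * cis \<theta> * (1 + \<i> * of_real (\<kappa> * M))"
    define q where "q = p * (of_real (1 - \<xi> * M) + \<i> * of_real (\<kappa> * \<xi>))"
    have seg: "\<exists>\<tau>. 0 \<le> \<tau> \<and> \<tau> \<le> 1 \<and> q = of_real (1 - \<tau>) * p + of_real \<tau> * z0"
    proof (cases "M = 0")
      case True
      then have "\<xi> = 0" using \<xi> by simp
      then show ?thesis using True by (intro exI[of _ 0]) (simp add: q_def)
    next
      case False
      define \<tau> where "\<tau> = \<xi> / (k * M)"
      have kM: "k * M > 0" using False M k by simp
      have \<tau>: "0 \<le> \<tau>" "\<tau> \<le> 1" "\<tau> * (k * M) = \<xi>" using \<xi> kM by (auto simp: \<tau>_def)
      have e1: "1 - \<tau> + \<tau> * k = 1 - \<xi> * M"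
      proof -
        have "\<tau> * (1 - k) = \<tau> * (k * M\<^sup>2)" using k by (simp add: distrib_left)
        also have "\<dots> = \<xi> * M" using \<tau>(3) by (simp add: power2_eq_square algebra_simps)
        finally show ?thesis by (simp add: algebra_simps)
      qed
      have "of_real (1 - \<tau>) * p + of_real \<tau> * z0 = p * (of_real (1 - \<tau> + \<tau> * k) + \<i> * of_real (\<kappa> * (\<tau> * (k * M))))"
        by (simp add: p_def z0_def algebra_simps)
      then show ?thesis using \<tau> by (intro exI[of _ \<tau>]) (simp only: e1 \<tau>(3) q_def)
    qed
    then obtain \<tau> where \<tau>: "0 \<le> \<tau>" "\<tau> \<le> 1" "q = of_real (1 - \<tau>) * p + of_real \<tau> * z0" by blast
    have nz0: "norm z0 = r"
    proof -
      have "norm (1 + \<i> * complex_of_real (\<kappa> * M)) = sqrt (1 + M\<^sup>2)"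
        using \<kappa> by (auto simp: cmod_def)
      then have "norm z0 = \<rho> * k * sqrt (1 + M\<^sup>2)" using \<rho> k by (simp add: z0_def norm_mult)
      also have "\<dots> = r * (k * (1 + M\<^sup>2))" by (simp add: M(2))
      finally show ?thesis using k by simp
    qed
    \<comment> \<open>\<open>p\<close> lies outside \<Omega> and \<open>z0\<close> outside the open
      disc, each on the boundary, so the tangent segment is shrunk by \<open>l\<close> before
      star-shapedness is applied.\<close>
    have lq: "of_real l * q \<in> \<Omega>" if l: "0 \<le> l" "l < 1" for l
    proof -
      have "of_real l * p = of_real (l * \<rho>) * cis \<theta>" by (simp add: p_def)
      moreover have "l * \<rho> < radius \<theta>" using l \<rho> by (simp add: \<rho>_def)
      ultimately have lp: "of_real l * p \<in> \<Omega>" using ray_in_iff[of "l * \<rho>" \<theta>] l \<rho> by (metis less_imp_le mult_nonneg_nonneg)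
      have lz: "of_real l * z0 \<in> ball 0 r" using l r_pos nz0 by (simp add: norm_mult)
      have "of_real l * q = (1 - \<tau>) *\<^sub>R (of_real l * p) + \<tau> *\<^sub>R (of_real l * z0)"
        unfolding \<tau>(3) scaleR_conv_of_real by (simp add: algebra_simps)
      then have "of_real l * q \<in> closed_segment (of_real l * p) (of_real l * z0)"
        using \<tau> unfolding closed_segment_def by blast
      then show ?thesis using star[OF lp lz] by auto
    qed
    \<comment> \<open>The modulus of \<open>q\<close>, that is, the distance at which the ray in the
      new direction crosses the tangent.\<close>
    define m where "m = \<rho> / (cos d + M * sin d)"
    have cs: "cos d + M * sin d > 0" using c s M by (simp add: add_pos_nonneg)
    have qm: "q = of_real m * cis (\<theta> + \<kappa> * d)"
    proof -
      have 1: "\<xi> = sin d / (cos d + M * sin d)"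
        using c cs Mt by (simp add: \<xi>_def t_def tan_def divide_simps)
      have 2: "1 - \<xi> * M = cos d / (cos d + M * sin d)"
        unfolding 1 using cs by (simp add: divide_simps)
      have 3: "cis (\<theta> + \<kappa> * d) = cis \<theta> * (of_real (cos d) + \<i> * of_real (\<kappa> * sin d))"
        using \<kappa> by (auto simp: complex_eq_iff cos_add sin_add cos_diff sin_diff algebra_simps)
      show ?thesis
      proof -
        have "q = p * (of_real (cos d / (cos d + M * sin d)) + \<i> * of_real (\<kappa> * (sin d / (cos d + M * sin d))))"
          unfolding q_def 2 by (simp only: 1)
        then show ?thesis
          unfolding p_def m_def 3 by (simp add: algebra_simps add_divide_distrib)
      qed
    qed
    have mp: "m > 0" using \<rho> cs by (simp add: m_def)
    have "m \<le> radius (\<theta> + \<kappa> * d)"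
    proof (rule dense_le_bounded[OF mp])
      fix w assume w: "0 < w" "w < m"
      have "of_real (w / m) * q = of_real w * cis (\<theta> + \<kappa> * d)" using mp by (simp add: qm)
      then have "of_real w * cis (\<theta> + \<kappa> * d) \<in> \<Omega>" using lq[of "w / m"] w mp by simp
      then show "w \<le> radius (\<theta> + \<kappa> * d)" using ray_in_iff[of w] w by simp
    qed
    then have "m * (1 + d * M) \<le> radius (\<theta> + \<kappa> * d) * (1 + d * M)" using d M by (intro mult_right_mono) auto
    moreover have "\<rho> \<le> m * (1 + d * M)"
    proof -
      have "cos d + M * sin d \<le> 1 + d * M"
        using s M mult_left_mono[OF s(2) M(1)] by (simp add: add_mono mult.commute)
      then have "\<rho> * (cos d + M * sin d) \<le> \<rho> * (1 + d * M)" using \<rho> by simp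
      then show ?thesis using cs by (simp add: m_def divide_simps)
    qed
    ultimately show ?thesis by (simp add: \<rho>_def M_def)
  qed
qed

definition log_radius :: "real \<Rightarrow> real" where "log_radius \<theta> = ln (radius \<theta>)"

text \<open>\<open>radius_lower\<close> is applied from either end, with ln (1 + x) \<le> x. The
  result stands in for the derivative bound |(ln radius)'| \<le> slope when the radius need not be
  differentiable.\<close>

lemma log_radius_diff:
  assumes "0 \<le> d" "d \<le> 1"
  shows "\<bar>log_radius (\<theta> + d) - log_radius \<theta>\<bar> \<le> d * max (slope \<theta>) (slope (\<theta> + d))"
proof -
  have ln: "ln x - ln y \<le> d * m" if "x \<le> y * (1 + d * m)" "x > 0" "y > 0" "m \<ge> 0" for x y m
  proof -
    have "1 + d * m > 0" using that assms by (simp add: add_pos_nonneg)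
    then have "ln x \<le> ln y + ln (1 + d * m)"
      using that by (metis ln_le_cancel_iff ln_mult_pos mult_pos_pos)
    also have "ln (1 + d * m) \<le> d * m" using that assms by (intro ln_add_one_self_le_self) auto
    finally show ?thesis by simp
  qed
  have "log_radius \<theta> - log_radius (\<theta> + d) \<le> d * slope \<theta>"
    unfolding log_radius_def
    using radius_lower[OF assms, of 1 \<theta>] by (intro ln) (auto simp: radius_pos slope_nonneg)
  moreover have "log_radius (\<theta> + d) - log_radius \<theta> \<le> d * slope (\<theta> + d)"
    unfolding log_radius_def
    using radius_lower[OF assms, of "-1" "\<theta> + d"] by (intro ln) (auto simp: radius_pos slope_nonneg)
  moreover have "d * slope \<theta> \<le> d * max (slope \<theta>) (slope (\<theta> + d))" "d * slope (\<theta> + d) \<le> d * max (slope \<theta>) (slope (\<theta> + d))"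
    using assms by (auto intro!: mult_left_mono)
  ultimately show ?thesis by linarith
qed

lemma continuous_log_radius: "continuous_on UNIV log_radius"
proof -
  have "\<bar>log_radius y - log_radius x\<bar> \<le> \<bar>y - x\<bar> * (R / r)" if "\<bar>y - x\<bar> \<le> 1" for x y
  proof -
    have *: "\<bar>log_radius (x + d) - log_radius x\<bar> \<le> d * (R / r)" if "0 \<le> d" "d \<le> 1" for x d
      using log_radius_diff[OF that, of x] slope_le that
      by (meson max.boundedI mult_left_mono order_trans)
    show ?thesis
      using *[of "y - x" x] *[of "x - y" y] that by (cases "x \<le> y") (auto simp: abs_minus_commute)
  qed
  note lip = this
  have "\<exists>d>0. \<forall>y. \<bar>y - x\<bar> < d \<longrightarrow> \<bar>log_radius y - log_radius x\<bar> < e" if "e > 0" for x e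
  proof -
    have C: "R / r + 1 > 0" using R_pos r_pos by (simp add: add_pos_pos)
    show ?thesis
    proof (intro exI[of _ "min 1 (e / (R / r + 1))"] conjI allI impI)
      show "min 1 (e / (R / r + 1)) > 0" using C that by simp
      fix y assume y: "\<bar>y - x\<bar> < min 1 (e / (R / r + 1))"
      have "\<bar>log_radius y - log_radius x\<bar> \<le> \<bar>y - x\<bar> * (R / r)" using lip y by simp
      also have "\<dots> \<le> \<bar>y - x\<bar> * (R / r + 1)" by (intro mult_left_mono) auto
      also have "\<dots> < e" using y C by (simp add: less_divide_eq)
      finally show "\<bar>log_radius y - log_radius x\<bar> < e" .
    qed
  qed
  then show ?thesis by (auto simp: continuous_on_iff dist_real_def)
qed

lemma continuous_radius: "continuous_on A radius"
proof -
  have "radius = (\<lambda>\<theta>. exp (log_radius \<theta>))" using radius_pos by (auto simp: log_radius_def)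
  then show ?thesis using continuous_log_radius
    by (metis continuous_on_exp continuous_on_subset subset_UNIV)
qed

lemma continuous_slope: "continuous_on A slope"
  unfolding slope_def[abs_def] using r_pos by (intro continuous_intros continuous_radius) auto

definition curve :: "real \<Rightarrow> real \<Rightarrow> complex" where
  "curve t \<theta> = of_real (t * radius \<theta>) * cis \<theta>"

lemma curve_in: "0 \<le> t \<Longrightarrow> t < 1 \<Longrightarrow> curve t \<theta> \<in> \<Omega>"
  unfolding curve_def using ray_in_iff[of "t * radius \<theta>" \<theta>] radius_pos[of \<theta>] by simp

text \<open>In logarithmic coordinates an angular step is additive, and its real part is the
  increment of \<open>log_radius\<close>; its quotient by \<open>d\<close> replaces the logarithmic
  derivative of the curve.\<close>

lemma curve_shift: "curve t (\<theta> + d) = curve t \<theta> * exp (Complex (log_radius (\<theta> + d) - log_radius \<theta>) d)"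
proof -
  have e: "exp (log_radius (\<theta> + d) - log_radius \<theta>) = radius (\<theta> + d) / radius \<theta>"
    using radius_pos by (simp add: log_radius_def exp_diff)
  have "curve t \<theta> * exp (Complex (log_radius (\<theta> + d) - log_radius \<theta>) d)
      = of_real (t * radius \<theta> * (radius (\<theta> + d) / radius \<theta>)) * (cis \<theta> * cis d)"
    by (simp add: curve_def exp_eq_polar e)
  also have "\<dots> = curve t (\<theta> + d)"
    using radius_pos[of \<theta>] by (simp add: curve_def cis_mult)
  finally show ?thesis by simp
qed

lemma continuous_curve: "continuous_on A (curve t)"
  unfolding curve_def[abs_def] by (intro continuous_intros continuous_radius)

end

section \<open>The contour identity along dilated boundaries\<close>

text \<open>The derivative is uniformly continuous on the compact thickening \<open>K1\<close> of
  \<open>K\<close>. The mean value inequality for f y - f'(z) y on a small ball around z turns this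
  into a first-order expansion that is uniform in z.\<close>

lemma uniform_holomorphic_taylor:
  fixes f :: "complex \<Rightarrow> complex"
  assumes f: "f holomorphic_on S" "open S" and K: "compact K" "K \<subseteq> S" and e: "e > 0"
  obtains d where "d > 0"
    "\<And>z h. z \<in> K \<Longrightarrow> norm h < d \<Longrightarrow> norm (f (z + h) - f z - deriv f z * h) \<le> e * norm h"
proof -
  obtain d1 where d1: "d1 > 0" "(\<Union>x\<in>K. cball x d1) \<subseteq> S"
    using compact_subset_open_imp_cball_epsilon_subset[OF K(1) f(2) K(2)] by metis
  define K1 where "K1 = (\<Union>x\<in>K. cball x d1)"
  have "K1 = {x + y | x y. x \<in> K \<and> y \<in> cball 0 d1}"
    unfolding K1_def by (auto simp: dist_norm) (metis add_diff_cancel_left' diff_add_cancel add.commute norm_minus_commute)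
  then have cK1: "compact K1" using compact_sums[OF K(1) compact_cball[of 0 d1]] by simp
  have "continuous_on K1 (deriv f)"
    using f d1(2) by (metis K1_def continuous_on_subset holomorphic_deriv holomorphic_on_imp_continuous_on)
  then have "uniformly_continuous_on K1 (deriv f)" using cK1 by (rule compact_uniformly_continuous)
  then obtain d2 where d2: "d2 > 0" "\<And>x y. x \<in> K1 \<Longrightarrow> y \<in> K1 \<Longrightarrow> dist y x < d2 \<Longrightarrow> dist (deriv f y) (deriv f x) < e"
    unfolding uniformly_continuous_on_def using e by metis
  show ?thesis
  proof (rule that[of "min d1 d2"])
    show "min d1 d2 > 0" using d1 d2 by simp
    fix z h :: complex assume z: "z \<in> K" and h: "norm h < min d1 d2"
    define g where "g = (\<lambda>y. f y - deriv f z * y)"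
    have sub: "ball z (min d1 d2) \<subseteq> K1" using z by (auto simp: K1_def)
    have zK: "z \<in> K1" using sub d1 d2 by auto
    have "norm (g (z + h) - g z) \<le> e * norm (z + h - z)"
    proof (rule field_differentiable_bound[of "ball z (min d1 d2)"])
      fix y assume y: "y \<in> ball z (min d1 d2)"
      then have "y \<in> S" using sub d1(2) K1_def by blast
      then have "(f has_field_derivative deriv f y) (at y)" using f holomorphic_derivI by blast
      then have "(g has_field_derivative (deriv f y - deriv f z)) (at y)"
        unfolding g_def by (auto intro!: derivative_eq_intros)
      then show "(g has_field_derivative (deriv f y - deriv f z)) (at y within ball z (min d1 d2))"
        by (rule has_field_derivative_at_within)
      show "norm (deriv f y - deriv f z) \<le> e"
      proof -
        have "y \<in> K1" "dist y z < d2" using y sub by (auto simp: dist_commute)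
        then show ?thesis using d2(2)[OF zK] by (auto simp: dist_norm intro: less_imp_le)
      qed
    qed (use h d1 d2 in \<open>auto simp: dist_norm\<close>)
    then show "norm (f (z + h) - f z - deriv f z * h) \<le> e * norm h"
      by (simp add: g_def algebra_simps)
  qed
qed

lemma integral_periodic_shift:
  fixes \<psi> :: "real \<Rightarrow> complex"
  assumes c: "continuous_on UNIV \<psi>" and p: "\<And>x. \<psi> (x + 2 * pi) = \<psi> x" and d: "0 \<le> d" "d \<le> 1"
  shows "integral {-pi..pi} (\<lambda>x. \<psi> (x + d)) = integral {-pi..pi} \<psi>"
proof -
  have i: "\<psi> integrable_on {a..b}" for a b
    using c by (intro integrable_continuous_real) (auto intro: continuous_on_subset)
  have "integral {-pi..pi} (\<lambda>x. \<psi> (x + d)) = integral {-pi + d..pi + d} \<psi>"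
    using integral_shift_Icc_real[of "-pi" pi \<psi> d] by (simp add: o_def add.commute)
  also have "\<dots> = integral {-pi + d..pi} \<psi> + integral {pi..pi + d} \<psi>"
    using d pi_gt3 by (intro Henstock_Kurzweil_Integration.integral_combine[symmetric] i) auto
  also have "integral {pi..pi + d} \<psi> = integral {-pi..-pi + d} \<psi>"
  proof -
    have "integral {-pi..-pi + d} (\<psi> \<circ> ((+) (2 * pi))) = integral {-pi + 2 * pi..-pi + d + 2 * pi} \<psi>"
      by (rule integral_shift_Icc_real)
    moreover have "\<psi> \<circ> ((+) (2 * pi)) = \<psi>" by (auto simp: add.commute[of "2 * pi"] p)
    ultimately show ?thesis by (simp add: add.commute)
  qed
  also have "integral {-pi + d..pi} \<psi> + integral {-pi..-pi + d} \<psi> = integral {-pi..pi} \<psi>"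
    using d pi_gt3 by (subst add.commute, intro Henstock_Kurzweil_Integration.integral_combine i) auto
  finally show ?thesis .
qed

context star_domain
begin

text \<open>A discrete substitute for \<open>\<integral> (F\<^sup>2 - F(0)\<^sup>2) dz/z = 0\<close> along \<open>curve t\<close>, which is merely Lipschitz:
  the difference quotients of a primitive integrate to zero by periodicity.\<close>

lemma curve_identity:
  assumes G: "G holomorphic_on \<Omega>" and t: "0 < t" "t < 1" and e: "e > 0"
  shows "\<exists>d0>0. \<forall>d. 0 < d \<longrightarrow> d < d0 \<longrightarrow> norm (integral {-pi..pi} (\<lambda>\<theta>. (G (curve t \<theta>) - G 0) *
        Complex ((log_radius (\<theta> + d) - log_radius \<theta>) / d) 1)) \<le> e"
proof -
  \<comment> \<open>(G z - G 0) / z with the singularity at 0 removed. Its primitive satisfies z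
    \<Phi>'(z) = G z - G 0, so an angular step changes \<Phi> by (G - G 0) w up to terms of smaller
    order.\<close>
  define H where "H = (\<lambda>z. if z = 0 then deriv G 0 else (G z - G 0) / (z - 0))"
  have H: "H holomorphic_on \<Omega>"
    unfolding H_def by (rule pole_lemma_open[OF G open_\<Omega>])
  have zH: "z * H z = G z - G 0" for z by (simp add: H_def)
  have "0 \<in> \<Omega>" using r_sub r_pos by auto
  then have "starlike \<Omega>"
    unfolding starlike_def using star[of _ 0] r_pos by (intro bexI[of _ 0]) (auto simp: closed_segment_commute)
  then obtain \<Phi> where \<Phi>: "\<And>z. z \<in> \<Omega> \<Longrightarrow> (\<Phi> has_field_derivative H z) (at z)"
    using holomorphic_starlike_primitive[OF holomorphic_on_imp_continuous_on[OF H] _ open_\<Omega>, of "{}"]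
      H open_\<Omega> holomorphic_on_imp_differentiable_at by blast
  have \<Phi>h: "\<Phi> holomorphic_on \<Omega>"
    using \<Phi> open_\<Omega> by (meson holomorphic_on_open)
  have d\<Phi>: "deriv \<Phi> z = H z" if "z \<in> \<Omega>" for z using \<Phi>[OF that] DERIV_imp_deriv by blast
  define K where "K = curve t ` {-pi..pi}"
  have K: "compact K" "K \<subseteq> \<Omega>"
    unfolding K_def using continuous_curve t curve_in by (auto intro!: compact_continuous_image)
  define C where "C = R / r + 1"
  have C: "C > 0" using R_pos r_pos by (simp add: C_def add_pos_pos)
  have "bounded (G ` K)"
    using K G by (meson compact_continuous_image compact_imp_bounded continuous_on_subset holomorphic_on_imp_continuous_on)
  then obtain B where B: "B > 0" "\<And>z. z \<in> K \<Longrightarrow> norm (G z) \<le> B"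
    unfolding bounded_pos by auto
  \<comment> \<open>Chosen so that the pointwise error, multiplied by the length 2 pi, is exactly e
    d.\<close>
  define e1 where "e1 = e / (2 * pi * C * (2 * R + (B + norm (G 0) + 1)))"
  have den: "2 * R + (B + norm (G 0) + 1) > 0" using R_pos B by (simp add: add_pos_nonneg)
  then have e1: "e1 > 0" using e C by (simp add: e1_def)
  obtain d1 where d1: "d1 > 0"
    "\<And>z h. z \<in> K \<Longrightarrow> norm h < d1 \<Longrightarrow> norm (\<Phi> (z + h) - \<Phi> z - deriv \<Phi> z * h) \<le> e1 * norm h"
    using uniform_holomorphic_taylor[OF \<Phi>h open_\<Omega> K e1] by metis
  have "min e1 1 > 0" using e1 by simp
  moreover have "\<forall>e>0. \<exists>d>0. \<forall>w::complex. norm w < d \<longrightarrow> norm (exp w - 1 - w) \<le> e * norm w"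
    using DERIV_exp[of "0::complex"] unfolding has_field_derivative_def has_derivative_at_alt by simp
  ultimately obtain d2 where d2: "d2 > 0" "\<And>w::complex. norm w < d2 \<Longrightarrow> norm (exp w - 1 - w) \<le> min e1 1 * norm w"
    by blast
  \<comment> \<open>The three bounds keep \<open>d\<close> in the range of
    \<open>log_radius_diff\<close>, the norm of \<open>w\<close> below \<open>d2\<close> and the
    norm of \<open>h\<close> below \<open>d1\<close>.\<close>
  define d0 where "d0 = min 1 (min (d2 / C) (d1 / (2 * R * C)))"
  show ?thesis
  proof (intro exI[of _ d0] conjI allI impI)
    show "d0 > 0" using d1 d2 C R_pos by (simp add: d0_def)
    fix d assume d: "0 < d" "d < d0"
    define w where "w = (\<lambda>\<theta>. Complex (log_radius (\<theta> + d) - log_radius \<theta>) d)"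
    have wb: "norm (w \<theta>) \<le> C * d" for \<theta>
    proof -
      have "norm (w \<theta>) \<le> \<bar>log_radius (\<theta> + d) - log_radius \<theta>\<bar> + \<bar>d\<bar>"
        using cmod_le[of "w \<theta>"] by (simp add: w_def)
      also have "\<dots> \<le> d * (R / r) + d"
      proof -
        have "d * max (slope \<theta>) (slope (\<theta> + d)) \<le> d * (R / r)" using d slope_le by (intro mult_left_mono) auto
        then show ?thesis using log_radius_diff[of d \<theta>] d by (simp add: d0_def)
      qed
      finally show ?thesis by (simp add: C_def algebra_simps)
    qed
    have wd2: "norm (w \<theta>) < d2" for \<theta>
    proof -
      have "C * d < d2" using d C by (simp add: d0_def less_divide_eq mult.commute)
      then show ?thesis using wb[of \<theta>] by simp
    qed
    have pt: "norm (\<Phi> (curve t (\<theta> + d)) - \<Phi> (curve t \<theta>) - (G (curve t \<theta>) - G 0) * w \<theta>)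
        \<le> e1 * (C * d) * (2 * R + (B + norm (G 0) + 1))" if th: "\<theta> \<in> {-pi..pi}" for \<theta>
    proof -
      define z where "z = curve t \<theta>"
      define h where "h = z * (exp (w \<theta>) - 1)"
      have zK: "z \<in> K" using th by (simp add: z_def K_def)
      have nz: "norm z \<le> R"
        using zK K(2) sub_R by (auto simp: subset_iff less_imp_le)
      have ew: "norm (exp (w \<theta>) - 1) \<le> 2 * norm (w \<theta>)"
        using d2(2)[OF wd2[of \<theta>]] norm_triangle_ineq2[of "exp (w \<theta>) - 1" "w \<theta>"]
          mult_right_mono[of "min e1 1" 1 "norm (w \<theta>)"] by simp
      have hb: "norm h \<le> 2 * R * (C * d)"
      proof -
        have "norm h \<le> R * (2 * norm (w \<theta>))"
          unfolding h_def norm_mult using nz ew R_pos by (intro mult_mono) auto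
        also have "\<dots> \<le> R * (2 * (C * d))" using wb[of \<theta>] R_pos by simp
        finally show ?thesis by (simp add: mult_ac)
      qed
      have "2 * R * (C * d) < d1"
        using d C R_pos by (simp add: d0_def less_divide_eq mult_ac)
      then have hd: "norm h < d1" using hb by simp
      have "curve t (\<theta> + d) = z + h"
        by (simp add: curve_shift z_def h_def w_def algebra_simps)
      \<comment> \<open>Two errors remain: the one of the first-order expansion of \<Phi>, and the
        one of linearising exp in h = z (exp w - 1).\<close>
      then have "\<Phi> (curve t (\<theta> + d)) - \<Phi> (curve t \<theta>) - (G (curve t \<theta>) - G 0) * w \<theta>
         = (\<Phi> (z + h) - \<Phi> z - deriv \<Phi> z * h) + (G z - G 0) * (exp (w \<theta>) - 1 - w \<theta>)"
      proof -
        have "deriv \<Phi> z * h = (G z - G 0) * (exp (w \<theta>) - 1)"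
          unfolding zH[symmetric] using d\<Phi>[of z] zK K(2) by (simp add: h_def subset_iff)
        then show ?thesis using \<open>curve t (\<theta> + d) = z + h\<close> by (simp add: z_def[symmetric] algebra_simps)
      qed
      also have "norm \<dots> \<le> e1 * norm h + (B + norm (G 0)) * (e1 * norm (w \<theta>))"
      proof (rule norm_triangle_mono[OF d1(2)[OF zK hd]])
        have "norm (exp (w \<theta>) - 1 - w \<theta>) \<le> e1 * norm (w \<theta>)"
          using d2(2)[OF wd2[of \<theta>]] mult_right_mono[of "min e1 1" e1 "norm (w \<theta>)"] by simp
        moreover have "norm (G z - G 0) \<le> B + norm (G 0)"
          using B(2)[OF zK] norm_triangle_ineq4[of "G z" "G 0"] by simp
        ultimately show "norm ((G z - G 0) * (exp (w \<theta>) - 1 - w \<theta>)) \<le> (B + norm (G 0)) * (e1 * norm (w \<theta>))"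
          unfolding norm_mult using B by (intro mult_mono) auto
      qed
      also have "\<dots> \<le> e1 * (2 * R * (C * d)) + (B + norm (G 0) + 1) * (e1 * (C * d))"
      proof (rule add_mono)
        show "e1 * norm h \<le> e1 * (2 * R * (C * d))" using hb e1 by simp
        show "(B + norm (G 0)) * (e1 * norm (w \<theta>)) \<le> (B + norm (G 0) + 1) * (e1 * (C * d))"
          using wb[of \<theta>] e1 B(1) by (intro mult_mono) auto
      qed
      also have "\<dots> = e1 * (C * d) * (2 * R + (B + norm (G 0) + 1))" by algebra
      finally show ?thesis .
    qed
    have cG: "continuous_on {-pi..pi} (\<lambda>\<theta>. G (curve t \<theta>))"
      by (rule continuous_on_compose2[OF holomorphic_on_imp_continuous_on[OF G] continuous_curve]) (use t curve_in in auto)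
    have cl: "continuous_on A (\<lambda>\<theta>. log_radius (\<theta> + d))" for A
      by (rule continuous_on_compose2[OF continuous_log_radius]) (auto intro!: continuous_intros)
    have cl': "continuous_on A log_radius" for A
      using continuous_log_radius continuous_on_subset by blast
    have cw: "continuous_on {-pi..pi} w"
      unfolding w_def Complex_eq
      by (intro continuous_on_add continuous_on_mult continuous_on_of_real continuous_on_diff continuous_on_const cl cl')
    have c\<Phi>: "continuous_on UNIV (\<lambda>\<theta>. \<Phi> (curve t \<theta>))"
      by (rule continuous_on_compose2[OF holomorphic_on_imp_continuous_on[OF \<Phi>h] continuous_curve]) (use t curve_in in auto)
    have c\<Phi>d: "continuous_on A (\<lambda>\<theta>. \<Phi> (curve t (\<theta> + d)))" for A
      by (rule continuous_on_compose2[OF c\<Phi>]) (auto intro!: continuous_intros)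
    have per: "\<Phi> (curve t (x + 2 * pi)) = \<Phi> (curve t x)" for x
      by (simp add: curve_def radius_periodic cis.code)
    define I where "I = integral {-pi..pi} (\<lambda>\<theta>. (G (curve t \<theta>) - G 0) * w \<theta>)"
    have i1: "(\<lambda>\<theta>. \<Phi> (curve t (\<theta> + d)) - \<Phi> (curve t \<theta>)) integrable_on {-pi..pi}"
      and i2: "(\<lambda>\<theta>. (G (curve t \<theta>) - G 0) * w \<theta>) integrable_on {-pi..pi}"
      using continuous_on_subset[OF c\<Phi>]
      by (auto intro!: integrable_continuous_real continuous_on_diff continuous_on_mult continuous_on_const c\<Phi>d cG cw)
    have "integral {-pi..pi} (\<lambda>\<theta>. \<Phi> (curve t (\<theta> + d)) - \<Phi> (curve t \<theta>)) = 0"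
    proof -
      have "integral {-pi..pi} (\<lambda>\<theta>. \<Phi> (curve t (\<theta> + d)) - \<Phi> (curve t \<theta>))
        = integral {-pi..pi} (\<lambda>\<theta>. \<Phi> (curve t (\<theta> + d))) - integral {-pi..pi} (\<lambda>\<theta>. \<Phi> (curve t \<theta>))"
        using continuous_on_subset[OF c\<Phi>] by (intro integral_diff integrable_continuous_real c\<Phi>d) auto
      then show ?thesis
        using integral_periodic_shift[OF c\<Phi> per, of d] d by (simp add: d0_def)
    qed
    then have "- I = integral {-pi..pi} (\<lambda>\<theta>. \<Phi> (curve t (\<theta> + d)) - \<Phi> (curve t \<theta>) - (G (curve t \<theta>) - G 0) * w \<theta>)"
      unfolding I_def using integral_diff[OF i1 i2] by simp
    also have "norm \<dots> \<le> integral {-pi..pi} (\<lambda>\<theta>. e1 * (C * d) * (2 * R + (B + norm (G 0) + 1)))"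
      by (rule integral_norm_bound_integral[OF integrable_diff[OF i1 i2]]) (use pt in auto)
    also have "\<dots> = e * d"
      using C den pi_gt_zero by (simp add: e1_def)
    finally have "norm I \<le> e * d" by simp
    moreover have "integral {-pi..pi} (\<lambda>\<theta>. (G (curve t \<theta>) - G 0) * Complex ((log_radius (\<theta> + d) - log_radius \<theta>) / d) 1) = I / of_real d"
    proof -
      have "Complex (x / d) 1 = Complex x d / of_real d" for x using d by (simp add: complex_eq_iff)
      then have "(\<lambda>\<theta>. (G (curve t \<theta>) - G 0) * Complex ((log_radius (\<theta> + d) - log_radius \<theta>) / d) 1)
        = (\<lambda>\<theta>. (G (curve t \<theta>) - G 0) * w \<theta> / of_real d)" by (simp add: w_def)
      then show ?thesis unfolding I_def by simp
    qed
    ultimately show "norm (integral {-pi..pi} (\<lambda>\<theta>. (G (curve t \<theta>) - G 0) *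
        Complex ((log_radius (\<theta> + d) - log_radius \<theta>) / d) 1)) \<le> e"
      using d by (simp add: norm_divide divide_le_eq)
  qed
qed

section \<open>The quadratic form behind the Friedrichs inequality\<close>

text \<open>The square of the larger root x of x^2 - 2 \<eta> x + 1 = 0 for \<eta> = R / r; with sin
  \<epsilon> = r / R it is cot^2 (\<epsilon>/2).\<close>

definition friedrichs_const :: real where
  "friedrichs_const = (R / r + sqrt ((R / r)\<^sup>2 - 1))\<^sup>2"

text \<open>If h + i g is the value of F on the curve and m + i the logarithmic derivative of the
  curve, then h^2 - g^2 + 2 m h g is the imaginary part of F^2 (m + i), which the contour identity
  controls. The difference of the two sides is a quadratic form in (h, g). The multiplier \<tau> =
  \<eta> x reduces its discriminant condition to \<eta>^2 - q \<ge> 0, which is radius \<le>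
  R.\<close>

lemma friedrichs_form:
  assumes m: "\<bar>m\<bar> \<le> slope \<theta>"
  shows "(radius \<theta> / r)\<^sup>2 * (h\<^sup>2 - friedrichs_const * g\<^sup>2)
    \<le> (friedrichs_const + 1) / 2 * (h\<^sup>2 - g\<^sup>2 + 2 * m * h * g)"
proof -
  define \<eta> where "\<eta> = R / r"
  define x where "x = \<eta> + sqrt (\<eta>\<^sup>2 - 1)"
  define q where "q = (radius \<theta> / r)\<^sup>2"
  have \<eta>: "\<eta> \<ge> 1" using radius_bounds[of \<theta>] r_pos by (simp add: \<eta>_def)
  then have "\<eta>\<^sup>2 \<ge> 1" using power_mono[of 1 \<eta> 2] by simp
  then have x: "x \<ge> \<eta>" "x\<^sup>2 + 1 = 2 * \<eta> * x"
    by (auto simp: x_def power2_eq_square algebra_simps)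
  have \<Gamma>: "friedrichs_const = x\<^sup>2" by (simp add: friedrichs_const_def x_def \<eta>_def)
  define \<tau> where "\<tau> = \<eta> * x"
  have \<tau>: "(friedrichs_const + 1) / 2 = \<tau>" "\<tau> > 0" using x \<eta> by (auto simp: \<Gamma> \<tau>_def)
  have q: "1 \<le> q" "q \<le> \<eta>\<^sup>2" "(slope \<theta>)\<^sup>2 = q - 1"
  proof -
    have 1: "1 \<le> radius \<theta> / r" "radius \<theta> / r \<le> \<eta>"
      using radius_bounds r_pos by (auto simp: \<eta>_def divide_right_mono)
    then show "1 \<le> q" unfolding q_def using power_mono[of 1 "radius \<theta> / r" 2] by simp
    show "q \<le> \<eta>\<^sup>2" unfolding q_def using 1 by (intro power_mono) auto
    show "(slope \<theta>)\<^sup>2 = q - 1" using \<open>1 \<le> q\<close> by (simp add: slope_def q_def)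
  qed
  define \<alpha> where "\<alpha> = \<tau> - q"
  define \<beta> where "\<beta> = x\<^sup>2 * q - \<tau>"
  have "\<eta>\<^sup>2 \<le> \<tau>" unfolding \<tau>_def power2_eq_square using x(1) \<eta> by (intro mult_left_mono) auto
  then have \<alpha>: "\<alpha> \<ge> 0" using q by (simp add: \<alpha>_def)
  have \<beta>: "\<beta> \<ge> 0"
  proof -
    have "\<tau> \<le> x\<^sup>2" unfolding \<tau>_def power2_eq_square using x(1) \<eta> by (intro mult_right_mono) auto
    also have "\<dots> \<le> x\<^sup>2 * q" using q by (simp add: mult_le_cancel_left1)
    finally show ?thesis by (simp add: \<beta>_def)
  qed
  have disc: "\<tau>\<^sup>2 * m\<^sup>2 \<le> \<alpha> * \<beta>"
  proof -
    have "\<tau>\<^sup>2 * m\<^sup>2 \<le> \<tau>\<^sup>2 * (q - 1)"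
      using m unfolding q(3)[symmetric] by (intro mult_left_mono abs_le_square_iff[THEN iffD1]) (auto simp: slope_nonneg)
    moreover have "\<alpha> * \<beta> - \<tau>\<^sup>2 * (q - 1) = q * x\<^sup>2 * (\<eta>\<^sup>2 - q)"
      using x(2) unfolding \<alpha>_def \<beta>_def \<tau>_def by algebra
    moreover have "q * x\<^sup>2 * (\<eta>\<^sup>2 - q) \<ge> 0" using q by simp
    ultimately show ?thesis by simp
  qed
  have "0 \<le> \<alpha> * h\<^sup>2 + \<beta> * g\<^sup>2 + 2 * \<tau> * m * h * g"
  \<comment> \<open>The square is completed after multiplication by \<alpha>; if \<alpha> = 0, the
    discriminant condition forces m = 0.\<close>
  proof (cases "\<alpha> = 0")
    case True
    then have "m = 0" using disc \<tau>(2) by (simp add: mult_le_0_iff)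
    then show ?thesis using True \<beta> by simp
  next
    case False
    have "\<alpha> * (\<alpha> * h\<^sup>2 + \<beta> * g\<^sup>2 + 2 * \<tau> * m * h * g) = (\<alpha> * h + \<tau> * m * g)\<^sup>2 + (\<alpha> * \<beta> - \<tau>\<^sup>2 * m\<^sup>2) * g\<^sup>2"
      by (simp add: power2_eq_square algebra_simps)
    also have "\<dots> \<ge> 0" using disc by (intro add_nonneg_nonneg mult_nonneg_nonneg) auto
    finally show ?thesis using False \<alpha> by (simp add: zero_le_mult_iff)
  qed
  moreover have "\<tau> * (h\<^sup>2 - g\<^sup>2 + 2 * m * h * g) - q * (h\<^sup>2 - x\<^sup>2 * g\<^sup>2) = \<alpha> * h\<^sup>2 + \<beta> * g\<^sup>2 + 2 * \<tau> * m * h * g"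
    by (simp add: \<alpha>_def \<beta>_def algebra_simps)
  ultimately show ?thesis unfolding \<tau>(1) unfolding \<Gamma> q_def[symmetric] by linarith
qed

lemma continuous_on_curve:
  assumes "continuous_on \<Omega> f" "0 \<le> t" "t < 1"
  shows "continuous_on A (\<lambda>\<theta>. f (curve t \<theta>))"
proof (rule continuous_on_compose2[OF assms(1) continuous_curve])
  show "curve t ` A \<subseteq> \<Omega>" using curve_in[OF assms(2,3)] by blast
qed

lemma friedrichs_curve:
  assumes F: "F holomorphic_on \<Omega>" and F0: "Re (F 0) = 0" and t: "0 < t" "t < 1"
  shows "integral {-pi..pi} (\<lambda>\<theta>. (radius \<theta>)\<^sup>2 * (Re (F (curve t \<theta>)))\<^sup>2)
    \<le> friedrichs_const * integral {-pi..pi} (\<lambda>\<theta>. (radius \<theta>)\<^sup>2 * (Im (F (curve t \<theta>)))\<^sup>2)"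
proof -
  define h where "h = (\<lambda>\<theta>. Re (F (curve t \<theta>)))"
  define g where "g = (\<lambda>\<theta>. Im (F (curve t \<theta>)))"
  define \<tau> where "\<tau> = (friedrichs_const + 1) / 2"
  have \<tau>: "\<tau> > 0" by (simp add: \<tau>_def friedrichs_const_def add_nonneg_pos)
  have cF: "continuous_on \<Omega> F" using F holomorphic_on_imp_continuous_on by blast
  have ch: "continuous_on A h" and cg: "continuous_on A g" for A
    unfolding h_def g_def using t by (auto intro!: continuous_on_Re continuous_on_Im continuous_on_curve[OF cF])
  define A where "A = integral {-pi..pi} (\<lambda>\<theta>. (radius \<theta> / r)\<^sup>2 * ((h \<theta>)\<^sup>2 - friedrichs_const * (g \<theta>)\<^sup>2))"
  define B where "B = integral {-pi..pi} (\<lambda>\<theta>. \<bar>h \<theta> * g \<theta>\<bar>)"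
  have B: "B \<ge> 0" unfolding B_def by (intro integral_nonneg integrable_continuous_real continuous_intros ch cg) auto
  \<comment> \<open>A bound by an arbitrarily small multiple of a fixed constant gives A \<le> 0;
    here \<open>e\<close> bounds both the contour integral and the oscillation of
    \<open>slope\<close> over one step.\<close>
  have Ae: "A \<le> e * (\<tau> * (1 + 2 * B))" if e: "e > 0" for e
  proof -
    have G: "(\<lambda>z. (F z)\<^sup>2) holomorphic_on \<Omega>" by (intro holomorphic_intros F)
    obtain d0 where d0: "d0 > 0"
      "\<And>d. 0 < d \<Longrightarrow> d < d0 \<Longrightarrow> norm (integral {-pi..pi} (\<lambda>\<theta>. ((F (curve t \<theta>))\<^sup>2 - (F 0)\<^sup>2) *
        Complex ((log_radius (\<theta> + d) - log_radius \<theta>) / d) 1)) \<le> e"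
      using curve_identity[OF G t e] by blast
    have "uniformly_continuous_on {-pi..pi + 1} slope"
      by (intro compact_uniformly_continuous continuous_slope) auto
    then obtain d1 where d1: "d1 > 0"
      "\<And>x y. x \<in> {-pi..pi + 1} \<Longrightarrow> y \<in> {-pi..pi + 1} \<Longrightarrow> dist y x < d1 \<Longrightarrow> dist (slope y) (slope x) < e"
      unfolding uniformly_continuous_on_def using e by metis
    define d where "d = min 1 (min (d0 / 2) (d1 / 2))"
    have d: "0 < d" "d < d0" "d < d1" "d \<le> 1" using d0 d1 by (auto simp: d_def)
    define \<mu> where "\<mu> = (\<lambda>\<theta>. (log_radius (\<theta> + d) - log_radius \<theta>) / d)"
    define W where "W = (\<lambda>\<theta>. ((F (curve t \<theta>))\<^sup>2 - (F 0)\<^sup>2) * Complex (\<mu> \<theta>) 1)"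
    have ImW: "Im (W \<theta>) = (h \<theta>)\<^sup>2 - (g \<theta>)\<^sup>2 + (Im (F 0))\<^sup>2 + 2 * \<mu> \<theta> * h \<theta> * g \<theta>" for \<theta>
      using F0 by (simp add: W_def h_def g_def power2_eq_square algebra_simps)
    have c\<mu>: "continuous_on A \<mu>" for A
      unfolding \<mu>_def
      by (intro continuous_on_divide continuous_on_diff continuous_on_const
          continuous_on_compose2[OF continuous_log_radius] continuous_on_subset[OF continuous_log_radius])
        (use d in \<open>auto intro!: continuous_intros\<close>)
    have iW: "W integrable_on {-pi..pi}"
      unfolding W_def Complex_eq
      by (intro integrable_continuous_real continuous_on_mult continuous_on_diff continuous_on_power
          continuous_on_add continuous_on_of_real continuous_on_const c\<mu> continuous_on_curve[OF cF]) (use t in auto)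
    have pt: "(radius \<theta> / r)\<^sup>2 * ((h \<theta>)\<^sup>2 - friedrichs_const * (g \<theta>)\<^sup>2) \<le> \<tau> * (Im (W \<theta>) + 2 * e * \<bar>h \<theta> * g \<theta>\<bar>)"
      if th: "\<theta> \<in> {-pi..pi}" for \<theta>
    proof -
      have "\<bar>\<mu> \<theta>\<bar> \<le> max (slope \<theta>) (slope (\<theta> + d))"
        using log_radius_diff[of d \<theta>] d by (simp add: \<mu>_def abs_divide divide_le_eq mult.commute)
      moreover have "\<bar>slope (\<theta> + d) - slope \<theta>\<bar> < e"
        using d1(2)[of \<theta> "\<theta> + d"] th d by (simp add: dist_real_def)
      ultimately have \<mu>b: "\<bar>\<mu> \<theta>\<bar> \<le> slope \<theta> + e" using e by (auto simp: max_def split: if_splits)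
      \<comment> \<open>\<open>log_radius_diff\<close> involves the slopes at both ends, so the
        difference quotient may exceed \<open>slope \<theta>\<close> by up to \<open>e\<close>.
        Clipping makes \<open>friedrichs_form\<close> applicable at the cost of 2 e |h g|.\<close>
      define m where "m = max (- slope \<theta>) (min (slope \<theta>) (\<mu> \<theta>))"
      have m: "\<bar>m\<bar> \<le> slope \<theta>" "\<bar>m - \<mu> \<theta>\<bar> \<le> e"
        using \<mu>b slope_nonneg[of \<theta>] e by (auto simp: m_def max_def min_def)
      have "(m - \<mu> \<theta>) * (h \<theta> * g \<theta>) \<le> e * \<bar>h \<theta> * g \<theta>\<bar>"
      proof -
        have "(m - \<mu> \<theta>) * (h \<theta> * g \<theta>) \<le> \<bar>m - \<mu> \<theta>\<bar> * \<bar>h \<theta> * g \<theta>\<bar>" by (metis abs_ge_self abs_mult)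
        also have "\<dots> \<le> e * \<bar>h \<theta> * g \<theta>\<bar>" using m by (intro mult_right_mono) auto
        finally show ?thesis .
      qed
      then have "m * (h \<theta> * g \<theta>) \<le> e * \<bar>h \<theta> * g \<theta>\<bar> + \<mu> \<theta> * (h \<theta> * g \<theta>)"
        by (simp add: left_diff_distrib)
      moreover have "2 * m * h \<theta> * g \<theta> = 2 * (m * (h \<theta> * g \<theta>))" "2 * \<mu> \<theta> * h \<theta> * g \<theta> = 2 * (\<mu> \<theta> * (h \<theta> * g \<theta>))"
        "2 * e * \<bar>h \<theta> * g \<theta>\<bar> = 2 * (e * \<bar>h \<theta> * g \<theta>\<bar>)" "0 \<le> (Im (F 0))\<^sup>2"
        by (simp_all only: mult.assoc zero_le_power2)
      ultimately have "(h \<theta>)\<^sup>2 - (g \<theta>)\<^sup>2 + 2 * m * h \<theta> * g \<theta> \<le> Im (W \<theta>) + 2 * e * \<bar>h \<theta> * g \<theta>\<bar>"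
        unfolding ImW by linarith
      then have "\<tau> * ((h \<theta>)\<^sup>2 - (g \<theta>)\<^sup>2 + 2 * m * h \<theta> * g \<theta>) \<le> \<tau> * (Im (W \<theta>) + 2 * e * \<bar>h \<theta> * g \<theta>\<bar>)"
        using \<tau> by simp
      then show ?thesis using friedrichs_form[OF m(1), of "h \<theta>" "g \<theta>"] by (simp add: \<tau>_def)
    qed
    have ImI: "((\<lambda>\<theta>. Im (W \<theta>)) has_integral Im (integral {-pi..pi} W)) {-pi..pi}"
      by (rule has_integral_Im[OF integrable_integral[OF iW]])
    have BI: "((\<lambda>\<theta>. \<bar>h \<theta> * g \<theta>\<bar>) has_integral B) {-pi..pi}"
      unfolding B_def by (intro integrable_integral integrable_continuous_real continuous_intros ch cg)
    have HW: "((\<lambda>\<theta>. \<tau> * (Im (W \<theta>) + 2 * e * \<bar>h \<theta> * g \<theta>\<bar>)) has_integral \<tau> * (Im (integral {-pi..pi} W) + 2 * e * B)) {-pi..pi}"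
      by (rule has_integral_mult_right[OF has_integral_add[OF ImI has_integral_mult_right[OF BI]]])
    have HA: "((\<lambda>\<theta>. (radius \<theta> / r)\<^sup>2 * ((h \<theta>)\<^sup>2 - friedrichs_const * (g \<theta>)\<^sup>2)) has_integral A) {-pi..pi}"
      unfolding A_def using r_pos
      by (intro integrable_integral integrable_continuous_real continuous_intros ch cg continuous_radius) auto
    have "A \<le> \<tau> * (Im (integral {-pi..pi} W) + 2 * e * B)"
      by (rule has_integral_le[OF HA HW pt])
    also have "\<dots> \<le> \<tau> * (e + 2 * e * B)"
    proof -
      have "Im (integral {-pi..pi} W) \<le> e"
        using abs_Im_le_cmod[of "integral {-pi..pi} W"] d0(2)[of d] d by (simp add: W_def \<mu>_def)
      then show ?thesis using \<tau> by simp
    qed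
    finally show ?thesis by (simp add: algebra_simps)
  qed
  have "A \<le> 0"
  proof (rule field_le_epsilon)
    fix e :: real assume e: "e > 0"
    define c where "c = \<tau> * (1 + 2 * B)"
    have "c > 0" using \<tau> B by (simp add: c_def add_pos_nonneg)
    then have "e / c * c = e" "e / c > 0" using e by auto
    then show "A \<le> 0 + e" using Ae[of "e / c"] by (simp only: c_def[symmetric] add_0)
  qed
  moreover have "A = (integral {-pi..pi} (\<lambda>\<theta>. (radius \<theta>)\<^sup>2 * (h \<theta>)\<^sup>2)
      - friedrichs_const * integral {-pi..pi} (\<lambda>\<theta>. (radius \<theta>)\<^sup>2 * (g \<theta>)\<^sup>2)) / r\<^sup>2"
  proof -
    have i: "(\<lambda>\<theta>. (radius \<theta>)\<^sup>2 * (h \<theta>)\<^sup>2) integrable_on {-pi..pi}" "(\<lambda>\<theta>. (radius \<theta>)\<^sup>2 * (g \<theta>)\<^sup>2) integrable_on {-pi..pi}"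
      by (intro integrable_continuous_real continuous_intros ch cg continuous_radius)+
    have "((\<lambda>\<theta>. ((radius \<theta>)\<^sup>2 * (h \<theta>)\<^sup>2 - friedrichs_const * ((radius \<theta>)\<^sup>2 * (g \<theta>)\<^sup>2)) / r\<^sup>2) has_integral
      (integral {-pi..pi} (\<lambda>\<theta>. (radius \<theta>)\<^sup>2 * (h \<theta>)\<^sup>2)
        - friedrichs_const * integral {-pi..pi} (\<lambda>\<theta>. (radius \<theta>)\<^sup>2 * (g \<theta>)\<^sup>2)) / r\<^sup>2) {-pi..pi}"
      using has_integral_divide[OF has_integral_diff[OF integrable_integral[OF i(1)] has_integral_mult_right[OF integrable_integral[OF i(2)]]]] .
    moreover have "(radius \<theta> / r)\<^sup>2 * ((h \<theta>)\<^sup>2 - friedrichs_const * (g \<theta>)\<^sup>2)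
       = ((radius \<theta>)\<^sup>2 * (h \<theta>)\<^sup>2 - friedrichs_const * ((radius \<theta>)\<^sup>2 * (g \<theta>)\<^sup>2)) / r\<^sup>2" for \<theta>
      by (simp add: power_divide right_diff_distrib diff_divide_distrib mult_ac)
    ultimately show ?thesis unfolding A_def by (intro integral_unique) (simp only:)
  qed
  ultimately show ?thesis using r_pos by (simp add: h_def g_def divide_le_0_iff)
qed

section \<open>Integration over a star-shaped domain\<close>

text \<open>A shift of the inner variable in \<open>nn_integral_log_polar\<close> by
  \<open>log_radius \<theta>\<close> straightens the domain to s < 0. The lines of constant s are
  the curves \<open>curve (exp s)\<close>, and (radius \<theta>)^2 is the additional
  Jacobian.\<close>

lemma nn_integral_star_log_polar:
  fixes X :: "complex \<Rightarrow> real"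
  assumes X: "continuous_on \<Omega> X" "\<And>z. z \<in> \<Omega> \<Longrightarrow> X z \<ge> 0"
  shows "(\<integral>\<^sup>+z\<in>\<Omega>. ennreal (X z) \<partial>lborel)
    = (\<integral>\<^sup>+s\<in>{..<0}. ennreal (exp (2 * s) * integral {-pi..pi} (\<lambda>\<theta>. (radius \<theta>)\<^sup>2 * X (curve (exp s) \<theta>))) \<partial>lborel)"
proof -
  define H where "H = (\<lambda>z. if z \<in> \<Omega> then X z else 0)"
  have Hm [measurable]: "H \<in> borel_measurable borel"
    unfolding H_def using borel_measurable_continuous_on_if[of \<Omega> X "\<lambda>_. 0"] X open_\<Omega> by auto
  have [measurable]: "log_radius \<in> borel_measurable borel"
    by (intro borel_measurable_continuous_onI continuous_log_radius)
  have [measurable]: "exp \<in> borel_measurable (borel :: complex measure)"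
    by (intro borel_measurable_continuous_onI continuous_intros)
  define J where "J = (\<lambda>p::real\<times>real. ennreal (H (exp (Complex (fst p + log_radius (snd p)) (snd p))))
      * ennreal (exp (2 * (fst p + log_radius (snd p)))) * indicator {-pi<..<pi} (snd p))"
  have Jm [measurable]: "J \<in> borel_measurable (lborel \<Otimes>\<^sub>M lborel)"
    unfolding J_def Complex_eq by measurable
  have ec: "exp (Complex (s + log_radius \<theta>) \<theta>) = curve (exp s) \<theta>" for s \<theta>
    using radius_pos[of \<theta>] by (simp add: curve_def exp_eq_polar log_radius_def exp_add)
  have "(\<integral>\<^sup>+z\<in>\<Omega>. ennreal (X z) \<partial>lborel) = (\<integral>\<^sup>+z. ennreal (H z) \<partial>lborel)"
    by (intro nn_integral_cong) (auto simp: H_def indicator_def)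
  also have "\<dots> = (\<integral>\<^sup>+\<theta>\<in>{-pi<..<pi}. (\<integral>\<^sup>+s. ennreal (H (exp (Complex s \<theta>))) * ennreal (exp (2 * s)) \<partial>lborel) \<partial>lborel)"
    by (rule nn_integral_log_polar) measurable
  also have "\<dots> = (\<integral>\<^sup>+\<theta>. (\<integral>\<^sup>+s. J (s, \<theta>) \<partial>lborel) \<partial>lborel)"
  proof (rule nn_integral_cong)
    fix \<theta> :: real
    have [measurable]: "(\<lambda>s. Complex s \<theta>) \<in> borel_measurable borel"
      unfolding Complex_eq by measurable
    have "(\<integral>\<^sup>+s. ennreal (H (exp (Complex s \<theta>))) * ennreal (exp (2 * s)) \<partial>lborel)
      = (\<integral>\<^sup>+s. ennreal (H (exp (Complex (s + log_radius \<theta>) \<theta>))) * ennreal (exp (2 * (s + log_radius \<theta>))) \<partial>lborel)"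
      using nn_integral_real_affine[of "\<lambda>s. ennreal (H (exp (Complex s \<theta>))) * ennreal (exp (2 * s))" 1 "log_radius \<theta>"]
      by (simp add: add.commute)
    then show "(\<integral>\<^sup>+s. ennreal (H (exp (Complex s \<theta>))) * ennreal (exp (2 * s)) \<partial>lborel) * indicator {-pi<..<pi} \<theta>
       = (\<integral>\<^sup>+s. J (s, \<theta>) \<partial>lborel)"
      by (auto simp: J_def indicator_def)
  qed
  also have "\<dots> = (\<integral>\<^sup>+s. (\<integral>\<^sup>+\<theta>. J (s, \<theta>) \<partial>lborel) \<partial>lborel)"
    by (rule lborel_pair.Fubini') simp
  also have "\<dots> = (\<integral>\<^sup>+s\<in>{..<0}. ennreal (exp (2 * s) * integral {-pi..pi} (\<lambda>\<theta>. (radius \<theta>)\<^sup>2 * X (curve (exp s) \<theta>))) \<partial>lborel)"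
  proof (rule nn_integral_cong)
    fix s :: real
    show "(\<integral>\<^sup>+\<theta>. J (s, \<theta>) \<partial>lborel) = ennreal (exp (2 * s) * integral {-pi..pi} (\<lambda>\<theta>. (radius \<theta>)\<^sup>2 * X (curve (exp s) \<theta>))) * indicator {..<0} s"
    proof (cases "s < 0")
      case False
      have "curve (exp s) \<theta> \<notin> \<Omega>" for \<theta>
        unfolding curve_def using ray_in_iff[of "exp s * radius \<theta>" \<theta>] radius_pos[of \<theta>] False by simp
      then have "J (s, \<theta>) = 0" for \<theta> by (simp add: J_def H_def ec)
      then show ?thesis using False by simp
    next
      case True
      then have in\<Omega>: "curve (exp s) \<theta> \<in> \<Omega>" for \<theta> by (intro curve_in) auto
      define f where "f = (\<lambda>\<theta>. exp (2 * s) * ((radius \<theta>)\<^sup>2 * X (curve (exp s) \<theta>)))"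
      have cf: "continuous_on T f" for T
        unfolding f_def using True
        by (intro continuous_on_mult continuous_on_const continuous_on_power continuous_radius continuous_on_curve[OF X(1)]) auto
      have f0: "f \<theta> \<ge> 0" for \<theta> unfolding f_def using X(2)[OF in\<Omega>] by simp
      have "(\<integral>\<^sup>+\<theta>. J (s, \<theta>) \<partial>lborel) = (\<integral>\<^sup>+\<theta>\<in>{-pi..pi}. ennreal (f \<theta>) \<partial>lborel)"
      proof (rule nn_integral_cong_AE)
        have "AE \<theta> in lborel. \<theta> \<noteq> pi \<and> \<theta> \<noteq> - pi"
          using AE_lborel_singleton[of pi] AE_lborel_singleton[of "-pi"] by auto
        then show "AE \<theta> in lborel. J (s, \<theta>) = ennreal (f \<theta>) * indicator {-pi..pi} \<theta>"
        proof eventually_elim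
          case (elim \<theta>)
          have "exp (2 * (s + log_radius \<theta>)) = exp (2 * s) * (radius \<theta>)\<^sup>2"
            using radius_pos[of \<theta>] by (simp add: distrib_left exp_add log_radius_def exp_double)
          then show ?case
            using elim in\<Omega>[of \<theta>] X(2)[OF in\<Omega>[of \<theta>]]
            by (auto simp: J_def H_def ec f_def indicator_def mult_ac simp flip: ennreal_mult')
        qed
      qed
      also have "\<dots> = ennreal (integral {-pi..pi} f)"
        using nn_integral_has_integral_lebesgue'[of "{-pi..pi}" f "integral {-pi..pi} f"] f0
          borel_measurable_continuous_onI[OF cf]
        by (simp add: nn_integral_completion integrable_continuous_real cf integrable_integral)
      finally show ?thesis using True by (simp add: f_def)
    qed
  qed
  finally show ?thesis .
qed

theorem friedrichs_inequality:
  assumes F: "F holomorphic_on \<Omega>" and F0: "Re (F 0) = 0"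
  shows "(\<integral>\<^sup>+z\<in>\<Omega>. ennreal ((Re (F z))\<^sup>2) \<partial>lborel)
    \<le> ennreal friedrichs_const * (\<integral>\<^sup>+z\<in>\<Omega>. ennreal ((Im (F z))\<^sup>2) \<partial>lborel)"
proof -
  have cF: "continuous_on \<Omega> F" using F holomorphic_on_imp_continuous_on by blast
  have C0: "friedrichs_const \<ge> 0" by (simp add: friedrichs_const_def)
  have "(\<integral>\<^sup>+z\<in>\<Omega>. ennreal ((Re (F z))\<^sup>2) \<partial>lborel)
    = (\<integral>\<^sup>+s\<in>{..<0}. ennreal (exp (2 * s) * integral {-pi..pi} (\<lambda>\<theta>. (radius \<theta>)\<^sup>2 * (Re (F (curve (exp s) \<theta>)))\<^sup>2)) \<partial>lborel)"
    by (rule nn_integral_star_log_polar) (auto intro!: continuous_intros cF)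
  also have "\<dots> \<le> (\<integral>\<^sup>+s\<in>{..<0}. ennreal (exp (2 * s) * integral {-pi..pi} (\<lambda>\<theta>. (radius \<theta>)\<^sup>2 * (friedrichs_const * (Im (F (curve (exp s) \<theta>)))\<^sup>2))) \<partial>lborel)"
  proof (intro nn_integral_mono)
    fix s :: real
    show "ennreal (exp (2 * s) * integral {-pi..pi} (\<lambda>\<theta>. (radius \<theta>)\<^sup>2 * (Re (F (curve (exp s) \<theta>)))\<^sup>2)) * indicator {..<0} s
      \<le> ennreal (exp (2 * s) * integral {-pi..pi} (\<lambda>\<theta>. (radius \<theta>)\<^sup>2 * (friedrichs_const * (Im (F (curve (exp s) \<theta>)))\<^sup>2))) * indicator {..<0} s"
    proof (cases "s < 0")
      case True
      have "integral {-pi..pi} (\<lambda>\<theta>. (radius \<theta>)\<^sup>2 * (friedrichs_const * (Im (F (curve (exp s) \<theta>)))\<^sup>2))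
        = friedrichs_const * integral {-pi..pi} (\<lambda>\<theta>. (radius \<theta>)\<^sup>2 * (Im (F (curve (exp s) \<theta>)))\<^sup>2)"
        by (simp add: mult.left_commute)
      then show ?thesis
        using friedrichs_curve[OF F F0, of "exp s"] True by (auto intro!: ennreal_leI)
    qed simp
  qed
  also have "\<dots> = (\<integral>\<^sup>+z\<in>\<Omega>. ennreal (friedrichs_const * (Im (F z))\<^sup>2) \<partial>lborel)"
    by (rule nn_integral_star_log_polar[symmetric]) (auto intro!: continuous_intros cF simp: C0)
  also have "\<dots> = ennreal friedrichs_const * (\<integral>\<^sup>+z\<in>\<Omega>. ennreal ((Im (F z))\<^sup>2) \<partial>lborel)"
  proof -
    have "(\<lambda>z. if z \<in> \<Omega> then (Im (F z))\<^sup>2 else 0) \<in> borel_measurable borel"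
      by (rule borel_measurable_continuous_on_if) (use open_\<Omega> in \<open>auto intro!: continuous_intros cF\<close>)
    then have m: "(\<lambda>z. ennreal (if z \<in> \<Omega> then (Im (F z))\<^sup>2 else 0)) \<in> borel_measurable lborel" by simp
    have "(\<integral>\<^sup>+z\<in>\<Omega>. ennreal (friedrichs_const * (Im (F z))\<^sup>2) \<partial>lborel)
      = (\<integral>\<^sup>+z. ennreal friedrichs_const * ennreal (if z \<in> \<Omega> then (Im (F z))\<^sup>2 else 0) \<partial>lborel)"
      by (intro nn_integral_cong) (auto simp: indicator_def ennreal_mult'' C0)
    also have "\<dots> = ennreal friedrichs_const * (\<integral>\<^sup>+z. ennreal (if z \<in> \<Omega> then (Im (F z))\<^sup>2 else 0) \<partial>lborel)"
      by (rule nn_integral_cmult[OF m])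
    also have "(\<integral>\<^sup>+z. ennreal (if z \<in> \<Omega> then (Im (F z))\<^sup>2 else 0) \<partial>lborel) = (\<integral>\<^sup>+z\<in>\<Omega>. ennreal ((Im (F z))\<^sup>2) \<partial>lborel)"
      by (intro nn_integral_cong) (auto simp: indicator_def)
    finally show ?thesis .
  qed
  finally show ?thesis .
qed

end

section \<open>Approximation by polynomials on the disc\<close>

lemma circle_in_ball: "s < 0 \<Longrightarrow> of_real (exp s) * cis t \<in> ball 0 1"
  by (simp add: norm_mult)

lemma continuous_on_log_polar:
  assumes "continuous_on (ball 0 1) h"
  shows "continuous_on ({..<0} \<times> T) (\<lambda>(s, t). h (of_real (exp s) * cis t))"
  unfolding case_prod_beta
  by (rule continuous_on_compose2[OF assms]) (auto intro!: continuous_intros simp: norm_mult)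

lemma continuous_on_circle:
  assumes "continuous_on (ball 0 1) h" "s < 0"
  shows "continuous_on T (\<lambda>t. h (of_real (exp s) * cis t))"
  by (rule continuous_on_compose2[OF assms(1)]) (use assms(2) in \<open>auto intro!: continuous_intros simp: norm_mult\<close>)

text \<open>The unit disc is a star domain with r = R = 1, which forces its radius to be 1 in every
  direction.\<close>

lemma nn_integral_disc_log_polar:
  fixes h :: "complex \<Rightarrow> real"
  assumes h: "continuous_on (ball 0 1) h" "\<And>z. z \<in> ball 0 1 \<Longrightarrow> h z \<ge> 0"
  shows "(\<integral>\<^sup>+z\<in>ball 0 1. ennreal (h z) \<partial>lborel)
    = (\<integral>\<^sup>+s\<in>{..<0}. ennreal (exp (2 * s) * integral {-pi..pi} (\<lambda>t. h (of_real (exp s) * cis t))) \<partial>lborel)"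
proof -
  interpret star_domain "ball 0 1" 1 1
  proof
    show "closed_segment x y \<subseteq> ball 0 1" if "x \<in> ball 0 1" "y \<in> ball 0 1" for x y :: complex
      using that closed_segment_subset[OF _ _ convex_ball] by blast
  qed auto
  have "radius \<theta> = 1" for \<theta> using radius_bounds[of \<theta>] by simp
  then show ?thesis
    using nn_integral_star_log_polar[OF h] by (simp add: curve_def)
qed

context
  fixes V :: "complex \<Rightarrow> complex" and V' :: "complex \<Rightarrow> complex \<Rightarrow> complex"
  assumes der: "\<And>z. z \<in> ball 0 1 \<Longrightarrow> (V has_derivative V' z) (at z)"
    and c1: "continuous_on (ball 0 1) (\<lambda>z. V' z 1)"
    and ci: "continuous_on (ball 0 1) (\<lambda>z. V' z \<i>)"
begin

text \<open>Twice the Wirtinger derivative of \<open>V\<close> with respect to the conjugate variable.\<close>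

definition "dbar z = V' z 1 + \<i> * V' z \<i>"

definition "fmode n s = fourier_coeff (\<lambda>t. V (of_real (exp s) * cis t)) n"

text \<open>In the coordinates z = exp (s + i t), the expression (d/ds + i d/dt) V equals cnj z
  times \<open>dbar z\<close>; hence the extra factor.\<close>

definition "dbar_mode n s = fourier_coeff (\<lambda>t. cnj (of_real (exp s) * cis t) * dbar (of_real (exp s) * cis t)) n"

lemma V'_lin: "z \<in> ball 0 1 \<Longrightarrow> V' z w = of_real (Re w) * V' z 1 + of_real (Im w) * V' z \<i>"
proof -
  assume "z \<in> ball 0 1"
  then interpret bounded_linear "V' z" using der has_derivative_bounded_linear by blast
  have "w = Re w *\<^sub>R 1 + Im w *\<^sub>R \<i>" by (simp add: complex_eq_iff)
  then have "V' z w = Re w *\<^sub>R V' z 1 + Im w *\<^sub>R V' z \<i>" by (metis add scale)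
  then show ?thesis by (simp add: scaleR_conv_of_real)
qed

lemma continuous_V: "continuous_on (ball 0 1) V"
  using der by (meson continuous_at_imp_continuous_on has_derivative_continuous)

lemma continuous_dbar: "continuous_on (ball 0 1) dbar"
  unfolding dbar_def[abs_def] by (intro continuous_intros c1 ci)

text \<open>The n-th Fourier coefficient of (d/ds + i d/dt) V = cnj z dbar z. Integration by parts
  turns the angular term into -n times the mode, which moves to the other side.\<close>

lemma fmode_derivative:
  assumes s: "s < 0"
  shows "(fmode n has_vector_derivative (of_real (of_int n) * fmode n s + dbar_mode n s)) (at s)"
proof -
  define E where "E = (\<lambda>s t. of_real (exp s) * cis t)"
  define c where "c = (\<lambda>t. cis (- (of_int n * t)))"
  have Eb: "E s t \<in> ball 0 1" if "s < 0" for s t using circle_in_ball[OF that] by (simp add: E_def)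
  have cc: "continuous_on T c" for T unfolding c_def by (intro continuous_intros)
  have E1: "((\<lambda>s. E s t) has_vector_derivative E s t) (at s)" for s t
    unfolding E_def has_vector_derivative_complex_iff by (auto intro!: derivative_eq_intros)
  have E2: "((\<lambda>t. E s t) has_vector_derivative \<i> * E s t) (at t)" for s t
    unfolding E_def has_vector_derivative_complex_iff by (auto intro!: derivative_eq_intros)
  have d1: "((\<lambda>s. V (E s t)) has_vector_derivative V' (E s t) (E s t)) (at s)" if "s < 0" for s t
    using vector_derivative_diff_chain_within[OF E1 has_derivative_at_withinI[OF der[OF Eb[OF that]]]]
    by (simp add: o_def)
  have d2: "((\<lambda>t. V (E s t)) has_vector_derivative V' (E s t) (\<i> * E s t)) (at t)" for t
    using vector_derivative_diff_chain_within[OF E2 has_derivative_at_withinI[OF der[OF Eb[OF s]]]]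
    by (simp add: o_def)
  have dc: "(c has_vector_derivative (- \<i> * of_int n * c t)) (at t)" for t
    unfolding c_def has_vector_derivative_complex_iff by (auto intro!: derivative_eq_intros)
  have contV': "continuous_on (ball 0 1) (\<lambda>z. V' z (w * z))" for w
  proof -
    have "continuous_on (ball 0 1) (\<lambda>z. of_real (Re (w * z)) * V' z 1 + of_real (Im (w * z)) * V' z \<i>)"
      by (intro continuous_intros c1 ci)
    then show ?thesis
      by (rule continuous_on_eq) (rule V'_lin[symmetric])
  qed
  have contV1: "continuous_on ({..<0} \<times> T) (\<lambda>(s, t). V' (E s t) (E s t))" for T
    using continuous_on_log_polar[OF contV'[of 1], of T] by (simp add: E_def)
  have ci1: "continuous_on T (\<lambda>t. V' (E s t) (w * E s t))" for T w
    unfolding E_def by (rule continuous_on_circle[OF contV' s])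
  have cV: "continuous_on T (\<lambda>t. V (E s t))" if "s < 0" for s T
    unfolding E_def by (rule continuous_on_circle[OF continuous_V that])
  define I1 where "I1 = integral {-pi..pi} (\<lambda>t. V' (E s t) (E s t) * c t)"
  define I2 where "I2 = integral {-pi..pi} (\<lambda>t. V' (E s t) (\<i> * E s t) * c t)"
  define I0 where "I0 = integral {-pi..pi} (\<lambda>t. V (E s t) * c t)"
  have "((\<lambda>s. integral (cbox (-pi) pi) (\<lambda>t. V (E s t) * c t)) has_vector_derivative
      integral (cbox (-pi) pi) (\<lambda>t. V' (E s t) (E s t) * c t)) (at s within {..<0})"
  proof (rule leibniz_rule_vector_derivative)
    show "((\<lambda>s. V (E s t) * c t) has_vector_derivative V' (E x t) (E x t) * c t) (at x within {..<0})"
      if "x \<in> {..<0}" for x t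
      using has_vector_derivative_mult_left[OF d1[of x t], of "c t"] that
      by (auto intro: has_vector_derivative_at_within)
    show "(\<lambda>t. V (E x t) * c t) integrable_on cbox (-pi) pi" if "x \<in> {..<0}" for x
      using that by (intro integrable_continuous continuous_intros cV cc) auto
    show "continuous_on ({..<0} \<times> cbox (- pi) pi) (\<lambda>(x, t). V' (E x t) (E x t) * c t)"
      using contV1 unfolding case_prod_beta
      by (intro continuous_intros continuous_on_compose2[OF cc[of UNIV]]) auto
  qed (use s in auto)
  then have D: "((\<lambda>s. integral {-pi..pi} (\<lambda>t. V (E s t) * c t)) has_vector_derivative I1) (at s)"
    using at_within_open[of s "{..<0}"] s by (simp add: I1_def)
  \<comment> \<open>Integration by parts in the angle; the boundary terms cancel by
    periodicity.\<close>
  have h1: "((\<lambda>t. V' (E s t) (\<i> * E s t) * c t + V (E s t) * (- \<i> * of_int n * c t)) has_integral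
     (V (E s pi) * c pi - V (E s (-pi)) * c (-pi))) {-pi..pi}"
    by (rule fundamental_theorem_of_calculus)
      (auto intro!: has_vector_derivative_at_within[OF has_vector_derivative_eq_rhs[OF has_vector_derivative_mult[OF d2 dc]]])
  have h0: "V (E s pi) * c pi - V (E s (-pi)) * c (-pi) = 0"
  proof -
    have "cis pi = cis (-pi)" by (simp add: complex_eq_iff)
    moreover have "c pi = c (-pi)"
      using sin_npi_int[of n] by (simp add: c_def complex_eq_iff mult.commute)
    ultimately show ?thesis by (simp add: E_def)
  qed
  have h2: "((\<lambda>t. V' (E s t) (\<i> * E s t) * c t + (- \<i> * of_int n) * (V (E s t) * c t)) has_integral
     (I2 + (- \<i> * of_int n) * I0)) {-pi..pi}"
  proof -
    have "(\<lambda>t. V' (E s t) (\<i> * E s t) * c t) integrable_on {-pi..pi}" "(\<lambda>t. V (E s t) * c t) integrable_on {-pi..pi}"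
      by (intro integrable_continuous_real continuous_on_mult ci1 cc cV s)+
    then show ?thesis
      unfolding I2_def I0_def
      using has_integral_add[OF integrable_integral has_integral_mult_right[OF integrable_integral]] by blast
  qed
  have eq: "(\<lambda>t. V' (E s t) (\<i> * E s t) * c t + V (E s t) * (- \<i> * of_int n * c t))
      = (\<lambda>t. V' (E s t) (\<i> * E s t) * c t + (- \<i> * of_int n) * (V (E s t) * c t))"
    by (simp add: mult_ac)
  have "I2 + (- \<i> * of_int n) * I0 = 0"
    by (rule has_integral_unique[OF h2 h1[unfolded h0 eq]])
  then have I2: "I2 = \<i> * of_int n * I0"
    by simp
  define I3 where "I3 = integral {-pi..pi} (\<lambda>t. cnj (E s t) * dbar (E s t) * c t)"
  have I1: "I1 = I3 - \<i> * I2"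
  proof -
    have *: "V' z z = cnj z * dbar z - \<i> * V' z (\<i> * z)" if "z \<in> ball 0 1" for z
      unfolding V'_lin[OF that, of z] V'_lin[OF that, of "\<i> * z"] dbar_def
      by (simp add: complex_eq_iff algebra_simps)
    have "I1 = integral {-pi..pi} (\<lambda>t. cnj (E s t) * dbar (E s t) * c t - \<i> * (V' (E s t) (\<i> * E s t) * c t))"
      unfolding I1_def *[OF Eb[OF s]] by (simp only: left_diff_distrib mult.assoc)
    also have "\<dots> = I3 - \<i> * I2"
    proof (rule integral_unique)
      have cd: "continuous_on T (\<lambda>t. dbar (E s t))" for T
        unfolding E_def by (rule continuous_on_circle[OF continuous_dbar s])
      have cE: "continuous_on T (\<lambda>t. E s t)" for T
        unfolding E_def by (intro continuous_intros)
      show "((\<lambda>t. cnj (E s t) * dbar (E s t) * c t - \<i> * (V' (E s t) (\<i> * E s t) * c t)) has_integral I3 - \<i> * I2) {-pi..pi}"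
      proof -
        have "(\<lambda>t. cnj (E s t) * dbar (E s t) * c t) integrable_on {-pi..pi}"
            "(\<lambda>t. V' (E s t) (\<i> * E s t) * c t) integrable_on {-pi..pi}"
          by (intro integrable_continuous_real continuous_on_mult continuous_on_cnj ci1 cc cd cE)+
        then show ?thesis
          unfolding I3_def I2_def
          using has_integral_diff[OF integrable_integral has_integral_mult_right[OF integrable_integral]] by blast
      qed
    qed
    finally show ?thesis .
  qed
  have "I1 / of_real (2 * pi) = of_real (of_int n) * fmode n s + dbar_mode n s"
  proof -
    have "I1 = of_int n * I0 + I3" unfolding I1 I2 by (simp add: mult.assoc)
    then show ?thesis
      unfolding fmode_def dbar_mode_def fourier_coeff_def I0_def I3_def E_def c_def
      by (simp add: add_divide_distrib)
  qed
  moreover have "fmode n = (\<lambda>s. integral {-pi..pi} (\<lambda>t. V (E s t) * c t) / of_real (2 * pi))"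
    by (auto simp: fmode_def fourier_coeff_def E_def c_def)
  ultimately show ?thesis
    using has_vector_derivative_divide[OF D, of "of_real (2 * pi)"] by simp
qed

lemma continuous_fourier_coeff_param:
  assumes "continuous_on (ball 0 1) h"
  shows "continuous_on {..<0} (\<lambda>s. fourier_coeff (\<lambda>t. h (of_real (exp s) * cis t)) n)"
proof -
  have "continuous_on {..<0} (\<lambda>s. integral (cbox (-pi) pi) (\<lambda>t. h (of_real (exp s) * cis t) * cis (- (of_int n * t))))"
    by (rule integral_continuous_on_param)
      (use continuous_on_log_polar[OF assms] in \<open>auto simp: case_prod_beta intro!: continuous_intros\<close>)
  then show ?thesis unfolding fourier_coeff_def by (auto intro!: continuous_intros)
qed

lemma continuous_circle_integral_norm:
  assumes "continuous_on (ball 0 1) (h :: complex \<Rightarrow> complex)"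
  shows "continuous_on {..<0} (\<lambda>s. integral {-pi..pi} (\<lambda>t. (norm (h (of_real (exp s) * cis t)))\<^sup>2))"
proof -
  have "continuous_on {..<0} (\<lambda>s. integral (cbox (-pi) pi) (\<lambda>t. (norm (h (of_real (exp s) * cis t)))\<^sup>2))"
    by (rule integral_continuous_on_param)
      (use continuous_on_log_polar[OF assms] in \<open>auto simp: case_prod_beta intro!: continuous_intros\<close>)
  then show ?thesis by simp
qed

lemma continuous_dbar_mode: "continuous_on {..<0} (dbar_mode n)"
  unfolding dbar_mode_def[abs_def]
  by (rule continuous_fourier_coeff_param[of "\<lambda>z. cnj z * dbar z"]) (intro continuous_intros continuous_dbar)

text \<open>Near 0 the function is close to the constant \<open>V 0\<close>, whose n-th mode
  vanishes. For negative n this is the condition at minus infinity in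
  \<open>mode_neg\<close>.\<close>

lemma fmode_tendsto_0:
  assumes n: "n \<noteq> 0"
  shows "(fmode n \<longlongrightarrow> 0) at_bot"
proof (rule tendstoI)
  fix e :: real assume e: "e > 0"
  have "isCont V 0" using der[of 0] has_derivative_continuous by auto
  then obtain d where d: "d > 0" "\<And>z. dist z 0 < d \<Longrightarrow> dist (V z) (V 0) < e / 2"
    unfolding continuous_at_eps_delta using e by (metis half_gt_zero)
  have "eventually (\<lambda>s. s < min 0 (ln d)) at_bot" unfolding eventually_at_bot_dense by blast
  then show "eventually (\<lambda>s. dist (fmode n s) 0 < e) at_bot"
  proof eventually_elim
    case (elim s)
    then have s: "s < 0" "exp s < d" using d(1) by (auto simp: ln_less_cancel_iff) (metis exp_less_mono exp_ln)
    define E where "E = (\<lambda>t. of_real (exp s) * cis t)"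
    have Ed: "norm (V (E t) - V 0) \<le> e / 2" for t
      using d(2)[of "E t"] s by (simp add: E_def dist_norm norm_mult)
    have cV: "continuous_on T (\<lambda>t. V (E t))" for T
      unfolding E_def by (rule continuous_on_circle[OF continuous_V s(1)])
    have 0: "integral {-pi..pi} (\<lambda>t. V 0 * cis (- (of_int n * t))) = 0"
      using integral_cis[of "-n"] n by simp
    have "integral {-pi..pi} (\<lambda>t. V (E t) * cis (- (of_int n * t)))
      = integral {-pi..pi} (\<lambda>t. V (E t) * cis (- (of_int n * t)) - V 0 * cis (- (of_int n * t)))"
      by (subst integral_diff) (auto intro!: integrable_continuous_real continuous_intros cV simp: 0 simp del: integral_mult_right)
    also have "norm \<dots> \<le> integral {-pi..pi} (\<lambda>t. e / 2)"
    proof (rule integral_norm_bound_integral)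
      show "(\<lambda>t. V (E t) * cis (- (of_int n * t)) - V 0 * cis (- (of_int n * t))) integrable_on {-pi..pi}"
        by (intro integrable_continuous_real continuous_intros cV)
      show "norm (V (E t) * cis (- (of_int n * t)) - V 0 * cis (- (of_int n * t))) \<le> e / 2" for t
        using Ed[of t] by (simp add: norm_mult flip: left_diff_distrib)
    qed auto
    finally have "norm (integral {-pi..pi} (\<lambda>t. V (E t) * cis (- (of_int n * t)))) \<le> e * pi" by (simp add: mult.commute)
    then have "norm (fmode n s) \<le> e / 2"
      by (simp add: fmode_def fourier_coeff_def E_def norm_divide divide_le_eq mult.commute)
    then show ?case using e by simp
  qed
qed

text \<open>The logarithmic radius of the circle |z|^2 = (n + 1) / (n + 2), the node in
  \<open>mode_nonneg\<close>.\<close>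

definition "mode_centre n = ln ((of_int n + 1) / (of_int n + 2)) / 2"

text \<open>The coefficient of z^n for which the n-th mode of the difference vanishes on that
  circle. Negative modes get 0, because a polynomial has none.\<close>

definition "mode_value n = (if n < 0 then 0 else fmode n (mode_centre n) / of_real (exp (of_int n * mode_centre n)))"

text \<open>exp (n s) solves the homogeneous equation, so a multiple of it can be subtracted without
  changing \<open>dbar_mode\<close>. This creates the zero at the node which
  \<open>mode_nonneg\<close> asks for.\<close>

lemma mode_inequality:
  "(\<integral>\<^sup>+s\<in>{..<0}. ennreal (exp (2 * s) * (norm (fmode n s - mode_value n * of_real (exp (of_int n * s))))\<^sup>2) \<partial>lborel)
    \<le> (\<integral>\<^sup>+s\<in>{..<0}. ennreal ((1 - exp (2 * s))\<^sup>2 * (norm (dbar_mode n s))\<^sup>2) \<partial>lborel)"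
proof (cases "n < 0")
  case True
  have "(\<integral>\<^sup>+s\<in>{..<0}. ennreal (exp (2 * s) * (norm (fmode n s))\<^sup>2) \<partial>lborel)
    \<le> (\<integral>\<^sup>+s\<in>{..<0}. ennreal ((1 - exp (2 * s))\<^sup>2 * (norm (dbar_mode n s))\<^sup>2) \<partial>lborel)"
    by (rule mode_neg[of "of_int n"])
      (use True fmode_derivative continuous_dbar_mode fmode_tendsto_0 in auto)
  then show ?thesis using True by (simp add: mode_value_def)
next
  case False
  define x where "x = (real_of_int n + 1) / (of_int n + 2)"
  have "x > 0" using False by (simp add: x_def)
  then have ex: "exp (2 * mode_centre n) = x" by (simp add: mode_centre_def x_def[symmetric])
  show ?thesis
  proof (rule mode_nonneg[of "of_int n"])
    show "((\<lambda>s. fmode n s - mode_value n * of_real (exp (of_int n * s))) has_vector_derivative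
       (of_real (of_int n) * (fmode n s - mode_value n * of_real (exp (of_int n * s))) + dbar_mode n s)) (at s)" if "s < 0" for s
    proof -
      have "((\<lambda>s. complex_of_real (exp (of_int n * s))) has_vector_derivative of_real (of_int n * exp (of_int n * s))) (at s)"
        unfolding has_vector_derivative_complex_iff by (auto intro!: derivative_eq_intros)
      from has_vector_derivative_diff[OF fmode_derivative[OF that, of n] has_vector_derivative_mult_right[OF this, of "mode_value n"]]
      show ?thesis by (simp add: algebra_simps)
    qed
  qed (use False ex in \<open>auto simp: x_def mode_value_def continuous_dbar_mode\<close>)
qed

text \<open>On a circle the polynomial is a trigonometric sum with the coefficients
  \<open>mode_value n\<close> times exp (n s). They vanish for n < 0, so the range can be made
  symmetric to match Parseval's identity.\<close>

lemma circle_expansion: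
  assumes s: "s < 0"
  shows "integral {-pi..pi} (\<lambda>t. (norm (V (of_real (exp s) * cis t) - (\<Sum>n\<le>N. mode_value (int n) * (of_real (exp s) * cis t) ^ n)))\<^sup>2)
    = integral {-pi..pi} (\<lambda>t. (norm (V (of_real (exp s) * cis t)))\<^sup>2) - 2 * pi * (\<Sum>n\<in>{-int N..int N}. (norm (fmode n s))\<^sup>2)
      + 2 * pi * (\<Sum>n\<in>{-int N..int N}. (norm (fmode n s - mode_value n * of_real (exp (of_int n * s))))\<^sup>2)"
proof -
  have "(\<Sum>n\<le>N. mode_value (int n) * (of_real (exp s) * cis t) ^ n)
      = (\<Sum>n\<in>{-int N..int N}. mode_value n * of_real (exp (of_int n * s)) * cis (of_int n * t))" for t
  proof -
    have "(\<Sum>n\<in>{-int N..int N}. mode_value n * of_real (exp (of_int n * s)) * cis (of_int n * t))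
      = (\<Sum>n\<in>{0..int N}. mode_value n * of_real (exp (of_int n * s)) * cis (of_int n * t))"
      by (rule sum.mono_neutral_right) (auto simp: mode_value_def)
    also have "{0..int N} = int ` {..N}"
      using image_int_atLeastAtMost[of 0 N] by (simp add: atMost_atLeast0)
    also have "(\<Sum>n\<in>int ` {..N}. mode_value n * of_real (exp (of_int n * s)) * cis (of_int n * t))
      = (\<Sum>n\<le>N. mode_value (int n) * (of_real (exp s) * cis t) ^ n)"
      by (subst sum.reindex) (auto simp: power_mult_distrib Complex.DeMoivre exp_of_nat_mult mult.assoc)
    finally show ?thesis by simp
  qed
  then show ?thesis
    unfolding fmode_def
    by (simp only: integral_norm_sq_diff_trig[OF continuous_on_circle[OF continuous_V s] finite_atLeastAtMost_int, symmetric])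
qed

lemma borel_measurable_on_negatives:
  fixes f :: "real \<Rightarrow> real"
  assumes "continuous_on {..<0} f"
  shows "(\<lambda>s. ennreal (f s) * indicator {..<0} s) \<in> borel_measurable borel"
proof -
  have "(\<lambda>s. ennreal (if s \<in> {..<0} then f s else 0)) \<in> borel_measurable borel"
    by (intro measurable_compose[OF _ measurable_ennreal] borel_measurable_continuous_on_if assms) auto
  also have "(\<lambda>s. ennreal (if s \<in> {..<0} then f s else 0)) = (\<lambda>s. ennreal (f s) * indicator {..<0} s)"
    by (auto simp: indicator_def)
  finally show ?thesis .
qed

text \<open>On each circle the error splits into the Parseval tail \<open>R N\<close> and the mode
  errors \<open>Q n\<close>. The integrals of the tails tend to 0 by dominated convergence, which
  accounts for \<open>e\<close>; the mode errors are bounded by \<open>mode_inequality\<close> and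
  summed by Bessel's inequality for \<open>dbar\<close>.\<close>

theorem dbar_disc:
  assumes fin: "(\<integral>\<^sup>+z\<in>ball 0 1. ennreal ((norm (V z))\<^sup>2) \<partial>lborel) < \<infinity>" and e: "e > 0"
  obtains a N where "(\<integral>\<^sup>+z\<in>ball 0 1. ennreal ((norm (V z - (\<Sum>n\<le>N. a n * z ^ n)))\<^sup>2) \<partial>lborel)
    \<le> (\<integral>\<^sup>+z\<in>ball 0 1. ennreal ((1 - (norm z)\<^sup>2)\<^sup>2 * (norm (V' z 1 + \<i> * V' z \<i>))\<^sup>2) \<partial>lborel) + ennreal e"
proof -
  define A where "A = (\<lambda>s. integral {-pi..pi} (\<lambda>t. (norm (V (of_real (exp s) * cis t)))\<^sup>2))"
  define R where "R = (\<lambda>N s. A s - 2 * pi * (\<Sum>n\<in>{-int N..int N}. (norm (fmode n s))\<^sup>2))"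
  define Q where "Q = (\<lambda>n s. (norm (fmode n s - mode_value n * of_real (exp (of_int n * s))))\<^sup>2)"
  define B where "B = (\<lambda>s. integral {-pi..pi} (\<lambda>t. (norm (cnj (of_real (exp s) * cis t) * dbar (of_real (exp s) * cis t)))\<^sup>2))"
  have cA: "continuous_on {..<0} A"
    unfolding A_def by (rule continuous_circle_integral_norm[OF continuous_V])
  have cf: "continuous_on {..<0} (fmode n)" for n
    unfolding fmode_def[abs_def] by (rule continuous_fourier_coeff_param[OF continuous_V])
  have cR: "continuous_on {..<0} (R N)" for N
    unfolding R_def by (intro continuous_intros cA cf)
  have cQ: "continuous_on {..<0} (Q n)" for n
    unfolding Q_def by (intro continuous_intros cf)
  have R0: "0 \<le> R N s" "R N s \<le> A s" if "s < 0" for N s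
    using bessel_fourier[OF continuous_on_circle[OF continuous_V that], of "{-int N..int N}"]
    by (auto simp: R_def A_def fmode_def intro!: mult_nonneg_nonneg sum_nonneg)
  have Q0: "0 \<le> Q n s" for n s by (simp add: Q_def)
  have mR: "(\<lambda>s. ennreal (exp (2 * s) * R N s) * indicator {..<0} s) \<in> borel_measurable borel" for N
    by (intro borel_measurable_on_negatives continuous_intros cR)
  have mA: "(\<lambda>s. ennreal (exp (2 * s) * A s) * indicator {..<0} s) \<in> borel_measurable borel"
    by (intro borel_measurable_on_negatives continuous_intros cA)
  have mQ: "(\<lambda>s. ennreal (exp (2 * s) * Q n s) * indicator {..<0} s) \<in> borel_measurable borel" for n
    by (intro borel_measurable_on_negatives continuous_intros cQ)
  have mD: "(\<lambda>s. ennreal ((1 - exp (2 * s))\<^sup>2 * (norm (dbar_mode n s))\<^sup>2) * indicator {..<0} s) \<in> borel_measurable borel" for n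
    by (intro borel_measurable_on_negatives continuous_intros continuous_dbar_mode)
  have sums': "(\<integral>\<^sup>+s. c * (\<Sum>n\<in>K. q n s) \<partial>lborel) = c * (\<Sum>n\<in>K. \<integral>\<^sup>+s. q n s \<partial>lborel)"
    if "\<And>n. q n \<in> borel_measurable borel" for c :: ennreal and q :: "int \<Rightarrow> real \<Rightarrow> ennreal" and K
    using that by (simp add: nn_integral_cmult nn_integral_sum)
  have sums: "(\<integral>\<^sup>+s. f s + c * (\<Sum>n\<in>K. q n s) \<partial>lborel) = (\<integral>\<^sup>+s. f s \<partial>lborel) + c * (\<Sum>n\<in>K. \<integral>\<^sup>+s. q n s \<partial>lborel)"
    if "f \<in> borel_measurable borel" "\<And>n. q n \<in> borel_measurable borel"
    for c :: ennreal and f and q :: "int \<Rightarrow> real \<Rightarrow> ennreal" and K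
    using that by (simp add: nn_integral_add nn_integral_cmult nn_integral_sum)
  let ?E = "\<integral>\<^sup>+z\<in>ball 0 1. ennreal ((1 - (norm z)\<^sup>2)\<^sup>2 * (norm (dbar z))\<^sup>2) \<partial>lborel"
  have finA: "(\<integral>\<^sup>+s\<in>{..<0}. ennreal (exp (2 * s) * A s) \<partial>lborel) < \<infinity>"
    using fin nn_integral_disc_log_polar[of "\<lambda>z. (norm (V z))\<^sup>2"]
    by (simp add: A_def continuous_intros continuous_V)
  have lim: "(\<lambda>N. \<integral>\<^sup>+s\<in>{..<0}. ennreal (exp (2 * s) * R N s) \<partial>lborel) \<longlonglongrightarrow> (\<integral>\<^sup>+s. 0 \<partial>(lborel :: real measure))"
  proof (rule nn_integral_dominated_convergence[where w = "\<lambda>s. ennreal (exp (2 * s) * A s) * indicator {..<0} s"])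
    show "AE s in lborel. ennreal (exp (2 * s) * R N s) * indicator {..<0} s \<le> ennreal (exp (2 * s) * A s) * indicator {..<0} s" for N
      using R0 by (auto intro!: AE_I2 simp: indicator_def ennreal_leI)
    show "AE s in lborel. (\<lambda>N. ennreal (exp (2 * s) * R N s) * indicator {..<0} s) \<longlonglongrightarrow> 0"
    proof (rule AE_I2)
      fix s :: real
      show "(\<lambda>N. ennreal (exp (2 * s) * R N s) * indicator {..<0} s) \<longlonglongrightarrow> 0"
      proof (cases "s < 0")
        case True
        have "continuous_on (sphere 0 1) (\<lambda>z. V (of_real (exp s) * z))"
          by (rule continuous_on_compose2[OF continuous_V])
            (use True in \<open>auto intro!: continuous_intros simp: norm_mult\<close>)
        then have "(\<lambda>N. R N s) \<longlonglongrightarrow> 0"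
          using parseval_limit[of "\<lambda>z. V (of_real (exp s) * z)"] by (simp add: R_def A_def fmode_def)
        then have "(\<lambda>N. ennreal (exp (2 * s) * R N s)) \<longlonglongrightarrow> ennreal (exp (2 * s) * 0)"
          by (intro tendsto_ennrealI tendsto_mult tendsto_const)
        then show ?thesis using True by simp
      qed simp
    qed
  qed (use mR mA finA in auto)
  have "eventually (\<lambda>N. (\<integral>\<^sup>+s\<in>{..<0}. ennreal (exp (2 * s) * R N s) \<partial>lborel) < ennreal e) sequentially"
    by (rule order_tendstoD(2)[OF lim]) (use e in simp)
  then obtain N where N: "(\<integral>\<^sup>+s\<in>{..<0}. ennreal (exp (2 * s) * R N s) \<partial>lborel) < ennreal e"
    by (auto simp: eventually_sequentially)
  let ?G = "\<lambda>z. \<Sum>n\<le>N. mode_value (int n) * z ^ n"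
  have "(\<integral>\<^sup>+z\<in>ball 0 1. ennreal ((norm (V z - ?G z))\<^sup>2) \<partial>lborel)
     = (\<integral>\<^sup>+s\<in>{..<0}. ennreal (exp (2 * s) * (R N s + 2 * pi * (\<Sum>n\<in>{-int N..int N}. Q n s))) \<partial>lborel)"
  proof (subst nn_integral_disc_log_polar)
    show "continuous_on (ball 0 1) (\<lambda>z. (norm (V z - ?G z))\<^sup>2)"
      by (intro continuous_intros continuous_V)
    show "(\<integral>\<^sup>+s\<in>{..<0}. ennreal (exp (2 * s) * integral {- pi..pi} (\<lambda>t. (norm (V (of_real (exp s) * cis t) - ?G (of_real (exp s) * cis t)))\<^sup>2)) \<partial>lborel)
      = (\<integral>\<^sup>+s\<in>{..<0}. ennreal (exp (2 * s) * (R N s + 2 * pi * (\<Sum>n\<in>{-int N..int N}. Q n s))) \<partial>lborel)"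
      by (intro nn_integral_cong) (auto simp: indicator_def circle_expansion R_def A_def Q_def)
  qed simp
  also have "\<dots> = (\<integral>\<^sup>+s. ennreal (exp (2 * s) * R N s) * indicator {..<0} s
      + ennreal (2 * pi) * (\<Sum>n\<in>{-int N..int N}. ennreal (exp (2 * s) * Q n s) * indicator {..<0} s) \<partial>lborel)"
  proof (rule nn_integral_cong)
    fix s :: real
    show "ennreal (exp (2 * s) * (R N s + 2 * pi * (\<Sum>n\<in>{-int N..int N}. Q n s))) * indicator {..<0} s
      = ennreal (exp (2 * s) * R N s) * indicator {..<0} s
      + ennreal (2 * pi) * (\<Sum>n\<in>{-int N..int N}. ennreal (exp (2 * s) * Q n s) * indicator {..<0} s)"
    proof (cases "s < 0")
      case True
      have "exp (2 * s) * (R N s + 2 * pi * (\<Sum>n\<in>{-int N..int N}. Q n s))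
        = exp (2 * s) * R N s + 2 * pi * (\<Sum>n\<in>{-int N..int N}. exp (2 * s) * Q n s)"
        by (simp add: distrib_left sum_distrib_left mult_ac)
      moreover have "ennreal (exp (2 * s) * R N s + 2 * pi * (\<Sum>n\<in>{-int N..int N}. exp (2 * s) * Q n s))
        = ennreal (exp (2 * s) * R N s) + ennreal (2 * pi) * (\<Sum>n\<in>{-int N..int N}. ennreal (exp (2 * s) * Q n s))"
        using R0[OF True] Q0
        by (subst ennreal_plus) (auto simp: ennreal_mult' sum_nonneg simp flip: sum_ennreal)
      ultimately show ?thesis using True by simp
    qed simp
  qed
  also have "\<dots> = (\<integral>\<^sup>+s\<in>{..<0}. ennreal (exp (2 * s) * R N s) \<partial>lborel)
      + ennreal (2 * pi) * (\<Sum>n\<in>{-int N..int N}. \<integral>\<^sup>+s\<in>{..<0}. ennreal (exp (2 * s) * Q n s) \<partial>lborel)"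
    by (rule sums) (use mR mQ in auto)
  also have "\<dots> \<le> ennreal e + ennreal (2 * pi) * (\<Sum>n\<in>{-int N..int N}. \<integral>\<^sup>+s\<in>{..<0}. ennreal ((1 - exp (2 * s))\<^sup>2 * (norm (dbar_mode n s))\<^sup>2) \<partial>lborel)"
    using N mode_inequality unfolding Q_def by (intro add_mono mult_left_mono sum_mono) auto
  also have "ennreal (2 * pi) * (\<Sum>n\<in>{-int N..int N}. \<integral>\<^sup>+s\<in>{..<0}. ennreal ((1 - exp (2 * s))\<^sup>2 * (norm (dbar_mode n s))\<^sup>2) \<partial>lborel)
     = (\<integral>\<^sup>+s. ennreal (2 * pi) * (\<Sum>n\<in>{-int N..int N}. ennreal ((1 - exp (2 * s))\<^sup>2 * (norm (dbar_mode n s))\<^sup>2) * indicator {..<0} s) \<partial>lborel)"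
    by (rule sums'[symmetric]) (use mD in auto)
  also have "\<dots> \<le> (\<integral>\<^sup>+s\<in>{..<0}. ennreal ((1 - exp (2 * s))\<^sup>2 * B s) \<partial>lborel)"
  proof (rule nn_integral_mono)
    fix s :: real
    show "ennreal (2 * pi) * (\<Sum>n\<in>{-int N..int N}. ennreal ((1 - exp (2 * s))\<^sup>2 * (norm (dbar_mode n s))\<^sup>2) * indicator {..<0} s)
      \<le> ennreal ((1 - exp (2 * s))\<^sup>2 * B s) * indicator {..<0} s"
    proof (cases "s < 0")
      case True
      have "2 * pi * (\<Sum>n\<in>{-int N..int N}. (norm (dbar_mode n s))\<^sup>2) \<le> B s"
        unfolding dbar_mode_def B_def
        by (rule bessel_fourier) (auto intro!: continuous_intros continuous_on_circle[OF continuous_dbar True])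
      then have "(1 - exp (2 * s))\<^sup>2 * (2 * pi * (\<Sum>n\<in>{-int N..int N}. (norm (dbar_mode n s))\<^sup>2)) \<le> (1 - exp (2 * s))\<^sup>2 * B s"
        by (rule mult_left_mono) simp
      also have "(1 - exp (2 * s))\<^sup>2 * (2 * pi * (\<Sum>n\<in>{-int N..int N}. (norm (dbar_mode n s))\<^sup>2))
        = 2 * pi * (\<Sum>n\<in>{-int N..int N}. (1 - exp (2 * s))\<^sup>2 * (norm (dbar_mode n s))\<^sup>2)"
        by (simp add: sum_distrib_left mult_ac)
      finally have "ennreal (2 * pi * (\<Sum>n\<in>{-int N..int N}. (1 - exp (2 * s))\<^sup>2 * (norm (dbar_mode n s))\<^sup>2)) \<le> ennreal ((1 - exp (2 * s))\<^sup>2 * B s)"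
        by (rule ennreal_leI)
      then show ?thesis
        using True by (simp add: ennreal_mult' sum_nonneg flip: sum_ennreal)
    qed simp
  qed
  also have "\<dots> = ?E"
  proof (subst nn_integral_disc_log_polar)
    show "continuous_on (ball 0 1) (\<lambda>z. (1 - (norm z)\<^sup>2)\<^sup>2 * (norm (dbar z))\<^sup>2)"
      by (intro continuous_intros continuous_dbar)
    \<comment> \<open>The factor cnj z inside \<open>B\<close> has modulus exp s; its square
      supplies the area factor exp (2 s) of the polar coordinates.\<close>
    have "(1 - exp (2 * s))\<^sup>2 * B s = exp (2 * s) * integral {- pi..pi} (\<lambda>t. (1 - (norm (of_real (exp s) * cis t))\<^sup>2)\<^sup>2 * (norm (dbar (of_real (exp s) * cis t)))\<^sup>2)" for s
      by (simp add: B_def norm_mult power_mult_distrib exp_double)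
    then show "(\<integral>\<^sup>+s\<in>{..<0}. ennreal ((1 - exp (2 * s))\<^sup>2 * B s) \<partial>lborel)
      = (\<integral>\<^sup>+s\<in>{..<0}. ennreal (exp (2 * s) * integral {- pi..pi} (\<lambda>t. (1 - (norm (of_real (exp s) * cis t))\<^sup>2)\<^sup>2 * (norm (dbar (of_real (exp s) * cis t)))\<^sup>2)) \<partial>lborel)"
      by simp
  qed simp
  finally show ?thesis
    by (intro that[where a = "\<lambda>n. mode_value (int n)" and N = N]) (simp add: dbar_def add.commute add_left_mono)
qed

end

section \<open>The inequality for smooth functions\<close>

text \<open>For y = x / 2 in [0, 1] one has cos y \<ge> 1 - y^2 / 2 \<ge> 1 - y / 2, and y / 2 = x /
  4 \<le> x / pi because pi < 4.\<close>

lemma cos_half_ge_linear: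
  assumes "0 \<le> x" "x \<le> pi / 2"
  shows "1 - x / pi \<le> cos (x / 2)"
proof -
  define y where "y = x / 2"
  have y: "0 \<le> y" "y \<le> 1" using assms pi_less_4 by (auto simp: y_def)
  have s: "0 \<le> sin (y / 2)" "sin (y / 2) \<le> y / 2"
    using sin_ge_zero[of "y / 2"] sin_x_le_x[of "y / 2"] y pi_gt3 by linarith+
  have "cos y = 1 - 2 * (sin (y / 2))\<^sup>2" using cos_double_sin[of "y / 2"] by simp
  moreover have "(sin (y / 2))\<^sup>2 \<le> (y / 2)\<^sup>2" using s by (intro power_mono)
  ultimately have "cos y \<ge> 1 - y * y / 2" by (simp add: power2_eq_square field_simps)
  moreover have "y * y / 2 \<le> y * 1 / 2" using y by (intro divide_right_mono mult_left_mono) auto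
  moreover have "y / 2 \<le> x / pi"
  proof -
    have "x * pi \<le> x * 4" using assms pi_less_4 by (intro mult_left_mono) auto
    then show ?thesis by (simp add: y_def field_simps)
  qed
  ultimately show ?thesis by (simp add: y_def)
qed

text \<open>Since \<Gamma> / (1 + \<Gamma>) = (1 + cos \<epsilon>) / 2 = cos^2 (\<epsilon> / 2), the
  claim is the square of \<open>cos_half_ge_linear\<close>.\<close>

lemma cone_constant:
  assumes \<eta>: "\<eta> \<ge> 1" and \<epsilon>: "\<epsilon> = arcsin (1 / \<eta>)"
  defines "\<Gamma> \<equiv> (\<eta> + sqrt (\<eta>\<^sup>2 - 1))\<^sup>2"
  shows "(1 + \<Gamma>) * (1 - \<epsilon> / pi)\<^sup>2 \<le> \<Gamma>"
proof -
  have e: "0 < \<epsilon>" "\<epsilon> \<le> pi / 2" "sin \<epsilon> = 1 / \<eta>"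
  proof -
    have "-1 \<le> 1 / \<eta>" "1 / \<eta> \<le> 1" using \<eta> by (auto simp: divide_le_eq le_divide_eq)
    then show "sin \<epsilon> = 1 / \<eta>" "\<epsilon> \<le> pi / 2" using arcsin_bounded by (auto simp: \<epsilon>)
    have "arcsin 0 < arcsin (1 / \<eta>)" using \<eta> by (intro arcsin_less_arcsin) auto
    then show "0 < \<epsilon>" by (simp add: \<epsilon>)
  qed
  have c: "cos \<epsilon> \<ge> 0" using e by (intro cos_ge_zero) auto
  have s: "sin \<epsilon> > 0" using e \<eta> by simp
  have \<eta>s: "\<eta> = 1 / sin \<epsilon>" using e \<eta> by simp
  have "\<eta>\<^sup>2 - 1 = (cos \<epsilon> / sin \<epsilon>)\<^sup>2"
    using s by (simp add: \<eta>s power_divide cos_squared_eq diff_divide_distrib)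
  then have sq: "sqrt (\<eta>\<^sup>2 - 1) = cos \<epsilon> / sin \<epsilon>" using c s by (simp add: real_sqrt_divide)
  have \<Gamma>: "\<Gamma> = (1 + cos \<epsilon>)\<^sup>2 / (sin \<epsilon>)\<^sup>2"
  proof -
    have "\<eta> + sqrt (\<eta>\<^sup>2 - 1) = (1 + cos \<epsilon>) / sin \<epsilon>"
      unfolding sq by (simp only: \<eta>s add_divide_distrib)
    then show ?thesis by (simp only: \<Gamma>_def power_divide)
  qed
  have \<Gamma>1: "1 + \<Gamma> = 2 * (1 + cos \<epsilon>) / (sin \<epsilon>)\<^sup>2"
  proof -
    have "1 + \<Gamma> = ((sin \<epsilon>)\<^sup>2 + (1 + cos \<epsilon>)\<^sup>2) / (sin \<epsilon>)\<^sup>2"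
      using s by (simp add: \<Gamma> add_divide_distrib)
    also have "(sin \<epsilon>)\<^sup>2 + (1 + cos \<epsilon>)\<^sup>2 = 2 * (1 + cos \<epsilon>)"
      by (simp add: sin_squared_eq power2_eq_square algebra_simps)
    finally show ?thesis .
  qed
  have "1 - \<epsilon> / pi \<ge> 0" using e pi_gt_zero by (simp add: field_simps)
  then have "(1 - \<epsilon> / pi)\<^sup>2 \<le> (cos (\<epsilon> / 2))\<^sup>2"
    using cos_half_ge_linear[of \<epsilon>] e by (intro power_mono) auto
  also have "(cos (\<epsilon> / 2))\<^sup>2 = (1 + cos \<epsilon>) / 2" using cos_double_cos[of "\<epsilon> / 2"] by simp
  finally have "(1 + \<Gamma>) * (1 - \<epsilon> / pi)\<^sup>2 \<le> (1 + \<Gamma>) * ((1 + cos \<epsilon>) / 2)"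
    by (rule mult_left_mono) (simp add: \<Gamma>_def)
  also have "\<dots> = (1 + cos \<epsilon>)\<^sup>2 / (sin \<epsilon>)\<^sup>2" unfolding \<Gamma>1
    by (simp only: power2_eq_square times_divide_times_eq mult_ac)
  also have "\<dots> = \<Gamma>" by (rule \<Gamma>[symmetric])
  finally show ?thesis .
qed

context star_domain
begin

lemma riemann_map:
  obtains f where "f holomorphic_on ball 0 1" "inj_on f (ball 0 1)" "f ` ball 0 1 = \<Omega>"
proof -
  have "0 \<in> \<Omega>" using r_sub r_pos by auto
  then have "starlike \<Omega>"
    unfolding starlike_def using star[of _ 0] r_pos by (intro bexI[of _ 0]) (auto simp: closed_segment_commute)
  then have "simply_connected \<Omega>" by (rule starlike_imp_simply_connected)
  moreover have "\<Omega> \<noteq> UNIV"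
    using sub_R bounded_ball[of "0::complex" R] not_bounded_UNIV bounded_subset by blast
  ultimately obtain g f where gf: "f holomorphic_on ball 0 1" "\<And>z. z \<in> \<Omega> \<Longrightarrow> g z \<in> ball 0 1 \<and> f (g z) = z"
    "\<And>z. z \<in> ball 0 1 \<Longrightarrow> f z \<in> \<Omega> \<and> g (f z) = z"
    using Riemann_mapping_theorem[of \<Omega>] open_\<Omega> \<open>0 \<in> \<Omega>\<close> by blast
  show ?thesis
  proof (rule that[OF gf(1)])
    show "inj_on f (ball 0 1)" using gf(3) by (metis inj_onI)
    show "f ` ball 0 1 = \<Omega>" 
    proof
      show "f ` ball 0 1 \<subseteq> \<Omega>" using gf(3) by blast
      show "\<Omega> \<subseteq> f ` ball 0 1"
      proof
        fix z assume "z \<in> \<Omega>"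
        with gf(2)[of z] show "z \<in> f ` ball 0 1" by (intro image_eqI[of _ _ "g z"]) auto
      qed
    qed
  qed
qed

text \<open>Pulling back by the Riemann map turns approximation by holomorphic functions in
  \<open>L\<^sub>2(\<Omega>)\<close> into the same problem on the disc, for \<open>(u \<circ> f) f'\<close> instead of \<open>u\<close>.\<close>

lemma holomorphic_approximation:
  fixes u :: "complex \<Rightarrow> real" and G :: "complex \<Rightarrow> complex"
  assumes du: "\<And>z. z \<in> \<Omega> \<Longrightarrow> (u has_derivative (\<lambda>h. h \<bullet> G z)) (at z)"
    and cG: "continuous_on \<Omega> G" and bd: "\<And>z. z \<in> \<Omega> \<Longrightarrow> \<bar>u z\<bar> \<le> B" and e: "e > 0"
    and \<epsilon>: "0 < \<epsilon>" "\<epsilon> \<le> pi / 2" "R * sin \<epsilon> = r"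
  obtains F where "F holomorphic_on \<Omega>"
    "(\<integral>\<^sup>+z\<in>\<Omega>. ennreal ((norm (of_real (u z) - F z))\<^sup>2) \<partial>lborel)
      \<le> ennreal (16 * (1 - \<epsilon> / pi)\<^sup>2) * (\<integral>\<^sup>+z\<in>\<Omega>. ennreal ((infdist z (frontier \<Omega>))\<^sup>2 * (norm (G z))\<^sup>2) \<partial>lborel) + ennreal e"
proof -
  let ?D = "ball (0::complex) 1"
  obtain f where f: "f holomorphic_on ?D" "inj_on f ?D" "f ` ?D = \<Omega>" by (rule riemann_map)
  define k where "k = 16 * (1 - \<epsilon> / pi)\<^sup>2"
  have cu: "continuous_on \<Omega> u"
    using du by (meson continuous_at_imp_continuous_on has_derivative_continuous)
  have fin: "f z \<in> \<Omega>" if "z \<in> ?D" for z using f(3) that by blast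
  have cf: "continuous_on ?D f" and hf': "deriv f holomorphic_on ?D"
    using f holomorphic_on_imp_continuous_on holomorphic_deriv by auto
  have cf': "continuous_on ?D (deriv f)" and hf'': "deriv (deriv f) holomorphic_on ?D"
    using hf' holomorphic_on_imp_continuous_on holomorphic_deriv by auto
  have cf'': "continuous_on ?D (deriv (deriv f))" using hf'' holomorphic_on_imp_continuous_on by blast
  have cuf: "continuous_on ?D (\<lambda>z. u (f z))" and cGf: "continuous_on ?D (\<lambda>z. G (f z))"
    using continuous_on_compose2[OF cu cf] continuous_on_compose2[OF cG cf] f(3) by auto
  have f'0: "deriv f z \<noteq> 0" if "z \<in> ?D" for z
    using holomorphic_injective_imp_regular[OF f(1) open_ball f(2) that] .
  define V where "V = (\<lambda>z. of_real (u (f z)) * deriv f z)"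
  define V' where "V' = (\<lambda>z h. of_real (u (f z)) * (deriv (deriv f) z * h) + of_real ((deriv f z * h) \<bullet> G (f z)) * deriv f z)"
  have dV: "(V has_derivative V' z) (at z)" if z: "z \<in> ?D" for z
  proof -
    have 1: "(f has_derivative (\<lambda>h. deriv f z * h)) (at z)"
      using f z by (metis has_field_derivative_def holomorphic_derivI open_ball)
    have 2: "(deriv f has_derivative (\<lambda>h. deriv (deriv f) z * h)) (at z)"
      using hf' z by (metis has_field_derivative_def holomorphic_derivI open_ball)
    have 3: "((\<lambda>z. complex_of_real (u (f z))) has_derivative (\<lambda>h. of_real ((deriv f z * h) \<bullet> G (f z)))) (at z)"
      by (rule has_derivative_of_real[OF has_derivative_compose[OF 1 du[OF fin[OF z]]]])
    show ?thesis unfolding V_def V'_def by (rule has_derivative_mult[OF 3 2])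
  qed
  have cV': "continuous_on ?D (\<lambda>z. V' z h)" for h
    unfolding V'_def by (intro continuous_intros cuf cf'' cf' cGf)
  \<comment> \<open>The holomorphic factor f' drops out, so only the derivative of u \<circ> f
    contributes: one f' stems from the chain rule, the other is the factor itself.\<close>
  have dbarV: "norm (V' z 1 + \<i> * V' z \<i>) = (norm (deriv f z))\<^sup>2 * norm (G (f z))" for z
  proof -
    have "V' z 1 + \<i> * V' z \<i> = deriv f z * cnj (deriv f z * cnj (G (f z)))"
      by (simp add: V'_def inner_complex_def complex_eq_iff algebra_simps)
    then show ?thesis by (simp add: norm_mult power2_eq_square)
  qed
  define uO where "uO = (\<lambda>z. if z \<in> \<Omega> then (u z)\<^sup>2 else 0)"
  have [measurable]: "uO \<in> borel_measurable borel"
    unfolding uO_def by (rule borel_measurable_continuous_on_if) (use cu open_\<Omega> in \<open>auto intro!: continuous_intros\<close>)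
  have \<Omega>m [measurable]: "\<Omega> \<in> sets borel" using open_\<Omega> by simp
  \<comment> \<open>\<open>V\<close> has the L2 norm of \<open>u\<close>, finite because
    \<open>u\<close> is bounded on a bounded domain.\<close>
  have finV: "(\<integral>\<^sup>+z\<in>?D. ennreal ((norm (V z))\<^sup>2) \<partial>lborel) < \<infinity>"
  proof -
    have "(\<integral>\<^sup>+z\<in>?D. ennreal ((norm (V z))\<^sup>2) \<partial>lborel) = (\<integral>\<^sup>+z\<in>?D. ennreal (uO (f z)) * ennreal ((norm (deriv f z))\<^sup>2) \<partial>lborel)"
      by (intro nn_integral_cong) (auto simp: indicator_def V_def uO_def fin norm_mult power_mult_distrib ennreal_mult)
    also have "\<dots> = (\<integral>\<^sup>+w\<in>f ` ?D. ennreal (uO w) \<partial>lborel)"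
      by (rule nn_integral_conformal_image[symmetric]) (use f in auto)
    also have "\<dots> \<le> (\<integral>\<^sup>+w\<in>\<Omega>. ennreal (B\<^sup>2) \<partial>lborel)"
      unfolding f(3) using bd by (intro nn_integral_mono) (auto simp: indicator_def uO_def intro!: ennreal_leI abs_le_square_iff[THEN iffD1] order_trans[OF _ abs_ge_self])
    also have "\<dots> = ennreal (B\<^sup>2) * emeasure lborel \<Omega>"
      by (rule nn_integral_cmult_indicator) simp
    also have "\<dots> < \<infinity>"
      using emeasure_bounded_finite[of \<Omega>] bounded_subset[OF bounded_ball sub_R] by (simp add: ennreal_mult_less_top)
    finally show ?thesis .
  qed
  obtain a N where "(\<integral>\<^sup>+z\<in>?D. ennreal ((norm (V z - (\<Sum>n\<le>N. a n * z ^ n)))\<^sup>2) \<partial>lborel)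
    \<le> (\<integral>\<^sup>+z\<in>?D. ennreal ((1 - (norm z)\<^sup>2)\<^sup>2 * (norm (V' z 1 + \<i> * V' z \<i>))\<^sup>2) \<partial>lborel) + ennreal e"
    using dbar_disc[OF dV cV' cV' finV e] by blast
  then obtain P where P: "P holomorphic_on ?D" and VP: "(\<integral>\<^sup>+z\<in>?D. ennreal ((norm (V z - P z))\<^sup>2) \<partial>lborel)
    \<le> (\<integral>\<^sup>+z\<in>?D. ennreal ((1 - (norm z)\<^sup>2)\<^sup>2 * (norm (V' z 1 + \<i> * V' z \<i>))\<^sup>2) \<partial>lborel) + ennreal e"
    by (rule that[of "\<lambda>z. \<Sum>n\<le>N. a n * z ^ n", rotated]) (intro holomorphic_intros)
  obtain g where g: "g holomorphic_on f ` ?D" "\<And>z. z \<in> ?D \<Longrightarrow> g (f z) = z"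
    using holomorphic_has_inverse[OF f(1) open_ball f(2)] by metis
  have gD: "g w \<in> ?D" if "w \<in> \<Omega>" for w using that f(3) g(2) by force
  \<comment> \<open>Division by f' undoes the factor in \<open>V\<close>, so that u - F on \<Omega>
    has the same norm as V - P on the disc.\<close>
  define F where "F = (\<lambda>w. P (g w) / deriv f (g w))"
  have Fh: "F holomorphic_on \<Omega>"
  proof -
    have "(\<lambda>z. P z / deriv f z) holomorphic_on ?D"
      by (intro holomorphic_intros P hf' f'0)
    then have "(\<lambda>z. P z / deriv f z) \<circ> g holomorphic_on \<Omega>"
      using g(1) gD unfolding f(3) by (intro holomorphic_on_compose_gen[of g \<Omega> _ ?D]) auto
    then show ?thesis by (simp add: F_def o_def)
  qed
  define X where "X = (\<lambda>w. if w \<in> \<Omega> then (norm (of_real (u w) - F w))\<^sup>2 else 0)"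
  have [measurable]: "X \<in> borel_measurable borel"
    unfolding X_def by (rule borel_measurable_continuous_on_if)
      (use cu open_\<Omega> holomorphic_on_imp_continuous_on[OF Fh] in \<open>auto intro!: continuous_intros\<close>)
  define Y where "Y = (\<lambda>w. if w \<in> \<Omega> then (infdist w (frontier \<Omega>))\<^sup>2 * (norm (G w))\<^sup>2 else 0)"
  have [measurable]: "Y \<in> borel_measurable borel"
    unfolding Y_def by (rule borel_measurable_continuous_on_if)
      (use cG open_\<Omega> in \<open>auto intro!: continuous_intros\<close>)
  have "(\<integral>\<^sup>+z\<in>\<Omega>. ennreal ((norm (of_real (u z) - F z))\<^sup>2) \<partial>lborel) = (\<integral>\<^sup>+w\<in>f ` ?D. ennreal (X w) \<partial>lborel)"
    unfolding f(3) by (intro nn_integral_cong) (auto simp: X_def indicator_def)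
  also have "\<dots> = (\<integral>\<^sup>+z\<in>?D. ennreal (X (f z)) * ennreal ((norm (deriv f z))\<^sup>2) \<partial>lborel)"
    by (rule nn_integral_conformal_image) (use f in auto)
  also have "\<dots> = (\<integral>\<^sup>+z\<in>?D. ennreal ((norm (V z - P z))\<^sup>2) \<partial>lborel)"
  proof (intro nn_integral_cong)
    fix z
    show "ennreal (X (f z)) * ennreal ((norm (deriv f z))\<^sup>2) * indicator ?D z = ennreal ((norm (V z - P z))\<^sup>2) * indicator ?D z"
    proof (cases "z \<in> ?D")
      case True
      have "V z - P z = (of_real (u (f z)) - F (f z)) * deriv f z"
        using f'0[OF True] g(2)[OF True] by (simp add: V_def F_def left_diff_distrib)
      then have "(norm (V z - P z))\<^sup>2 = X (f z) * (norm (deriv f z))\<^sup>2"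
        using fin[OF True] by (simp add: X_def norm_mult power_mult_distrib)
      then show ?thesis by (simp add: ennreal_mult X_def)
    qed simp
  qed
  finally have lhs: "(\<integral>\<^sup>+z\<in>\<Omega>. ennreal ((norm (of_real (u z) - F z))\<^sup>2) \<partial>lborel)
      = (\<integral>\<^sup>+z\<in>?D. ennreal ((norm (V z - P z))\<^sup>2) \<partial>lborel)" .
  have "(\<integral>\<^sup>+z\<in>?D. ennreal ((1 - (norm z)\<^sup>2)\<^sup>2 * (norm (V' z 1 + \<i> * V' z \<i>))\<^sup>2) \<partial>lborel)
     \<le> (\<integral>\<^sup>+z\<in>?D. ennreal (k * Y (f z)) * ennreal ((norm (deriv f z))\<^sup>2) \<partial>lborel)"
  proof (rule nn_integral_mono)
    fix z
    show "ennreal ((1 - (norm z)\<^sup>2)\<^sup>2 * (norm (V' z 1 + \<i> * V' z \<i>))\<^sup>2) * indicator ?D z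
      \<le> ennreal (k * Y (f z)) * ennreal ((norm (deriv f z))\<^sup>2) * indicator ?D z"
    proof (cases "z \<in> ?D")
      case True
      \<comment> \<open>One factor f' is spent together with the weight on the Koebe estimate; the
        other squares to the Jacobian of the change of variables.\<close>
      have "(1 - (norm z)\<^sup>2) * norm (deriv f z) \<le> 4 * (1 - \<epsilon> / pi) * infdist (f z) (frontier \<Omega>)"
        by (rule Koebe_star_shaped[OF open_\<Omega> sub_R star _ \<epsilon> f(1) _ True]) (use r_sub r_pos f(3) in auto)
      moreover have "(norm z)\<^sup>2 \<le> 1" using True by (simp add: power_le_one)
      ultimately have "((1 - (norm z)\<^sup>2) * norm (deriv f z))\<^sup>2 \<le> (4 * (1 - \<epsilon> / pi) * infdist (f z) (frontier \<Omega>))\<^sup>2"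
        by (intro power_mono) auto
      then have *: "((1 - (norm z)\<^sup>2) * norm (deriv f z))\<^sup>2 * ((norm (G (f z)))\<^sup>2 * (norm (deriv f z))\<^sup>2)
          \<le> (4 * (1 - \<epsilon> / pi) * infdist (f z) (frontier \<Omega>))\<^sup>2 * ((norm (G (f z)))\<^sup>2 * (norm (deriv f z))\<^sup>2)"
        by (rule mult_right_mono) simp
      have "(1 - (norm z)\<^sup>2)\<^sup>2 * (norm (V' z 1 + \<i> * V' z \<i>))\<^sup>2 \<le> k * Y (f z) * (norm (deriv f z))\<^sup>2"
      proof -
        have "(4 * (1 - \<epsilon> / pi) * infdist (f z) (frontier \<Omega>))\<^sup>2 = k * (infdist (f z) (frontier \<Omega>))\<^sup>2"
          unfolding power_mult_distrib k_def by simp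
        moreover have "(norm (V' z 1 + \<i> * V' z \<i>))\<^sup>2 = (norm (G (f z)))\<^sup>2 * (norm (deriv f z))\<^sup>2 * (norm (deriv f z))\<^sup>2"
          by (simp add: dbarV norm_mult power_mult_distrib)
        ultimately show ?thesis
          using * fin[OF True] by (simp only: Y_def power_mult_distrib if_True mult_ac)
      qed
      moreover have "ennreal (k * Y (f z) * (norm (deriv f z))\<^sup>2) = ennreal (k * Y (f z)) * ennreal ((norm (deriv f z))\<^sup>2)"
        by (rule ennreal_mult'') simp
      ultimately show ?thesis using True by (simp only: indicator_simps mult_1_right) (metis ennreal_leI)
    qed simp
  qed
  also have "\<dots> = (\<integral>\<^sup>+w\<in>f ` ?D. ennreal (k * Y w) \<partial>lborel)"
    by (rule nn_integral_conformal_image[symmetric]) (use f in auto)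
  also have "\<dots> = (\<integral>\<^sup>+w. ennreal k * ennreal (Y w) \<partial>lborel)"
    unfolding f(3) by (intro nn_integral_cong) (auto simp: Y_def indicator_def k_def ennreal_mult)
  also have "\<dots> = ennreal k * (\<integral>\<^sup>+w. ennreal (Y w) \<partial>lborel)"
    by (rule nn_integral_cmult) simp
  also have "(\<integral>\<^sup>+w. ennreal (Y w) \<partial>lborel) = (\<integral>\<^sup>+z\<in>\<Omega>. ennreal ((infdist z (frontier \<Omega>))\<^sup>2 * (norm (G z))\<^sup>2) \<partial>lborel)"
    by (intro nn_integral_cong) (auto simp: Y_def indicator_def)
  finally have rhs: "(\<integral>\<^sup>+z\<in>?D. ennreal ((1 - (norm z)\<^sup>2)\<^sup>2 * (norm (V' z 1 + \<i> * V' z \<i>))\<^sup>2) \<partial>lborel)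
      \<le> ennreal k * (\<integral>\<^sup>+z\<in>\<Omega>. ennreal ((infdist z (frontier \<Omega>))\<^sup>2 * (norm (G z))\<^sup>2) \<partial>lborel)" .
  have "(\<integral>\<^sup>+z\<in>\<Omega>. ennreal ((norm (of_real (u z) - F z))\<^sup>2) \<partial>lborel)
      \<le> ennreal k * (\<integral>\<^sup>+z\<in>\<Omega>. ennreal ((infdist z (frontier \<Omega>))\<^sup>2 * (norm (G z))\<^sup>2) \<partial>lborel) + ennreal e"
    unfolding lhs by (rule order_trans[OF VP add_right_mono[OF rhs]])
  then show ?thesis unfolding k_def by (rule that[OF Fh])
qed

text \<open>The sum u - c = (u - Re F) + (Re F - c) is squared with weights 1 + \<Gamma> and 1 +
  1/\<Gamma>. After the Friedrichs inequality both terms carry the factor 1 + \<Gamma> and recombine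
  to |u - F|^2.\<close>

theorem improved_poincare_smooth:
  fixes u :: "complex \<Rightarrow> real" and G :: "complex \<Rightarrow> complex"
  assumes du: "\<And>z. z \<in> \<Omega> \<Longrightarrow> (u has_derivative (\<lambda>h. h \<bullet> G z)) (at z)"
    and cG: "continuous_on \<Omega> G" and bd: "\<And>z. z \<in> \<Omega> \<Longrightarrow> \<bar>u z\<bar> \<le> B" and e: "e > 0"
  shows "\<exists>c. (\<integral>\<^sup>+z\<in>\<Omega>. ennreal ((u z - c)\<^sup>2) \<partial>lborel)
      \<le> ennreal (16 * friedrichs_const) * (\<integral>\<^sup>+z\<in>\<Omega>. ennreal ((infdist z (frontier \<Omega>))\<^sup>2 * (norm (G z))\<^sup>2) \<partial>lborel) + ennreal e"
proof -
  let ?E = "\<integral>\<^sup>+z\<in>\<Omega>. ennreal ((infdist z (frontier \<Omega>))\<^sup>2 * (norm (G z))\<^sup>2) \<partial>lborel"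
  define \<Gamma> where "\<Gamma> = friedrichs_const"
  define \<eta> where "\<eta> = R / r"
  define \<epsilon> where "\<epsilon> = arcsin (1 / \<eta>)"
  have \<eta>: "\<eta> \<ge> 1" using radius_bounds[of 0] r_pos by (simp add: \<eta>_def)
  have \<Gamma>: "(1 + \<Gamma>) * (1 - \<epsilon> / pi)\<^sup>2 \<le> \<Gamma>"
    using cone_constant[OF \<eta> \<epsilon>_def] by (simp add: \<Gamma>_def friedrichs_const_def \<eta>_def)
  have \<Gamma>1: "\<Gamma> \<ge> 1"
    unfolding \<Gamma>_def friedrichs_const_def \<eta>_def[symmetric]
    using \<eta> by (intro one_le_power add_increasing2) auto
  have \<epsilon>: "0 < \<epsilon>" "\<epsilon> \<le> pi / 2" "R * sin \<epsilon> = r"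
  proof -
    have "-1 \<le> 1 / \<eta>" "1 / \<eta> \<le> 1" using \<eta> by (auto simp: divide_le_eq le_divide_eq)
    then have "sin \<epsilon> = 1 / \<eta>" "\<epsilon> \<le> pi / 2" using arcsin_bounded by (auto simp: \<epsilon>_def)
    then show "\<epsilon> \<le> pi / 2" "R * sin \<epsilon> = r" using R_pos by (auto simp: \<eta>_def)
    have "arcsin 0 < arcsin (1 / \<eta>)" using \<eta> by (intro arcsin_less_arcsin) auto
    then show "0 < \<epsilon>" by (simp add: \<epsilon>_def)
  qed
  \<comment> \<open>Divided in advance by the factor 1 + \<Gamma> that will multiply the
    approximation error.\<close>
  define e' where "e' = e / (1 + \<Gamma>)"
  have e': "e' > 0" "(1 + \<Gamma>) * e' = e" using e \<Gamma>1 by (auto simp: e'_def)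
  obtain F where F: "F holomorphic_on \<Omega>"
    "(\<integral>\<^sup>+z\<in>\<Omega>. ennreal ((norm (of_real (u z) - F z))\<^sup>2) \<partial>lborel) \<le> ennreal (16 * (1 - \<epsilon> / pi)\<^sup>2) * ?E + ennreal e'"
    using holomorphic_approximation[OF du cG bd e'(1) \<epsilon>] by blast
  define c where "c = Re (F 0)"
  have cu: "continuous_on \<Omega> u"
    using du by (meson continuous_at_imp_continuous_on has_derivative_continuous)
  have cF: "continuous_on \<Omega> F" using F(1) holomorphic_on_imp_continuous_on by blast
  have meas: "(\<lambda>z. ennreal (X z) * indicator \<Omega> z) \<in> borel_measurable lborel" if "continuous_on \<Omega> X" for X :: "complex \<Rightarrow> real"
  proof -
    have "(\<lambda>z. ennreal (if z \<in> \<Omega> then X z else 0)) \<in> borel_measurable borel"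
      by (intro measurable_compose[OF _ measurable_ennreal] borel_measurable_continuous_on_if) (use that open_\<Omega> in auto)
    also have "(\<lambda>z. ennreal (if z \<in> \<Omega> then X z else 0)) = (\<lambda>z. ennreal (X z) * indicator \<Omega> z)"
      by (auto simp: indicator_def)
    finally show ?thesis by simp
  qed
  have m1: "(\<lambda>z. ennreal ((u z - Re (F z))\<^sup>2) * indicator \<Omega> z) \<in> borel_measurable lborel"
    and m2: "(\<lambda>z. ennreal ((Re (F z) - c)\<^sup>2) * indicator \<Omega> z) \<in> borel_measurable lborel"
    and m3: "(\<lambda>z. ennreal ((Im (F z))\<^sup>2) * indicator \<Omega> z) \<in> borel_measurable lborel"
    by (intro meas continuous_intros cu cF)+
  let ?A = "\<integral>\<^sup>+z\<in>\<Omega>. ennreal ((u z - Re (F z))\<^sup>2) \<partial>lborel"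
  let ?I = "\<integral>\<^sup>+z\<in>\<Omega>. ennreal ((Im (F z))\<^sup>2) \<partial>lborel"
  have fr: "(\<integral>\<^sup>+z\<in>\<Omega>. ennreal ((Re (F z) - c)\<^sup>2) \<partial>lborel) \<le> ennreal \<Gamma> * ?I"
    using friedrichs_inequality[of "\<lambda>z. F z - of_real c"] F(1) by (simp add: c_def \<Gamma>_def holomorphic_intros)
  have "(\<integral>\<^sup>+z\<in>\<Omega>. ennreal ((u z - c)\<^sup>2) \<partial>lborel)
    \<le> (\<integral>\<^sup>+z. ennreal (1 + \<Gamma>) * (ennreal ((u z - Re (F z))\<^sup>2) * indicator \<Omega> z)
         + ennreal (1 + 1 / \<Gamma>) * (ennreal ((Re (F z) - c)\<^sup>2) * indicator \<Omega> z) \<partial>lborel)"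
  proof (rule nn_integral_mono)
    fix z
    define x where "x = u z - Re (F z)"
    define y where "y = Re (F z) - c"
    have "0 \<le> (\<Gamma> * x - y)\<^sup>2 / \<Gamma>" using \<Gamma>1 by simp
    also have "\<dots> = \<Gamma> * x\<^sup>2 - 2 * x * y + y\<^sup>2 / \<Gamma>" using \<Gamma>1 by (simp add: power2_eq_square field_simps)
    finally have "(x + y)\<^sup>2 \<le> (1 + \<Gamma>) * x\<^sup>2 + (1 + 1 / \<Gamma>) * y\<^sup>2"
      by (simp add: power2_eq_square algebra_simps)
    then have "(u z - c)\<^sup>2 \<le> (1 + \<Gamma>) * (u z - Re (F z))\<^sup>2 + (1 + 1 / \<Gamma>) * (Re (F z) - c)\<^sup>2"
      by (simp add: x_def y_def)
    then have "ennreal ((u z - c)\<^sup>2) \<le> ennreal (1 + \<Gamma>) * ennreal ((u z - Re (F z))\<^sup>2) + ennreal (1 + 1 / \<Gamma>) * ennreal ((Re (F z) - c)\<^sup>2)"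
      using \<Gamma>1 by (simp add: ennreal_leI flip: ennreal_mult'' ennreal_plus)
    then show "ennreal ((u z - c)\<^sup>2) * indicator \<Omega> z \<le> ennreal (1 + \<Gamma>) * (ennreal ((u z - Re (F z))\<^sup>2) * indicator \<Omega> z)
         + ennreal (1 + 1 / \<Gamma>) * (ennreal ((Re (F z) - c)\<^sup>2) * indicator \<Omega> z)"
      by (simp add: indicator_def)
  qed
  also have "\<dots> = ennreal (1 + \<Gamma>) * ?A + ennreal (1 + 1 / \<Gamma>) * (\<integral>\<^sup>+z\<in>\<Omega>. ennreal ((Re (F z) - c)\<^sup>2) \<partial>lborel)"
    using m1 m2 by (subst nn_integral_add) (auto simp: nn_integral_cmult)
  also have "\<dots> \<le> ennreal (1 + \<Gamma>) * ?A + ennreal (1 + 1 / \<Gamma>) * (ennreal \<Gamma> * ?I)"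
    by (intro add_left_mono mult_left_mono fr) simp
  also have "ennreal (1 + 1 / \<Gamma>) * (ennreal \<Gamma> * ?I) = ennreal (1 + \<Gamma>) * ?I"
  proof -
    have "ennreal (1 + 1 / \<Gamma>) * ennreal \<Gamma> = ennreal (1 + \<Gamma>)"
      using \<Gamma>1 by (simp add: distrib_right flip: ennreal_mult'')
    then show ?thesis by (simp only: mult.assoc[symmetric])
  qed
  also have "ennreal (1 + \<Gamma>) * ?A + ennreal (1 + \<Gamma>) * ?I = ennreal (1 + \<Gamma>) * (?A + ?I)"
    by (simp only: distrib_left)
  also have "?A + ?I = (\<integral>\<^sup>+z\<in>\<Omega>. ennreal ((norm (of_real (u z) - F z))\<^sup>2) \<partial>lborel)"
    using m1 m3 by (subst nn_integral_add[symmetric]) (auto intro!: nn_integral_cong simp: indicator_def cmod_power2 simp flip: ennreal_plus)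
  also have "ennreal (1 + \<Gamma>) * \<dots> \<le> ennreal (1 + \<Gamma>) * (ennreal (16 * (1 - \<epsilon> / pi)\<^sup>2) * ?E + ennreal e')"
    by (intro mult_left_mono F(2)) simp
  also have "\<dots> = ennreal ((1 + \<Gamma>) * (16 * (1 - \<epsilon> / pi)\<^sup>2)) * ?E + ennreal e"
  proof -
    have "ennreal ((1 + \<Gamma>) * (16 * (1 - \<epsilon> / pi)\<^sup>2)) = ennreal (1 + \<Gamma>) * ennreal (16 * (1 - \<epsilon> / pi)\<^sup>2)"
      "ennreal e = ennreal (1 + \<Gamma>) * ennreal e'"
      using \<Gamma>1 e' by (simp_all add: ennreal_mult'' flip: e'(2))
    then show ?thesis by (simp only: distrib_left mult.assoc)
  qed
  also have "\<dots> \<le> ennreal (16 * \<Gamma>) * ?E + ennreal e"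
    using \<Gamma> by (intro add_right_mono mult_right_mono ennreal_leI) auto
  finally show ?thesis unfolding \<Gamma>_def by blast
qed

end

section \<open>Mollification\<close>

text \<open>The power of 1/t is a parameter because differentiation raises it; the span of the
  family is closed under derivatives.\<close>

definition flat :: "nat \<Rightarrow> real \<Rightarrow> real" where
  "flat k t = (if t > 0 then exp (- 1 / t) / t ^ k else 0)"

lemma flat_nonneg: "flat k t \<ge> 0" by (simp add: flat_def)

text \<open>A single term, of index k + 2, of the exponential series at 1/t. The quadratic bound
  gives \<open>flat k\<close> the derivative 0 at 0.\<close>

lemma flat_bound: "flat k t \<le> fact (k + 2) * t\<^sup>2"
proof (cases "t > 0")
  case True
  define x where "x = 1 / t"
  have x: "x > 0" using True by (simp add: x_def)
  have "x ^ (k + 2) / fact (k + 2) \<le> exp x"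
  proof -
    have "(\<Sum>n\<in>{k + 2}. x ^ n / fact n) \<le> (\<Sum>n. x ^ n / fact n)"
      by (rule sum_le_suminf) (use x summable_exp_generic[of x] in \<open>auto simp: divide_inverse mult.commute\<close>)
    also have "\<dots> = exp x" by (simp add: exp_def divide_inverse mult.commute)
    finally show ?thesis by simp
  qed
  then have "x ^ (k + 2) \<le> exp x * fact (k + 2)"
    by (subst (asm) pos_divide_le_eq) (rule fact_gt_zero)
  then have "x ^ (k + 2) * exp (- x) \<le> exp x * fact (k + 2) * exp (- x)"
    by (intro mult_right_mono) auto
  also have "exp x * fact (k + 2) * exp (- x) = fact (k + 2)"
    by (simp add: exp_minus del: fact_Suc add_2_eq_Suc')
  finally have "x ^ (k + 2) * exp (- x) \<le> fact (k + 2)" .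
  then have "exp (- x) * x ^ k * x\<^sup>2 \<le> fact (k + 2)"
    by (simp only: power_add mult_ac)
  then have "flat k t / t\<^sup>2 \<le> fact (k + 2)"
    using True by (simp add: flat_def x_def power_divide)
  then show ?thesis using True by (simp add: divide_le_eq)
qed (simp add: flat_def)

lemma flat_has_derivative:
  "(flat k has_real_derivative (flat (k + 2) t - real k * flat (k + 1) t)) (at t)"
proof -
  consider "t > 0" | "t < 0" | "t = 0" by linarith
  then show ?thesis
  proof cases
    case 1
    have "((\<lambda>t. exp (- 1 / t) / t ^ k) has_real_derivative (flat (k + 2) t - real k * flat (k + 1) t)) (at t)"
      using 1
      by (auto intro!: derivative_eq_intros simp: flat_def power2_eq_square power_add field_simps)
       (cases k; simp add: field_simps)
    then show ?thesis
      by (rule DERIV_cong_ev[THEN iffD1, rotated -1, OF _ refl _ refl])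
        (use 1 eventually_nhds_in_open[of "{0<..}" t] in \<open>auto elim!: eventually_mono simp: flat_def\<close>)
  next
    case 2
    have "((\<lambda>_. 0) has_real_derivative (flat (k + 2) t - real k * flat (k + 1) t)) (at t)"
      using 2 by (simp add: flat_def)
    then show ?thesis
      by (rule DERIV_cong_ev[THEN iffD1, rotated -1, OF _ refl _ refl])
        (use 2 eventually_nhds_in_open[of "{..<0}" t] in \<open>auto elim!: eventually_mono simp: flat_def\<close>)
  next
    case 3
    have "((\<lambda>h. (flat k (0 + h) - flat k 0) / h) \<longlongrightarrow> 0) (at 0)"
    proof (rule Lim_null_comparison)
      show "\<forall>\<^sub>F h in at 0. norm ((flat k (0 + h) - flat k 0) / h) \<le> fact (k + 2) * \<bar>h\<bar>"
      proof (rule always_eventually, rule allI)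
        fix h :: real
        have "flat k h \<le> fact (k + 2) * \<bar>h\<bar> * \<bar>h\<bar>"
          using flat_bound[of k h] by (simp add: power2_eq_square mult.assoc)
        then show "norm ((flat k (0 + h) - flat k 0) / h) \<le> fact (k + 2) * \<bar>h\<bar>"
          using flat_nonneg[of k h] by (cases "h = 0") (simp_all add: flat_def[of k 0] abs_divide divide_le_eq)
      qed
      show "((\<lambda>h. fact (k + 2) * \<bar>h\<bar>) \<longlongrightarrow> 0) (at (0::real))"
        by (auto intro!: tendsto_eq_intros)
    qed
    then show ?thesis unfolding 3 DERIV_def by (simp add: flat_def)
  qed
qed

text \<open>Contains a bump function on \<open>ball x0 e\<close> and is closed under directional derivatives.\<close>

inductive bump_class :: "'a::euclidean_space \<Rightarrow> real \<Rightarrow> ('a \<Rightarrow> real) \<Rightarrow> bool" for x0 e where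
  base: "bump_class x0 e (\<lambda>x. flat k (e\<^sup>2 - (x - x0) \<bullet> (x - x0)))"
| lin: "bump_class x0 e f \<Longrightarrow> bump_class x0 e (\<lambda>x. ((x - x0) \<bullet> b) * f x)"
| cmult: "bump_class x0 e f \<Longrightarrow> bump_class x0 e (\<lambda>x. c * f x)"
| add: "bump_class x0 e f \<Longrightarrow> bump_class x0 e g \<Longrightarrow> bump_class x0 e (\<lambda>x. f x + g x)"

lemma bump_class_derivative:
  assumes "bump_class x0 e f"
  shows "\<exists>f'. (\<forall>x. (f has_derivative f' x) (at x)) \<and> (\<forall>h. bump_class x0 e (\<lambda>x. f' x h))"
  using assms
proof induction
  case (base k)
  define q where "q = (\<lambda>x. e\<^sup>2 - (x - x0) \<bullet> (x - x0))"
  let ?f' = "\<lambda>x h. (flat (k + 2) (q x) - real k * flat (k + 1) (q x)) * (- 2 * ((x - x0) \<bullet> h))"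
  have "((\<lambda>x. flat k (q x)) has_derivative ?f' x) (at x)" for x
  proof -
    have "(q has_derivative (\<lambda>h. - 2 * ((x - x0) \<bullet> h))) (at x)"
      unfolding q_def by (auto intro!: derivative_eq_intros simp: inner_commute)
    from has_derivative_compose[OF this flat_has_derivative[of k "q x", unfolded has_field_derivative_def]]
    show ?thesis by simp
  qed
  moreover have "bump_class x0 e (\<lambda>x. ?f' x h)" for h
  proof -
    have "bump_class x0 e (\<lambda>x. (- 2) * (((x - x0) \<bullet> h) * flat (k + 2) (q x)) + (2 * real k) * (((x - x0) \<bullet> h) * flat (k + 1) (q x)))"
      unfolding q_def by (intro bump_class.intros)
    then show ?thesis by (simp add: algebra_simps)
  qed
  ultimately show ?case unfolding q_def
    by (intro exI[of _ "\<lambda>x h. (flat (k + 2) (e\<^sup>2 - (x - x0) \<bullet> (x - x0)) - real k * flat (k + 1) (e\<^sup>2 - (x - x0) \<bullet> (x - x0))) * (- 2 * ((x - x0) \<bullet> h))"]) blast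
next
  case (lin f b)
  then obtain f' where f': "\<forall>x. (f has_derivative f' x) (at x)" "\<forall>h. bump_class x0 e (\<lambda>x. f' x h)" by blast
  have "((\<lambda>x. ((x - x0) \<bullet> b) * f x) has_derivative (\<lambda>h. (h \<bullet> b) * f x + ((x - x0) \<bullet> b) * f' x h)) (at x)" for x
    using f'(1)[rule_format, of x] by (auto intro!: derivative_eq_intros)
  moreover have "bump_class x0 e (\<lambda>x. (h \<bullet> b) * f x + ((x - x0) \<bullet> b) * f' x h)" for h
    using lin f'(2) by (intro bump_class.add bump_class.cmult bump_class.lin) auto
  ultimately show ?case by (intro exI[of _ "\<lambda>x h. (h \<bullet> b) * f x + ((x - x0) \<bullet> b) * f' x h"]) auto
next
  case (cmult f c)
  then obtain f' where f': "\<forall>x. (f has_derivative f' x) (at x)" "\<forall>h. bump_class x0 e (\<lambda>x. f' x h)" by blast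
  then show ?case
    by (intro exI[of _ "\<lambda>x h. c * f' x h"]) (auto intro!: derivative_eq_intros bump_class.cmult)
next
  case (add f g)
  then obtain f' g' where "\<forall>x. (f has_derivative f' x) (at x)" "\<forall>h. bump_class x0 e (\<lambda>x. f' x h)"
    "\<forall>x. (g has_derivative g' x) (at x)" "\<forall>h. bump_class x0 e (\<lambda>x. g' x h)" by blast
  then show ?case
    by (intro exI[of _ "\<lambda>x h. f' x h + g' x h"]) (auto intro!: derivative_eq_intros bump_class.add)
qed

lemma bump_class_C_k: "bump_class x0 e f \<Longrightarrow> C_k k f"
proof (induction k arbitrary: f)
  case 0
  then show ?case using bump_class_derivative
    by (metis C_k.simps(1) continuous_at_imp_continuous_on has_derivative_continuous)
next
  case (Suc k)
  obtain f' where f': "\<And>x. (f has_derivative f' x) (at x)" "\<And>h. bump_class x0 e (\<lambda>x. f' x h)"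
    using bump_class_derivative[OF Suc.prems] by blast
  have "f differentiable_on UNIV" using f'(1) by (auto simp: differentiable_on_def differentiable_def)
  moreover have "frechet_derivative f (at x) = f' x" for x
    using frechet_derivative_at[OF f'(1)] by simp
  ultimately show ?case using Suc.IH f'(2) by simp
qed

section \<open>The bump function and the mollifying kernel\<close>

definition bump :: "'a::euclidean_space \<Rightarrow> real \<Rightarrow> 'a \<Rightarrow> real" where
  "bump x0 e x = flat 0 (e\<^sup>2 - (x - x0) \<bullet> (x - x0))"

lemma bump_class_bump: "bump_class x0 e (bump x0 e)"
  unfolding bump_def[abs_def] by (rule bump_class.base)

lemma bump_nonneg: "bump x0 e x \<ge> 0"
  by (simp add: bump_def flat_nonneg)

lemma bump_nonzero_iff:
  assumes "e > 0"
  shows "bump x0 e x \<noteq> 0 \<longleftrightarrow> dist x x0 < e"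
proof -
  have "bump x0 e x \<noteq> 0 \<longleftrightarrow> (norm (x - x0))\<^sup>2 < e\<^sup>2"
    by (simp add: bump_def flat_def power2_norm_eq_inner)
  also have "\<dots> \<longleftrightarrow> norm (x - x0) < e"
    using assms by (auto intro: power_strict_mono dest: power_less_imp_less_base)
  finally show ?thesis by (simp add: dist_norm)
qed

lemma bump_class_support:
  assumes "bump_class x0 e f" "e > 0" "dist x x0 \<ge> e"
  shows "f x = 0"
  using assms(1)
proof induction
  case (base k)
  have "e\<^sup>2 \<le> (dist x x0)\<^sup>2" using assms by (intro power_mono) auto
  then show ?case by (simp add: flat_def dist_norm power2_norm_eq_inner)
qed auto

lemma bump_class_bounded:
  assumes "bump_class x0 e f" "e > 0"
  shows "\<exists>B>0. \<forall>x. \<bar>f x\<bar> \<le> B"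
proof -
  have "continuous_on (cball x0 e) f"
    using bump_class_C_k[OF assms(1), of 0] continuous_on_subset by auto
  then have "bounded (f ` cball x0 e)"
    by (intro compact_imp_bounded compact_continuous_image) auto
  then obtain B where B: "B > 0" "\<And>x. x \<in> cball x0 e \<Longrightarrow> \<bar>f x\<bar> \<le> B"
    by (auto simp: bounded_pos)
  have "\<bar>f x\<bar> \<le> B" for x
    using B bump_class_support[OF assms, of x] by (cases "x \<in> cball x0 e") (auto simp: dist_commute)
  then show ?thesis using B by blast
qed

text \<open>The directional derivatives belong to the class again and are therefore bounded on the
  whole space.\<close>

lemma bump_class_Lipschitz:
  assumes "bump_class x0 e f" "e > 0"
  shows "\<exists>L\<ge>0. \<forall>x y. \<bar>f x - f y\<bar> \<le> L * norm (x - y)"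
proof -
  obtain f' where f': "\<And>x. (f has_derivative f' x) (at x)" "\<And>h. bump_class x0 e (\<lambda>x. f' x h)"
    using bump_class_derivative[OF assms(1)] by blast
  obtain B where B: "\<And>b x. \<bar>f' x b\<bar> \<le> B b" using bump_class_bounded[OF f'(2) assms(2)] by metis
  show ?thesis
  proof (intro exI[of _ "\<Sum>b\<in>Basis. B b"] conjI allI)
    show "0 \<le> (\<Sum>b\<in>Basis. B b)" using B by (intro sum_nonneg) (metis abs_ge_zero order_trans)
    fix x y
    have "onorm (f' z) \<le> (\<Sum>b\<in>Basis. B b)" for z
    proof -
      have "onorm (f' z) \<le> (\<Sum>b\<in>Basis. norm (f' z b))"
        by (rule onorm_componentwise[OF has_derivative_bounded_linear[OF f'(1)]])
      also have "\<dots> \<le> (\<Sum>b\<in>Basis. B b)" using B by (intro sum_mono) simp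
      finally show ?thesis .
    qed
    then show "\<bar>f x - f y\<bar> \<le> (\<Sum>b\<in>Basis. B b) * norm (x - y)"
      using differentiable_bound[OF convex_UNIV, of f f' "\<Sum>b\<in>Basis. B b" x y] f'(1) by simp
  qed
qed

text \<open>The directional derivatives are Lipschitz, so the error of linearisation is quadratic
  with a constant independent of \<open>x\<close>. This uniformity allows it to be integrated in
  \<open>mollify_has_derivative\<close>.\<close>

lemma bump_class_Taylor:
  assumes "bump_class x0 e f" "e > 0" and f': "\<And>x. (f has_derivative f' x) (at x)" "\<And>h. bump_class x0 e (\<lambda>x. f' x h)"
  shows "\<exists>C\<ge>0. \<forall>x h. \<bar>f (x + h) - f x - f' x h\<bar> \<le> C * (norm h)\<^sup>2"
proof -
  obtain L where L: "\<And>b. L b \<ge> 0" "\<And>b x y. \<bar>f' x b - f' y b\<bar> \<le> L b * norm (x - y)"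
    using bump_class_Lipschitz[OF f'(2) assms(2)] by metis
  show ?thesis
  proof (intro exI[of _ "\<Sum>b\<in>Basis. L b"] conjI allI)
    show "0 \<le> (\<Sum>b\<in>Basis. L b)" using L by (intro sum_nonneg)
    fix x h
    have "norm (f (x + h) - f x - f' x (x + h - x)) \<le> norm (x + h - x) * ((\<Sum>b\<in>Basis. L b) * norm h)"
    proof (rule differentiable_bound_linearization[where S = "cball x (norm h)"])
      show "x + t *\<^sub>R (x + h - x) \<in> cball x (norm h)" if "t \<in> {0..1}" for t
        using that by (simp add: dist_norm mult_left_le_one_le)
      show "(f has_derivative f' y) (at y within cball x (norm h))" for y
        using f'(1) has_derivative_at_withinI by blast
      fix y assume y: "y \<in> cball x (norm h)"
      have "bounded_linear (\<lambda>k. f' y k - f' x k)"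
        using f'(1) has_derivative_bounded_linear by (blast intro: bounded_linear_sub)
      then have "onorm (\<lambda>k. f' y k - f' x k) \<le> (\<Sum>b\<in>Basis. norm (f' y b - f' x b))"
        by (rule onorm_componentwise)
      also have "\<dots> \<le> (\<Sum>b\<in>Basis. L b * norm h)"
      proof (rule sum_mono)
        fix b :: 'a
        have "norm (f' y b - f' x b) \<le> L b * norm (y - x)" using L(2) by simp
        also have "\<dots> \<le> L b * norm h"
          using y L(1) by (intro mult_left_mono) (auto simp: dist_norm norm_minus_commute)
        finally show "norm (f' y b - f' x b) \<le> L b * norm h" .
      qed
      finally show "onorm (f' y - f' x) \<le> (\<Sum>b\<in>Basis. L b) * norm h"
        by (simp add: sum_distrib_right fun_diff_def)
    qed simp
    then show "\<bar>f (x + h) - f x - f' x h\<bar> \<le> (\<Sum>b\<in>Basis. L b) * (norm h)\<^sup>2"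
      by (simp add: power2_eq_square mult_ac)
  qed
qed

lemma bump_integrable: "e > 0 \<Longrightarrow> integrable lborel (bump x0 e)"
proof -
  assume e: "e > 0"
  have c: "continuous_on UNIV (bump x0 e)" using bump_class_C_k[OF bump_class_bump, of 0] by simp
  have "integrable lborel (\<lambda>x. indicator (cball x0 e) x *\<^sub>R bump x0 e x)"
    by (intro borel_integrable_compact continuous_on_subset[OF c]) auto
  moreover have "(\<lambda>x. indicator (cball x0 e) x *\<^sub>R bump x0 e x) = bump x0 e"
  proof
    fix x
    show "indicator (cball x0 e) x *\<^sub>R bump x0 e x = bump x0 e x"
      using bump_nonzero_iff[OF e, of x0 x] by (cases "x \<in> cball x0 e") (auto simp: dist_commute)
  qed
  ultimately show ?thesis by (simp only:)
qed

lemma bump_integral_pos: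
  assumes e: "e > 0"
  shows "integral\<^sup>L lborel (bump x0 e) > 0"
proof -
  have "integral\<^sup>L lborel (bump x0 e) \<noteq> 0"
  proof
    assume "integral\<^sup>L lborel (bump x0 e) = 0"
    then have "AE x in lborel. bump x0 e x = 0"
      using integral_nonneg_eq_0_iff_AE[OF bump_integrable[OF e]] bump_nonneg by blast
    then have "AE x in lborel. x \<notin> ball x0 e"
      using bump_nonzero_iff[OF e, of x0] by (auto simp: dist_commute elim!: eventually_mono)
    then have "ball x0 e \<in> null_sets lborel"
      by (subst (asm) AE_iff_null_sets[symmetric]) auto
    then have "negligible (ball x0 e)"
      by (simp add: negligible_iff_null_sets null_sets_completionI)
    then show False using e by (simp add: open_not_negligible)
  qed
  moreover have "integral\<^sup>L lborel (bump x0 e) \<ge> 0" by (intro Bochner_Integration.integral_nonneg) (rule bump_nonneg)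
  ultimately show ?thesis by simp
qed

text \<open>A kernel in two points: for fixed \<open>x\<close> it is a bump in \<open>y\<close>, and
  by symmetry either variable can be integrated out. Normalisation at centre 0 is right for every
  centre by \<open>bump_integral_eq\<close>.\<close>

definition mollifier :: "real \<Rightarrow> 'a::euclidean_space \<Rightarrow> 'a \<Rightarrow> real" where
  "mollifier e x y = bump x e y / integral\<^sup>L lborel (bump (0::'a) e)"

lemma mollifier_nonneg: "e > 0 \<Longrightarrow> mollifier e x y \<ge> 0"
  unfolding mollifier_def using bump_integral_pos[of e 0] by (intro divide_nonneg_pos bump_nonneg)

lemma mollifier_support: "e > 0 \<Longrightarrow> dist x y \<ge> e \<Longrightarrow> mollifier e x y = 0"
  using bump_nonzero_iff[of e x y] by (auto simp: mollifier_def dist_commute)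

lemma mollifier_commute: "mollifier e x y = mollifier e y x"
  by (simp add: mollifier_def bump_def norm_minus_commute flip: power2_norm_eq_inner)

lemma bump_integral_eq:
  fixes x :: "'a::euclidean_space"
  shows "integral\<^sup>L lborel (bump x e) = integral\<^sup>L lborel (bump (0::'a) e)"
proof -
  have "integral\<^sup>L lborel (bump x e) = integral\<^sup>L (distr lborel borel ((+) x)) (bump x e)"
    by (simp add: lborel_distr_plus)
  also have "\<dots> = integral\<^sup>L lborel (\<lambda>y. bump x e (x + y))"
  proof (rule integral_distr)
    have "continuous_on UNIV (bump x e)" using bump_class_C_k[OF bump_class_bump, of 0] by simp
    then show "bump x e \<in> borel_measurable borel" by (rule borel_measurable_continuous_onI)
  qed simp
  also have "(\<lambda>y. bump x e (x + y)) = bump 0 e" by (auto simp: bump_def)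
  finally show ?thesis .
qed

lemma mollifier_integrable: "e > 0 \<Longrightarrow> integrable lborel (mollifier e x)"
  unfolding mollifier_def[abs_def] using bump_integrable[of e x] by simp

lemma mollifier_integral: "e > 0 \<Longrightarrow> integral\<^sup>L lborel (mollifier e x) = 1"
  unfolding mollifier_def[abs_def] using bump_integral_eq[of x e] bump_integral_pos[of e x] by simp

lemma mollifier_nn_integral:
  assumes "e > 0"
  shows "(\<integral>\<^sup>+y. ennreal (mollifier e x y) \<partial>lborel) = 1"
    "(\<integral>\<^sup>+y. ennreal (mollifier e y x) \<partial>lborel) = 1"
proof -
  have "(\<integral>\<^sup>+y. ennreal (mollifier e x y) \<partial>lborel) = ennreal (integral\<^sup>L lborel (mollifier e x))"
    using mollifier_nonneg[OF assms] by (intro nn_integral_eq_integral mollifier_integrable assms) auto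
  then show 1: "(\<integral>\<^sup>+y. ennreal (mollifier e x y) \<partial>lborel) = 1"
    by (simp only: mollifier_integral[OF assms] ennreal_1)
  have "(\<lambda>y. ennreal (mollifier e y x)) = (\<lambda>y. ennreal (mollifier e x y))"
    using mollifier_commute by metis
  then show "(\<integral>\<^sup>+y. ennreal (mollifier e y x) \<partial>lborel) = 1"
    using 1 by (simp only:)
qed

lemma continuous_on_mollifier: "continuous_on A (\<lambda>p. mollifier e (fst p) (snd p))"
proof -
  have "continuous_on UNIV (flat 0)"
    by (meson DERIV_continuous continuous_at_imp_continuous_on flat_has_derivative)
  then have "continuous_on A (\<lambda>p. flat 0 (e\<^sup>2 - (snd p - fst p) \<bullet> (snd p - fst p)))"
    by (rule continuous_on_compose2) (auto intro!: continuous_intros)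
  then show ?thesis unfolding mollifier_def bump_def divide_inverse by (intro continuous_intros)
qed

lemma mollifier_test_function:
  assumes e: "e > 0" and sub: "cball x e \<subseteq> \<Omega>"
  shows "test_function \<Omega> (mollifier e x)"
proof -
  have "{y. mollifier e x y \<noteq> 0} \<subseteq> cball x e" using mollifier_support[OF e] by (force simp: not_le)
  then have cl: "closure {y. mollifier e x y \<noteq> 0} \<subseteq> cball x e" by (simp add: closure_minimal)
  moreover have "compact (closure {y. mollifier e x y \<noteq> 0})"
    using cl by (meson bounded_cball bounded_subset closed_closure compact_eq_bounded_closed)
  moreover have "C_k k (mollifier e x)" for k
  proof -
    have "bump_class x e (\<lambda>y. (1 / integral\<^sup>L lborel (bump (0::'a) e)) * bump x e y)"
      by (rule bump_class.cmult[OF bump_class_bump])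
    then show ?thesis using bump_class_C_k unfolding mollifier_def[abs_def] by (metis (no_types, lifting) ext mult.left_neutral times_divide_eq_left)
  qed
  ultimately show ?thesis using sub by (auto simp: test_function_def)
qed

lemma mollifier_translate: "mollifier e x y = mollifier e 0 (x - y)"
  by (simp add: mollifier_def bump_def norm_minus_commute flip: power2_norm_eq_inner)

lemma bump_class_mollifier: "bump_class x e (mollifier e x)"
proof -
  have "mollifier e x = (\<lambda>y. (1 / integral\<^sup>L lborel (bump (0::'a) e)) * bump x e y)"
    by (auto simp: mollifier_def)
  then show ?thesis by (simp only: bump_class.cmult[OF bump_class_bump])
qed

lemma borel_measurable_mollifier [measurable]:
  "(\<lambda>p. mollifier e (fst p) (snd p)) \<in> borel_measurable (borel \<Otimes>\<^sub>M borel)"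
  unfolding borel_prod by (intro borel_measurable_continuous_onI continuous_on_mollifier)

lemma borel_measurable_mollifier2 [measurable (raw)]:
  assumes "f \<in> borel_measurable M" "g \<in> borel_measurable M"
  shows "(\<lambda>x. mollifier e (f x) (g x)) \<in> borel_measurable M"
  using measurable_compose[OF measurable_Pair[OF assms] borel_measurable_mollifier] by simp

section \<open>Convolution with the kernel\<close>

definition mollify :: "real \<Rightarrow> ('a::euclidean_space \<Rightarrow> 'b::euclidean_space) \<Rightarrow> 'a \<Rightarrow> 'b" where
  "mollify e U x = (LINT y|lborel. mollifier e x y *\<^sub>R U y)"

lemma mollifier_bounded:
  assumes "e > 0"
  obtains B where "B > 0" "\<And>x y::'a::euclidean_space. mollifier e x y \<le> B"
proof -
  obtain B where "B > 0" "\<And>z::'a. \<bar>mollifier e 0 z\<bar> \<le> B"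
    using bump_class_bounded[OF bump_class_mollifier assms] by metis
  then show ?thesis using that[of B] by (metis abs_le_D1 mollifier_translate)
qed

lemma mollify_integrable:
  fixes U :: "'a::euclidean_space \<Rightarrow> 'b::euclidean_space"
  assumes e: "e > 0" and U: "integrable lborel U"
  shows "integrable lborel (\<lambda>y. mollifier e x y *\<^sub>R U y)"
proof -
  obtain B where B: "B > 0" "\<And>x y::'a. mollifier e x y \<le> B" using mollifier_bounded[OF e] by blast
  have [measurable]: "U \<in> borel_measurable borel" using U by auto
  show ?thesis
  proof (rule Bochner_Integration.integrable_bound[of lborel "\<lambda>y. B *\<^sub>R norm (U y)"])
    show "AE y in lborel. norm (mollifier e x y *\<^sub>R U y) \<le> norm (B *\<^sub>R norm (U y))"
      using B mollifier_nonneg[OF e, of x] by (intro AE_I2) (auto intro!: mult_right_mono simp: abs_of_nonneg)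
  qed (use U in auto)
qed

text \<open>The quadratic Taylor remainder of the kernel, integrated against |U|, bounds the
  remainder of the convolution by C N |z - x|^2.\<close>

lemma mollify_has_derivative:
  fixes U :: "'a::euclidean_space \<Rightarrow> real"
  assumes e: "e > 0" and U: "integrable lborel U"
    and M': "\<And>z. (mollifier e 0 has_derivative M' z) (at z)" "\<And>h. bump_class 0 e (\<lambda>z. M' z h)"
  shows "(mollify e U has_derivative (\<lambda>h. h \<bullet> (\<Sum>b\<in>Basis. (LINT y|lborel. M' (x - y) b * U y) *\<^sub>R b))) (at x)"
proof -
  have Um [measurable]: "U \<in> borel_measurable borel" using U by auto
  obtain C where C: "C \<ge> 0" "\<And>x h. \<bar>mollifier e 0 (x + h) - mollifier e 0 x - M' x h\<bar> \<le> C * (norm h)\<^sup>2"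
    using bump_class_Taylor[OF bump_class_mollifier e M'] by metis
  have iM: "integrable lborel (\<lambda>y. M' (x - y) b * U y)" for b
  proof -
    obtain B where B: "B > 0" "\<And>z. \<bar>M' z b\<bar> \<le> B" using bump_class_bounded[OF M'(2) e] by metis
    have "continuous_on UNIV (\<lambda>z. M' z b)" using bump_class_C_k[OF M'(2), of 0] by simp
    then have [measurable]: "(\<lambda>z. M' z b) \<in> borel_measurable borel" by (rule borel_measurable_continuous_onI)
    show ?thesis
    proof (rule Bochner_Integration.integrable_bound[of lborel "\<lambda>y. B *\<^sub>R norm (U y)"])
      show "AE y in lborel. norm (M' (x - y) b * U y) \<le> norm (B *\<^sub>R norm (U y))"
        using B by (intro AE_I2) (auto simp: abs_mult intro!: mult_right_mono)
    qed (use U in auto)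
  qed
  define D where "D = (\<lambda>h. LINT y|lborel. M' (x - y) h * U y)"
  have D: "D h = h \<bullet> (\<Sum>b\<in>Basis. (LINT y|lborel. M' (x - y) b * U y) *\<^sub>R b)" for h
  proof -
    have "M' z h = (\<Sum>b\<in>Basis. (h \<bullet> b) * M' z b)" for z
    proof -
      interpret bounded_linear "M' z" using M'(1) has_derivative_bounded_linear by blast
      have "M' z h = M' z (\<Sum>b\<in>Basis. (h \<bullet> b) *\<^sub>R b)" by (simp add: euclidean_representation)
      also have "\<dots> = (\<Sum>b\<in>Basis. (h \<bullet> b) * M' z b)" by (simp add: sum scale)
      finally show ?thesis .
    qed
    then have "D h = (LINT y|lborel. (\<Sum>b\<in>Basis. (h \<bullet> b) * (M' (x - y) b * U y)))"
      unfolding D_def by (intro Bochner_Integration.integral_cong refl) (simp only: sum_distrib_right mult.assoc)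
    also have "\<dots> = (\<Sum>b\<in>Basis. (h \<bullet> b) * (LINT y|lborel. M' (x - y) b * U y))"
      using iM by (subst Bochner_Integration.integral_sum) auto
    also have "\<dots> = h \<bullet> (\<Sum>b\<in>Basis. (LINT y|lborel. M' (x - y) b * U y) *\<^sub>R b)"
      by (simp add: inner_sum_right mult.commute)
    finally show ?thesis .
  qed
  define N where "N = (LINT y|lborel. norm (U y))"
  have N: "N \<ge> 0" by (simp add: N_def)
  have est: "norm (mollify e U z - mollify e U x - D (z - x)) \<le> C * (norm (z - x))\<^sup>2 * N" for z
  proof -
    have i1: "integrable lborel (\<lambda>y. mollifier e w y *\<^sub>R U y)" for w by (rule mollify_integrable[OF e U])
    have i2: "integrable lborel (\<lambda>y. M' (x - y) (z - x) * U y)" by (rule iM)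
    have "mollify e U z - mollify e U x - D (z - x)
      = (LINT y|lborel. mollifier e z y *\<^sub>R U y - mollifier e x y *\<^sub>R U y - M' (x - y) (z - x) * U y)"
      unfolding mollify_def D_def using i1 i2 by simp
    also have "norm \<dots> \<le> (LINT y|lborel. C * (norm (z - x))\<^sup>2 * norm (U y))"
    proof (rule Bochner_Integration.integral_norm_bound_integral)
      fix y
      have "\<bar>mollifier e 0 (x - y + (z - x)) - mollifier e 0 (x - y) - M' (x - y) (z - x)\<bar> \<le> C * (norm (z - x))\<^sup>2"
        by (rule C(2))
      moreover have "x - y + (z - x) = z - y" by simp
      ultimately have "\<bar>mollifier e z y - mollifier e x y - M' (x - y) (z - x)\<bar> \<le> C * (norm (z - x))\<^sup>2"
        by (simp add: mollifier_translate[of e z] mollifier_translate[of e x])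
      then have "\<bar>mollifier e z y - mollifier e x y - M' (x - y) (z - x)\<bar> * \<bar>U y\<bar> \<le> C * (norm (z - x))\<^sup>2 * \<bar>U y\<bar>"
        by (rule mult_right_mono) simp
      then show "norm (mollifier e z y *\<^sub>R U y - mollifier e x y *\<^sub>R U y - M' (x - y) (z - x) * U y)
         \<le> C * (norm (z - x))\<^sup>2 * norm (U y)"
        by (simp add: abs_mult[symmetric] left_diff_distrib)
    qed (use i1 i2 U in auto)
    finally show ?thesis using U by (simp add: N_def)
  qed
  have "(mollify e U has_derivative D) (at x)"
    unfolding has_derivative_at_alt
  proof (intro conjI allI impI)
    show "bounded_linear D" unfolding D by (rule bounded_linear_inner_left)
    fix \<eta> :: real assume \<eta>: "\<eta> > 0"
    show "\<exists>d>0. \<forall>z. norm (z - x) < d \<longrightarrow> norm (mollify e U z - mollify e U x - D (z - x)) \<le> \<eta> * norm (z - x)"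
    \<comment> \<open>The summand 1 guards against C N = 0.\<close>
    proof (intro exI[of _ "\<eta> / (C * N + 1)"] conjI allI impI)
      have CN: "C * N + 1 > 0" using C N by (simp add: add_nonneg_pos)
      then show "\<eta> / (C * N + 1) > 0" using \<eta> by simp
      fix z assume z: "norm (z - x) < \<eta> / (C * N + 1)"
      have "C * (norm (z - x))\<^sup>2 * N \<le> ((C * N + 1) * norm (z - x)) * norm (z - x)"
        by (simp add: power2_eq_square algebra_simps)
      also have "\<dots> \<le> \<eta> * norm (z - x)"
        using z CN by (intro mult_right_mono) (auto simp: less_divide_eq mult.commute)
      finally show "norm (mollify e U z - mollify e U x - D (z - x)) \<le> \<eta> * norm (z - x)"
        using est[of z] by simp
    qed
  qed
  moreover have "D = (\<lambda>h. h \<bullet> (\<Sum>b\<in>Basis. (LINT y|lborel. M' (x - y) b * U y) *\<^sub>R b))"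
    using D by blast
  ultimately show ?thesis by simp
qed

text \<open>The kernel at \<open>x\<close> is a test function supported in \<open>K\<close>, and its
  derivative in \<open>y\<close> is minus the one in \<open>x\<close>. Testing the weak gradient
  with it moves the derivative of the convolution from the kernel to \<open>g\<close>.\<close>

lemma mollify_gradient:
  fixes u :: "'a::euclidean_space \<Rightarrow> real"
  assumes wg: "weak_gradient \<Omega> u g" and e: "e > 0" and x: "cball x e \<subseteq> K" "K \<subseteq> \<Omega>" and \<Omega>: "open \<Omega>"
    and uK: "u absolutely_integrable_on K" and gK: "g absolutely_integrable_on K"
    and U: "integrable lborel U" "AE y in lebesgue. U y = indicator K y *\<^sub>R u y"
    and G: "integrable lborel G" "AE y in lebesgue. G y = indicator K y *\<^sub>R g y"
  shows "(mollify e U has_derivative (\<lambda>h. h \<bullet> mollify e G x)) (at x)"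
proof -
  have [measurable]: "U \<in> borel_measurable borel" "G \<in> borel_measurable borel" using U G by auto
  have um [measurable]: "(\<lambda>y. indicator K y *\<^sub>R u y) \<in> borel_measurable lebesgue"
    using uK unfolding set_integrable_def by (rule borel_measurable_integrable)
  have gm [measurable]: "(\<lambda>y. indicator K y *\<^sub>R g y) \<in> borel_measurable lebesgue"
    using gK unfolding set_integrable_def by (rule borel_measurable_integrable)
  obtain M' where M': "\<And>z::'a. (mollifier e 0 has_derivative M' z) (at z)" "\<And>h. bump_class 0 e (\<lambda>z. M' z h)"
    using bump_class_derivative[OF bump_class_mollifier] by metis
  have M'm [measurable]: "(\<lambda>z. M' z b) \<in> borel_measurable borel" for b
  proof -
    have "continuous_on UNIV (\<lambda>z. M' z b)" using bump_class_C_k[OF M'(2), of 0] by simp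
    then show ?thesis by (rule borel_measurable_continuous_onI)
  qed
  have dm: "frechet_derivative (mollifier e x) (at y) = (\<lambda>h. - M' (x - y) h)" for y
  proof -
    have "mollifier e x = (\<lambda>y. mollifier e 0 (x - y))" using mollifier_translate by blast
    moreover have "((\<lambda>y. mollifier e 0 (x - y)) has_derivative (\<lambda>h. M' (x - y) (- h))) (at y)"
      by (rule has_derivative_compose[OF _ M'(1)]) (auto intro!: derivative_eq_intros)
    moreover have "M' (x - y) (- h) = - M' (x - y) h" for h
      using has_derivative_bounded_linear[OF M'(1)] by (simp add: linear_simps)
    ultimately show ?thesis using frechet_derivative_at by fastforce
  qed
  have tf: "test_function \<Omega> (mollifier e x)"
    by (rule mollifier_test_function[OF e]) (use x in auto)
  have b: "(LINT y|lborel. M' (x - y) b * U y) = mollify e G x \<bullet> b" if b: "b \<in> Basis" for b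
  proof -
    have wb: "(LINT y:\<Omega>|lebesgue. u y * frechet_derivative (mollifier e x) (at y) b)
        = - (LINT y:\<Omega>|lebesgue. (g y \<bullet> b) * mollifier e x y)"
      using wg tf b by (auto simp: weak_gradient_def)
    have [measurable]: "(\<lambda>y. M' (x - y) b) \<in> borel_measurable lebesgue"
      by (intro measurable_completion) measurable
    have [measurable]: "(\<lambda>y. mollifier e x y) \<in> borel_measurable lebesgue"
      by (intro measurable_completion) measurable
    have [measurable]: "U \<in> borel_measurable lebesgue" "G \<in> borel_measurable lebesgue"
      by (intro measurable_completion; measurable)+
    have in_K: "y \<in> K" "y \<in> \<Omega>" if "dist x y < e" for y
      using that x by (auto simp: subset_iff)
    have "(LINT y:\<Omega>|lebesgue. u y * frechet_derivative (mollifier e x) (at y) b)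
        = (LINT y|lebesgue. - (M' (x - y) b * (indicator K y *\<^sub>R u y)))"
      unfolding set_lebesgue_integral_def
    proof (intro Bochner_Integration.integral_cong refl)
      fix y
      have "M' (x - y) b = 0" if "\<not> dist x y < e"
        using bump_class_support[OF M'(2) e, of "x - y"] that by (simp add: dist_norm)
      then show "indicator \<Omega> y *\<^sub>R (u y * frechet_derivative (mollifier e x) (at y) b) = - (M' (x - y) b * (indicator K y *\<^sub>R u y))"
        using in_K[of y] by (cases "dist x y < e") (auto simp: dm)
    qed
    also have "\<dots> = (LINT y|lebesgue. - (M' (x - y) b * U y))"
      by (rule integral_cong_AE, measurable) (use U(2) in \<open>auto elim!: eventually_mono\<close>)
    also have "\<dots> = - (LINT y|lborel. M' (x - y) b * U y)"
      by (subst integral_completion) auto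
    finally have 1: "(LINT y:\<Omega>|lebesgue. u y * frechet_derivative (mollifier e x) (at y) b) = - (LINT y|lborel. M' (x - y) b * U y)" .
    have "(LINT y:\<Omega>|lebesgue. (g y \<bullet> b) * mollifier e x y) = (LINT y|lebesgue. (mollifier e x y *\<^sub>R (indicator K y *\<^sub>R g y)) \<bullet> b)"
      unfolding set_lebesgue_integral_def
    proof (intro Bochner_Integration.integral_cong refl)
      fix y
      show "indicator \<Omega> y *\<^sub>R ((g y \<bullet> b) * mollifier e x y) = (mollifier e x y *\<^sub>R (indicator K y *\<^sub>R g y)) \<bullet> b"
        using in_K[of y] mollifier_support[OF e, of x y] by (cases "dist x y < e") auto
    qed
    also have "\<dots> = (LINT y|lebesgue. (mollifier e x y *\<^sub>R G y) \<bullet> b)"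
      by (rule integral_cong_AE, measurable) (use G(2) in \<open>auto elim!: eventually_mono\<close>)
    also have "\<dots> = (LINT y|lborel. (mollifier e x y *\<^sub>R G y) \<bullet> b)"
      by (subst integral_completion) auto
    also have "\<dots> = mollify e G x \<bullet> b"
      unfolding mollify_def by (rule integral_inner_left) (rule mollify_integrable[OF e G(1)])
    finally show ?thesis using 1 wb by simp
  qed
  have "(\<Sum>b\<in>Basis. (LINT y|lborel. M' (x - y) b * U y) *\<^sub>R b) = mollify e G x"
    using b by (simp add: euclidean_representation)
  then show ?thesis using mollify_has_derivative[OF e U(1) M', of x] by simp
qed

text \<open>\<open>L1_loc\<close> provides Lebesgue measurable functions only, while Fubini over
  \<open>lborel\<close> asks for Borel ones. The representative is built coordinate by coordinate
  and also cuts \<open>f\<close> off outside \<open>K\<close>.\<close>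

lemma absolutely_integrable_Borel_representative:
  fixes f :: "'a::euclidean_space \<Rightarrow> 'b::euclidean_space"
  assumes f: "f absolutely_integrable_on K"
  obtains U where "integrable lborel U" "AE y in lebesgue. U y = indicator K y *\<^sub>R f y"
proof -
  define F where "F = (\<lambda>y. indicator K y *\<^sub>R f y)"
  have F: "integrable lebesgue F" using f unfolding set_integrable_def F_def .
  have "\<exists>g'\<in>borel_measurable lborel. AE y in lborel. F y \<bullet> b = g' y" for b
    by (rule completion_ex_borel_measurable_real) (use F in auto)
  then obtain V where V: "\<And>b. V b \<in> borel_measurable lborel" "\<And>b. AE y in lborel. F y \<bullet> b = V b y"
    by metis
  define U where "U = (\<lambda>y. \<Sum>b\<in>Basis. V b y *\<^sub>R b)"
  have [measurable]: "V b \<in> borel_measurable borel" for b using V(1)[of b] by simp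
  have Um [measurable]: "U \<in> borel_measurable borel" unfolding U_def by measurable
  have "AE y in lborel. \<forall>b\<in>Basis. F y \<bullet> b = V b y"
    using V(2) by (intro AE_finite_allI) auto
  then have "AE y in lborel. U y = F y"
  proof eventually_elim
    case (elim y)
    have "U y = (\<Sum>b\<in>Basis. (F y \<bullet> b) *\<^sub>R b)" unfolding U_def using elim by (intro sum.cong) auto
    then show ?case by (simp add: euclidean_representation)
  qed
  then have ae: "AE y in lebesgue. U y = F y" by (rule AE_completion)
  have "integrable lebesgue U"
    by (rule integrable_cong_AE_imp[OF F]) (use ae in \<open>auto intro!: measurable_completion\<close>)
  then have "integrable lborel U" by (subst (asm) integrable_completion) auto
  then show ?thesis using that ae by (simp add: F_def)
qed

lemma continuous_mollify:
  fixes G :: "'a::euclidean_space \<Rightarrow> 'b::euclidean_space"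
  assumes e: "e > 0" and G: "integrable lborel G"
  shows "continuous_on A (mollify e G)"
proof -
  obtain L where L: "L \<ge> 0" "\<And>x y::'a. \<bar>mollifier e 0 x - mollifier e 0 y\<bar> \<le> L * norm (x - y)"
    using bump_class_Lipschitz[OF bump_class_mollifier e] by blast
  have [measurable]: "G \<in> borel_measurable borel" using G by auto
  define N where "N = (LINT y|lborel. norm (G y))"
  have N: "N \<ge> 0" by (simp add: N_def)
  have lip: "dist (mollify e G x) (mollify e G z) \<le> (L * N) * dist x z" for x z
  proof -
    have i: "integrable lborel (\<lambda>y. mollifier e w y *\<^sub>R G y)" for w by (rule mollify_integrable[OF e G])
    have "mollify e G x - mollify e G z = (LINT y|lborel. mollifier e x y *\<^sub>R G y - mollifier e z y *\<^sub>R G y)"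
      unfolding mollify_def using i by simp
    also have "norm \<dots> \<le> (LINT y|lborel. L * norm (x - z) * norm (G y))"
    proof (rule Bochner_Integration.integral_norm_bound_integral)
      fix y
      have "\<bar>mollifier e x y - mollifier e z y\<bar> \<le> L * norm (x - z)"
        using L(2)[of "x - y" "z - y"] by (simp add: mollifier_translate[of e x] mollifier_translate[of e z])
      then show "norm (mollifier e x y *\<^sub>R G y - mollifier e z y *\<^sub>R G y) \<le> L * norm (x - z) * norm (G y)"
        by (simp add: mult_right_mono flip: scaleR_diff_left)
    qed (use i G in auto)
    finally show ?thesis using G by (simp add: N_def dist_norm mult_ac)
  qed
  have "(L * N)-lipschitz_on A (mollify e G)"
    using lip L N by (intro lipschitz_onI) auto
  then show ?thesis by (rule lipschitz_on_continuous_on)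
qed

text \<open>The kernel is a probability density. Integrating 2 a |G y| \<le> a^2 + |G y|^2 with a =
  |mollify e G x| gives 2 a^2 \<le> a^2 + I, where the finite a^2 cancels.\<close>

lemma mollify_Jensen:
  fixes G :: "'a::euclidean_space \<Rightarrow> 'b::euclidean_space"
  assumes e: "e > 0" and G: "integrable lborel G"
  shows "ennreal ((norm (mollify e G x))\<^sup>2) \<le> (\<integral>\<^sup>+y. ennreal (mollifier e x y * (norm (G y))\<^sup>2) \<partial>lborel)"
proof -
  have [measurable]: "G \<in> borel_measurable borel" using G by auto
  define a where "a = norm (mollify e G x)"
  have a: "a \<ge> 0" by (simp add: a_def)
  let ?I = "\<integral>\<^sup>+y. ennreal (mollifier e x y * (norm (G y))\<^sup>2) \<partial>lborel"
  have i: "integrable lborel (\<lambda>y. mollifier e x y *\<^sub>R G y)" by (rule mollify_integrable[OF e G])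
  have m0: "mollifier e x y \<ge> 0" for y using mollifier_nonneg[OF e] .
  have "ennreal a \<le> (\<integral>\<^sup>+y. ennreal (norm (mollifier e x y *\<^sub>R G y)) \<partial>lborel)"
    unfolding a_def mollify_def using i by (intro integral_norm_bound_ennreal)
  also have "\<dots> = (\<integral>\<^sup>+y. ennreal (mollifier e x y * norm (G y)) \<partial>lborel)"
    using m0 by simp
  finally have "ennreal (2 * a) * ennreal a \<le> ennreal (2 * a) * (\<integral>\<^sup>+y. ennreal (mollifier e x y * norm (G y)) \<partial>lborel)"
    by (rule mult_left_mono) simp
  also have "\<dots> = (\<integral>\<^sup>+y. ennreal (2 * a) * ennreal (mollifier e x y * norm (G y)) \<partial>lborel)"
    by (rule nn_integral_cmult[symmetric]) measurable
  also have "\<dots> \<le> (\<integral>\<^sup>+y. ennreal (a\<^sup>2) * ennreal (mollifier e x y) + ennreal (mollifier e x y * (norm (G y))\<^sup>2) \<partial>lborel)"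
  proof (rule nn_integral_mono)
    fix y
    have "2 * a * norm (G y) \<le> a\<^sup>2 + (norm (G y))\<^sup>2" by (rule sum_squares_bound[of a "norm (G y)"])
    then have "mollifier e x y * (2 * a * norm (G y)) \<le> mollifier e x y * (a\<^sup>2 + (norm (G y))\<^sup>2)"
      using m0 by (rule mult_left_mono)
    then show "ennreal (2 * a) * ennreal (mollifier e x y * norm (G y)) \<le> ennreal (a\<^sup>2) * ennreal (mollifier e x y) + ennreal (mollifier e x y * (norm (G y))\<^sup>2)"
      using a m0[of y] by (simp add: algebra_simps flip: ennreal_mult' ennreal_plus)
  qed
  also have "\<dots> = ennreal (a\<^sup>2) + ?I"
    by (subst nn_integral_add; simp add: nn_integral_cmult mollifier_nn_integral[OF e])
  finally have "ennreal (a\<^sup>2) + ennreal (a\<^sup>2) \<le> ennreal (a\<^sup>2) + ?I"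
    using a by (simp add: power2_eq_square mult.assoc flip: ennreal_mult' ennreal_plus)
  then show ?thesis unfolding a_def
    by (simp add: ennreal_add_left_cancel_le)
qed

text \<open>Jensen's inequality followed by Fubini, as the kernel has mass 1 in either variable. The
  weights pass under the integral because D x \<le> d y for every y that the kernel at x
  sees.\<close>

lemma mollify_energy:
  fixes G :: "'a::euclidean_space \<Rightarrow> 'b::euclidean_space"
  assumes e: "e > 0" and G: "integrable lborel G"
    and [measurable]: "S \<in> sets borel" "D \<in> borel_measurable borel" "d \<in> borel_measurable borel"
    and Dd: "\<And>x y. x \<in> S \<Longrightarrow> dist x y < e \<Longrightarrow> 0 \<le> D x \<and> D x \<le> d y"
  shows "(\<integral>\<^sup>+x\<in>S. ennreal ((D x)\<^sup>2 * (norm (mollify e G x))\<^sup>2) \<partial>lborel)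
    \<le> (\<integral>\<^sup>+y. ennreal ((d y)\<^sup>2 * (norm (G y))\<^sup>2) \<partial>lborel)"
proof -
  have Gm [measurable]: "G \<in> borel_measurable borel" using G by auto
  have m0: "mollifier e x y \<ge> 0" for x y :: 'a using mollifier_nonneg[OF e] .
  have "(\<integral>\<^sup>+x\<in>S. ennreal ((D x)\<^sup>2 * (norm (mollify e G x))\<^sup>2) \<partial>lborel)
    \<le> (\<integral>\<^sup>+x. (\<integral>\<^sup>+y. ennreal ((d y)\<^sup>2 * (norm (G y))\<^sup>2) * ennreal (mollifier e x y) \<partial>lborel) \<partial>lborel)"
  proof (rule nn_integral_mono)
    fix x :: 'a
    show "ennreal ((D x)\<^sup>2 * (norm (mollify e G x))\<^sup>2) * indicator S x
      \<le> (\<integral>\<^sup>+y. ennreal ((d y)\<^sup>2 * (norm (G y))\<^sup>2) * ennreal (mollifier e x y) \<partial>lborel)"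
    proof (cases "x \<in> S")
      case True
      have "ennreal ((D x)\<^sup>2 * (norm (mollify e G x))\<^sup>2) = ennreal ((D x)\<^sup>2) * ennreal ((norm (mollify e G x))\<^sup>2)"
        by (simp add: ennreal_mult)
      also have "\<dots> \<le> ennreal ((D x)\<^sup>2) * (\<integral>\<^sup>+y. ennreal (mollifier e x y * (norm (G y))\<^sup>2) \<partial>lborel)"
        by (intro mult_left_mono mollify_Jensen e G) simp
      also have "\<dots> = (\<integral>\<^sup>+y. ennreal ((D x)\<^sup>2) * ennreal (mollifier e x y * (norm (G y))\<^sup>2) \<partial>lborel)"
        by (rule nn_integral_cmult[symmetric]) measurable
      also have "\<dots> \<le> (\<integral>\<^sup>+y. ennreal ((d y)\<^sup>2 * (norm (G y))\<^sup>2) * ennreal (mollifier e x y) \<partial>lborel)"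
      proof (rule nn_integral_mono)
        fix y
        show "ennreal ((D x)\<^sup>2) * ennreal (mollifier e x y * (norm (G y))\<^sup>2) \<le> ennreal ((d y)\<^sup>2 * (norm (G y))\<^sup>2) * ennreal (mollifier e x y)"
        proof (cases "dist x y < e")
          case c: True
          have "(D x)\<^sup>2 \<le> (d y)\<^sup>2" using Dd[OF True c] by (intro power_mono) auto
          then have "(D x)\<^sup>2 * (mollifier e x y * (norm (G y))\<^sup>2) \<le> (d y)\<^sup>2 * (mollifier e x y * (norm (G y))\<^sup>2)"
            using m0 by (intro mult_right_mono) auto
          then show ?thesis using m0[of x y] by (simp add: mult_ac flip: ennreal_mult')
        next
          case False
          then show ?thesis using mollifier_support[OF e, of x y] by simp
        qed
      qed
      finally show ?thesis using True by simp
    qed simp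
  qed
  also have "\<dots> = (\<integral>\<^sup>+y. (\<integral>\<^sup>+x. ennreal ((d y)\<^sup>2 * (norm (G y))\<^sup>2) * ennreal (mollifier e x y) \<partial>lborel) \<partial>lborel)"
    by (rule lborel_pair.Fubini') measurable
  also have "\<dots> = (\<integral>\<^sup>+y. ennreal ((d y)\<^sup>2 * (norm (G y))\<^sup>2) \<partial>lborel)"
    by (intro nn_integral_cong) (simp add: nn_integral_cmult mollifier_nn_integral[OF e])
  finally show ?thesis .
qed

text \<open>Measurability gives continuous functions converging almost everywhere. Truncating them
  and \<open>U\<close> at height n costs little in L1 and makes dominated convergence applicable on
  the bounded set \<open>B\<close>.\<close>

lemma L1_approximation_continuous:
  fixes U :: "'a::euclidean_space \<Rightarrow> real"
  assumes U: "integrable lborel U" and B: "B \<in> sets borel" "bounded B" and \<eta>: "\<eta> > 0"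
  obtains f where "continuous_on UNIV f" "(\<integral>\<^sup>+x\<in>B. ennreal \<bar>U x - f x\<bar> \<partial>lborel) \<le> ennreal \<eta>"
proof -
  have [measurable]: "U \<in> borel_measurable borel" "B \<in> sets borel" using U B by auto
  define c where "c = (\<lambda>(n::nat) t. max (- real n) (min (real n) t))"
  have cc: "continuous_on UNIV (c n)" for n unfolding c_def by (intro continuous_intros)
  have cm [measurable]: "c n \<in> borel_measurable borel" for n by (intro borel_measurable_continuous_onI cc)
  have cb: "\<bar>c n t\<bar> \<le> real n" for n t by (auto simp: c_def)
  have "(\<lambda>n. \<integral>\<^sup>+x. ennreal \<bar>U x - c n (U x)\<bar> \<partial>lborel) \<longlonglongrightarrow> (\<integral>\<^sup>+x. 0 \<partial>(lborel :: 'a measure))"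
  proof (rule nn_integral_dominated_convergence[where w = "\<lambda>x. ennreal (norm (U x))"])
    show "AE x in lborel. (\<lambda>n. ennreal \<bar>U x - c n (U x)\<bar>) \<longlonglongrightarrow> 0"
    proof (rule AE_I2)
      fix x
      obtain N where N: "\<bar>U x\<bar> \<le> real N" using real_arch_simple by blast
      have "eventually (\<lambda>n. ennreal \<bar>U x - c n (U x)\<bar> = 0) sequentially"
        using eventually_ge_at_top[of N] by eventually_elim (use N in \<open>auto simp: c_def\<close>)
      then show "(\<lambda>n. ennreal \<bar>U x - c n (U x)\<bar>) \<longlonglongrightarrow> 0" by (rule tendsto_eventually)
    qed
    show "AE x in lborel. ennreal \<bar>U x - c n (U x)\<bar> \<le> ennreal (norm (U x))" for n
      by (intro AE_I2 ennreal_leI) (auto simp: c_def)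
    show "(\<integral>\<^sup>+x. ennreal (norm (U x)) \<partial>lborel) < \<infinity>" using U by (simp add: integrable_iff_bounded)
  qed auto
  then have "eventually (\<lambda>n. (\<integral>\<^sup>+x. ennreal \<bar>U x - c n (U x)\<bar> \<partial>lborel) < ennreal (\<eta> / 2)) sequentially"
    using \<eta> by (intro order_tendstoD(2)) auto
  then obtain n where n: "(\<integral>\<^sup>+x. ennreal \<bar>U x - c n (U x)\<bar> \<partial>lborel) < ennreal (\<eta> / 2)"
    by (auto simp: eventually_sequentially)
  have "U measurable_on UNIV"
    by (rule lebesgue_measurable_imp_measurable_on) (auto intro!: measurable_completion)
  then obtain N g where N: "negligible N" and g: "\<And>k. continuous_on UNIV (g k)"
    "\<And>x. x \<notin> N \<Longrightarrow> (\<lambda>k. g k x) \<longlonglongrightarrow> U x"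
    unfolding measurable_on_def by auto
  have gm [measurable]: "g k \<in> borel_measurable borel" for k by (intro borel_measurable_continuous_onI g)
  have "AE x in lebesgue. x \<notin> N"
    using N by (simp add: negligible_iff_null_sets AE_not_in)
  then have aeN: "AE x in lborel. x \<notin> N" by (simp add: AE_completion_iff)
  have fB: "emeasure lborel B < \<infinity>" using B emeasure_bounded_finite by auto
  have "(\<lambda>k. \<integral>\<^sup>+x. ennreal \<bar>c n (U x) - c n (g k x)\<bar> * indicator B x \<partial>lborel) \<longlonglongrightarrow> (\<integral>\<^sup>+x. 0 \<partial>(lborel :: 'a measure))"
  proof (rule nn_integral_dominated_convergence[where w = "\<lambda>x. ennreal (2 * real n) * indicator B x"])
    show "AE x in lborel. (\<lambda>k. ennreal \<bar>c n (U x) - c n (g k x)\<bar> * indicator B x) \<longlonglongrightarrow> 0"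
      using aeN
    proof eventually_elim
      case (elim x)
      have "(\<lambda>k. c n (g k x)) \<longlonglongrightarrow> c n (U x)"
        using continuous_on_tendsto_compose[OF cc g(2)[OF elim]] by auto
      then have "(\<lambda>k. ennreal \<bar>c n (U x) - c n (g k x)\<bar>) \<longlonglongrightarrow> ennreal \<bar>c n (U x) - c n (U x)\<bar>"
        by (intro tendsto_ennrealI tendsto_rabs tendsto_diff tendsto_const)
      then show ?case by (cases "x \<in> B") auto
    qed
    show "AE x in lborel. ennreal \<bar>c n (U x) - c n (g k x)\<bar> * indicator B x \<le> ennreal (2 * real n) * indicator B x" for k
    proof (intro AE_I2 mult_right_mono ennreal_leI)
      fix x show "\<bar>c n (U x) - c n (g k x)\<bar> \<le> 2 * real n" using cb[of n "U x"] cb[of n "g k x"] by linarith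
    qed simp
    show "(\<integral>\<^sup>+x. ennreal (2 * real n) * indicator B x \<partial>lborel) < \<infinity>"
      using fB by (simp add: nn_integral_cmult_indicator ennreal_mult_less_top)
  qed auto
  then have "eventually (\<lambda>k. (\<integral>\<^sup>+x. ennreal \<bar>c n (U x) - c n (g k x)\<bar> * indicator B x \<partial>lborel) < ennreal (\<eta> / 2)) sequentially"
    using \<eta> by (intro order_tendstoD(2)) auto
  then obtain k where k: "(\<integral>\<^sup>+x. ennreal \<bar>c n (U x) - c n (g k x)\<bar> * indicator B x \<partial>lborel) < ennreal (\<eta> / 2)"
    by (auto simp: eventually_sequentially)
  have "(\<integral>\<^sup>+x\<in>B. ennreal \<bar>U x - c n (g k x)\<bar> \<partial>lborel)
    \<le> (\<integral>\<^sup>+x. ennreal \<bar>U x - c n (U x)\<bar> + ennreal \<bar>c n (U x) - c n (g k x)\<bar> * indicator B x \<partial>lborel)"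
  proof (rule nn_integral_mono)
    fix x
    have "ennreal \<bar>U x - c n (g k x)\<bar> \<le> ennreal \<bar>U x - c n (U x)\<bar> + ennreal \<bar>c n (U x) - c n (g k x)\<bar>"
      by (simp flip: ennreal_plus)
    then show "ennreal \<bar>U x - c n (g k x)\<bar> * indicator B x \<le> ennreal \<bar>U x - c n (U x)\<bar> + ennreal \<bar>c n (U x) - c n (g k x)\<bar> * indicator B x"
      by (cases "x \<in> B") auto
  qed
  also have "\<dots> = (\<integral>\<^sup>+x. ennreal \<bar>U x - c n (U x)\<bar> \<partial>lborel) + (\<integral>\<^sup>+x. ennreal \<bar>c n (U x) - c n (g k x)\<bar> * indicator B x \<partial>lborel)"
    by (rule nn_integral_add) measurable
  also have "\<dots> \<le> ennreal (\<eta> / 2) + ennreal (\<eta> / 2)" using n k by (intro add_mono) auto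
  also have "\<dots> = ennreal \<eta>" using \<eta> by (simp flip: ennreal_plus)
  finally show ?thesis
    by (intro that[of "\<lambda>x. c n (g k x)"]) (auto intro!: continuous_on_compose2[OF cc g(1)])
qed

text \<open>The error is split by a continuous \<open>f\<close>: the mollification of |U - f|, the
  oscillation of \<open>f\<close>, and |U - f| itself. The first has the same integral as the third,
  as the kernel has mass 1; each part gets a third of \<eta>.\<close>

lemma mollify_L1_convergence:
  fixes U :: "'a::euclidean_space \<Rightarrow> real"
  assumes U: "integrable lborel U" and S: "S \<in> sets borel" "bounded S" and \<eta>: "\<eta> > 0"
  shows "\<exists>e0>0. \<forall>e. 0 < e \<longrightarrow> e < e0 \<longrightarrow>
    (\<integral>\<^sup>+x\<in>S. ennreal \<bar>mollify e U x - U x\<bar> \<partial>lborel) \<le> ennreal \<eta>"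
proof -
  have [measurable]: "U \<in> borel_measurable borel" "S \<in> sets borel" using U S by auto
  obtain \<rho> where \<rho>: "\<rho> > 0" "S \<subseteq> cball 0 \<rho>"
  proof -
    obtain \<rho> where "\<rho> > 0" "\<forall>x\<in>S. norm x \<le> \<rho>" using S(2) unfolding bounded_pos by blast
    moreover from this have "S \<subseteq> cball 0 \<rho>" by auto
    ultimately show ?thesis using that by blast
  qed
  \<comment> \<open>A ball around \<open>S\<close> enlarged by 1. The mollification radius stays
    below 1, so the kernel at points of \<open>S\<close> sees only \<open>B\<close>.\<close>
  define B where "B = cball (0::'a) (\<rho> + 1)"
  have [measurable]: "B \<in> sets borel" by (simp add: B_def)
  obtain f where f: "continuous_on UNIV f" "(\<integral>\<^sup>+x\<in>B. ennreal \<bar>U x - f x\<bar> \<partial>lborel) \<le> ennreal (\<eta> / 3)"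
    using L1_approximation_continuous[OF U, of B "\<eta> / 3"] \<eta> by (auto simp: B_def)
  have [measurable]: "f \<in> borel_measurable borel" using f(1) by (rule borel_measurable_continuous_onI)
  define \<mu> where "\<mu> = measure lborel S"
  have \<mu>: "emeasure lborel S = ennreal \<mu>" "\<mu> \<ge> 0"
    using S emeasure_bounded_finite[of S] by (auto simp: \<mu>_def emeasure_eq_ennreal_measure)
  \<comment> \<open>The summand 1 allows \<open>S\<close> to have measure 0.\<close>
  define \<omega> where "\<omega> = \<eta> / (3 * (\<mu> + 1))"
  have \<omega>: "\<omega> > 0" "\<omega> * \<mu> \<le> \<eta> / 3" using \<eta> \<mu>(2) by (auto simp: \<omega>_def field_simps)
  have "uniformly_continuous_on B f"
    using f(1) by (intro compact_uniformly_continuous) (auto simp: B_def intro: continuous_on_subset)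
  then obtain \<delta> where \<delta>: "\<delta> > 0" "\<And>x y. x \<in> B \<Longrightarrow> y \<in> B \<Longrightarrow> dist y x < \<delta> \<Longrightarrow> dist (f y) (f x) < \<omega>"
    unfolding uniformly_continuous_on_def using \<omega> by metis
  show ?thesis
  proof (intro exI[of _ "min 1 \<delta>"] conjI allI impI)
    show "min 1 \<delta> > 0" using \<delta> by simp
    fix e assume e: "0 < e" "e < min 1 \<delta>"
    have m0: "mollifier e x y \<ge> 0" for x y :: 'a using mollifier_nonneg[OF e(1)] .
    let ?h = "\<lambda>y. ennreal \<bar>U y - f y\<bar> * indicator B y"
    have "(\<integral>\<^sup>+x\<in>S. ennreal \<bar>mollify e U x - U x\<bar> \<partial>lborel)
      \<le> (\<integral>\<^sup>+x. (\<integral>\<^sup>+y. ?h y * ennreal (mollifier e x y) \<partial>lborel) + (ennreal \<omega> * indicator S x + ?h x) \<partial>lborel)"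
    proof (rule nn_integral_mono)
      fix x
      show "ennreal \<bar>mollify e U x - U x\<bar> * indicator S x
        \<le> (\<integral>\<^sup>+y. ?h y * ennreal (mollifier e x y) \<partial>lborel) + (ennreal \<omega> * indicator S x + ?h x)"
      proof (cases "x \<in> S")
        case True
        have xB: "x \<in> B" using True \<rho> by (auto simp: B_def)
        have i: "integrable lborel (\<lambda>y. mollifier e x y *\<^sub>R U y)" "integrable lborel (\<lambda>y. mollifier e x y * U x)"
          using mollify_integrable[OF e(1) U] mollifier_integrable[OF e(1)] by auto
        have "mollify e U x - U x = (LINT y|lborel. mollifier e x y *\<^sub>R U y - mollifier e x y * U x)"
          using i mollifier_integral[OF e(1), of x] unfolding mollify_def by simp
        then have "ennreal \<bar>mollify e U x - U x\<bar> \<le> (\<integral>\<^sup>+y. ennreal (norm (mollifier e x y *\<^sub>R U y - mollifier e x y * U x)) \<partial>lborel)"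
          using integral_norm_bound_ennreal[OF Bochner_Integration.integrable_diff[OF i]] by simp
        also have "\<dots> \<le> (\<integral>\<^sup>+y. ?h y * ennreal (mollifier e x y) + ennreal (\<omega> + \<bar>U x - f x\<bar>) * ennreal (mollifier e x y) \<partial>lborel)"
        proof (rule nn_integral_mono)
          fix y
          show "ennreal (norm (mollifier e x y *\<^sub>R U y - mollifier e x y * U x))
            \<le> ?h y * ennreal (mollifier e x y) + ennreal (\<omega> + \<bar>U x - f x\<bar>) * ennreal (mollifier e x y)"
          proof (cases "dist x y < e")
            case False
            then show ?thesis using mollifier_support[OF e(1), of x y] by simp
          next
            case d: True
            have "norm y \<le> norm x + dist x y" using norm_triangle_sub[of y x] by (simp add: dist_norm norm_minus_commute)
            then have yB: "y \<in> B" using True \<rho> d e by (auto simp: B_def subset_iff)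
            have "dist (f y) (f x) < \<omega>" using \<delta>(2)[OF xB yB] d e by (simp add: dist_commute)
            then have "\<bar>U y - U x\<bar> \<le> \<bar>U y - f y\<bar> + (\<omega> + \<bar>U x - f x\<bar>)" by (simp add: dist_real_def)
            then have "mollifier e x y * \<bar>U y - U x\<bar> \<le> mollifier e x y * (\<bar>U y - f y\<bar> + (\<omega> + \<bar>U x - f x\<bar>))"
              using m0 by (rule mult_left_mono)
            also have "mollifier e x y * \<bar>U y - U x\<bar> = norm (mollifier e x y *\<^sub>R U y - mollifier e x y * U x)"
              using m0[of x y] by (simp add: abs_mult flip: right_diff_distrib)
            finally show ?thesis
              using yB m0[of x y] \<omega> by (simp add: distrib_left mult.commute[of _ "mollifier e x y"] ennreal_leI flip: ennreal_mult' ennreal_plus)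
          qed
        qed
        also have "\<dots> = (\<integral>\<^sup>+y. ?h y * ennreal (mollifier e x y) \<partial>lborel) + ennreal (\<omega> + \<bar>U x - f x\<bar>)"
          by (subst nn_integral_add; simp add: nn_integral_cmult mollifier_nn_integral[OF e(1)])
        also have "ennreal (\<omega> + \<bar>U x - f x\<bar>) = ennreal \<omega> * indicator S x + ?h x"
          using True xB \<omega> by (simp add: ennreal_plus)
        finally show ?thesis using True by simp
      qed simp
    qed
    also have "\<dots> = (\<integral>\<^sup>+x. (\<integral>\<^sup>+y. ?h y * ennreal (mollifier e x y) \<partial>lborel) \<partial>lborel) + (ennreal \<omega> * emeasure lborel S + (\<integral>\<^sup>+x. ?h x \<partial>lborel))"
      by (subst nn_integral_add; (subst nn_integral_add)?; simp add: nn_integral_cmult_indicator)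
    also have "(\<integral>\<^sup>+x. (\<integral>\<^sup>+y. ?h y * ennreal (mollifier e x y) \<partial>lborel) \<partial>lborel)
      = (\<integral>\<^sup>+y. (\<integral>\<^sup>+x. ?h y * ennreal (mollifier e x y) \<partial>lborel) \<partial>lborel)"
      by (rule lborel_pair.Fubini') measurable
    also have "\<dots> = (\<integral>\<^sup>+y. ?h y \<partial>lborel)"
      by (intro nn_integral_cong) (simp add: nn_integral_cmult mollifier_nn_integral[OF e(1)])
    also have "(\<integral>\<^sup>+y. ?h y \<partial>lborel) + (ennreal \<omega> * emeasure lborel S + (\<integral>\<^sup>+x. ?h x \<partial>lborel))
      \<le> ennreal (\<eta> / 3) + (ennreal (\<eta> / 3) + ennreal (\<eta> / 3))"
    proof (intro add_mono)
      show "ennreal \<omega> * emeasure lborel S \<le> ennreal (\<eta> / 3)"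
        using \<omega> \<mu> by (simp add: ennreal_leI flip: ennreal_mult')
    qed (use f(2) in auto)
    also have "\<dots> = ennreal \<eta>" using \<eta> by (simp flip: ennreal_plus)
    finally show "(\<integral>\<^sup>+x\<in>S. ennreal \<bar>mollify e U x - U x\<bar> \<partial>lborel) \<le> ennreal \<eta>" .
  qed
qed

section \<open>Approximation of weakly differentiable functions\<close>

text \<open>\<open>u\<close> and \<open>g\<close> are cut off to \<open>K\<close> and mollified with
  radii below \<open>e0\<close>; since \<open>S\<close> keeps that margin inside \<open>K\<close>,
  the cut-off is not felt on \<open>S\<close>. A subsequence upgrades L1 convergence to convergence
  almost everywhere. \<open>D\<close> and \<open>d\<close> will be the distance functions of the
  dilated and of the original domain.\<close>

lemma smooth_approximation:
  fixes u :: "'a::euclidean_space \<Rightarrow> real" and g :: "'a \<Rightarrow> 'a"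
  assumes \<Omega>: "open \<Omega>" and u: "L1_loc \<Omega> u" and wg: "weak_gradient \<Omega> u g"
    and K: "compact K" "K \<subseteq> \<Omega>" and S: "S \<in> sets borel" "bounded S"
    and e0: "e0 > 0" "\<And>x. x \<in> S \<Longrightarrow> cball x e0 \<subseteq> K"
    and D: "D \<in> borel_measurable borel" "d \<in> borel_measurable borel"
    and Dd: "\<And>x y. x \<in> S \<Longrightarrow> dist x y < e0 \<Longrightarrow> 0 \<le> D x \<and> D x \<le> d y"
  obtains v :: "nat \<Rightarrow> 'a \<Rightarrow> real" and G :: "nat \<Rightarrow> 'a \<Rightarrow> 'a" where
    "\<And>n x. x \<in> S \<Longrightarrow> (v n has_derivative (\<lambda>h. h \<bullet> G n x)) (at x)"
    "\<And>n. continuous_on UNIV (v n)" "\<And>n. continuous_on UNIV (G n)"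
    "\<And>n. (\<integral>\<^sup>+x\<in>S. ennreal ((D x)\<^sup>2 * (norm (G n x))\<^sup>2) \<partial>lborel)
       \<le> (\<integral>\<^sup>+x\<in>\<Omega>. ennreal ((d x)\<^sup>2 * (norm (g x))\<^sup>2) \<partial>lebesgue)"
    "AE x in lborel. x \<in> S \<longrightarrow> (\<lambda>n. v n x) \<longlonglongrightarrow> u x"
proof -
  have [measurable]: "S \<in> sets borel" "D \<in> borel_measurable borel" "d \<in> borel_measurable borel"
    using S D by auto
  have uK: "u absolutely_integrable_on K" and gK: "g absolutely_integrable_on K"
    using u wg K unfolding weak_gradient_def L1_loc_def by blast+
  obtain U where U: "integrable lborel U" "AE y in lebesgue. U y = indicator K y *\<^sub>R u y"
    using absolutely_integrable_Borel_representative[OF uK] by blast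
  obtain H where H: "integrable lborel H" "AE y in lebesgue. H y = indicator K y *\<^sub>R g y"
    using absolutely_integrable_Borel_representative[OF gK] by blast
  have [measurable]: "U \<in> borel_measurable borel" "H \<in> borel_measurable borel" using U H by auto
  have "\<exists>e. 0 < e \<and> e < e0 \<and> (\<integral>\<^sup>+x\<in>S. ennreal \<bar>mollify e U x - U x\<bar> \<partial>lborel) \<le> ennreal (1 / Suc n)" for n :: nat
  proof -
    have "(1::real) / Suc n > 0" by simp
    from mollify_L1_convergence[OF U(1) S this] obtain e1 where "e1 > 0"
      "\<forall>e. 0 < e \<longrightarrow> e < e1 \<longrightarrow> (\<integral>\<^sup>+x\<in>S. ennreal \<bar>mollify e U x - U x\<bar> \<partial>lborel) \<le> ennreal (1 / Suc n)"
      by blast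
    then show ?thesis using e0(1) by (intro exI[of _ "min e0 e1 / 2"]) auto
  qed
  then obtain e where e: "\<And>n. 0 < e n" "\<And>n. e n < e0"
    "\<And>n. (\<integral>\<^sup>+x\<in>S. ennreal \<bar>mollify (e n) U x - U x\<bar> \<partial>lborel) \<le> ennreal (1 / Suc n)"
    by metis
  have mm [measurable]: "mollify (e n) U \<in> borel_measurable borel" for n
    using continuous_mollify[OF e(1) U(1)] by (rule borel_measurable_continuous_onI)
  define w where "w = (\<lambda>n x. indicator S x * (mollify (e n) U x - U x))"
  have wm [measurable]: "w n \<in> borel_measurable borel" for n unfolding w_def by measurable
  have wn: "(\<integral>\<^sup>+x. ennreal (norm (w n x)) \<partial>lborel) \<le> ennreal (1 / Suc n)" for n
  proof -
    have "(\<integral>\<^sup>+x. ennreal (norm (w n x)) \<partial>lborel) = (\<integral>\<^sup>+x\<in>S. ennreal \<bar>mollify (e n) U x - U x\<bar> \<partial>lborel)"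
      by (intro nn_integral_cong) (auto simp: w_def indicator_def)
    then show ?thesis using e(3) by simp
  qed
  have wi: "integrable lborel (w n)" for n
    using wn[of n] by (auto simp: integrable_iff_bounded intro: le_less_trans)
  have w0: "(\<lambda>n. LINT x|lborel. norm (w n x)) \<longlonglongrightarrow> 0"
  proof (rule tendsto_sandwich[OF _ _ tendsto_const LIMSEQ_inverse_real_of_nat])
    show "\<forall>\<^sub>F n in sequentially. (LINT x|lborel. norm (w n x)) \<le> inverse (real (Suc n))"
    proof (rule always_eventually, rule allI)
      fix n
      have "ennreal (LINT x|lborel. norm (w n x)) = (\<integral>\<^sup>+x. ennreal (norm (w n x)) \<partial>lborel)"
        using wi by (intro nn_integral_eq_integral[symmetric]) auto
      also have "\<dots> \<le> ennreal (inverse (Suc n))" using wn[of n] by (simp add: inverse_eq_divide)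
      finally show "(LINT x|lborel. norm (w n x)) \<le> inverse (real (Suc n))"
        by (subst (asm) ennreal_le_iff) auto
    qed
  qed auto
  obtain s where s: "strict_mono s" "AE x in lborel. (\<lambda>n. w (s n) x) \<longlonglongrightarrow> 0"
    using tendsto_L1_AE_subseq[OF wi w0] by auto
  have UuS: "AE x in lborel. U x = indicator K x *\<^sub>R u x" using U(2) by (simp add: AE_completion_iff)
  show ?thesis
  proof (rule that[of "\<lambda>n. mollify (e (s n)) U" "\<lambda>n. mollify (e (s n)) H"])
    show "(mollify (e (s n)) U has_derivative (\<lambda>h. h \<bullet> mollify (e (s n)) H x)) (at x)" if x: "x \<in> S" for n x
    proof (rule mollify_gradient[OF wg e(1) _ K(2) \<Omega> uK gK U H])
      show "cball x (e (s n)) \<subseteq> K" using e0(2)[OF x] e(2)[of "s n"] by auto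
    qed
    show "continuous_on UNIV (mollify (e (s n)) U)" "continuous_on UNIV (mollify (e (s n)) H)" for n
      by (intro continuous_mollify e U H)+
    show "(\<integral>\<^sup>+x\<in>S. ennreal ((D x)\<^sup>2 * (norm (mollify (e (s n)) H x))\<^sup>2) \<partial>lborel)
       \<le> (\<integral>\<^sup>+x\<in>\<Omega>. ennreal ((d x)\<^sup>2 * (norm (g x))\<^sup>2) \<partial>lebesgue)" for n
    proof -
      have "(\<integral>\<^sup>+x\<in>S. ennreal ((D x)\<^sup>2 * (norm (mollify (e (s n)) H x))\<^sup>2) \<partial>lborel)
        \<le> (\<integral>\<^sup>+y. ennreal ((d y)\<^sup>2 * (norm (H y))\<^sup>2) \<partial>lborel)"
      proof (rule mollify_energy[OF e(1) H(1) S(1) D])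
        show "0 \<le> D x \<and> D x \<le> d y" if "x \<in> S" "dist x y < e (s n)" for x y
          using Dd[OF that(1)] that(2) e(2)[of "s n"] by (meson less_trans)
      qed
      also have "\<dots> = (\<integral>\<^sup>+y. ennreal ((d y)\<^sup>2 * (norm (H y))\<^sup>2) \<partial>lebesgue)"
        by (simp add: nn_integral_completion)
      also have "\<dots> \<le> (\<integral>\<^sup>+x\<in>\<Omega>. ennreal ((d x)\<^sup>2 * (norm (g x))\<^sup>2) \<partial>lebesgue)"
        by (rule nn_integral_mono_AE) (use H(2) K(2) in \<open>auto elim!: eventually_mono simp: indicator_def\<close>)
      finally show ?thesis .
    qed
    show "AE x in lborel. x \<in> S \<longrightarrow> (\<lambda>n. mollify (e (s n)) U x) \<longlonglongrightarrow> u x"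
      using s(2) UuS
    proof eventually_elim
      case (elim x)
      show ?case
      proof
        assume x: "x \<in> S"
        then have "x \<in> K" using e0(2)[OF x] e0(1) by auto
        then have "U x = u x" using elim by simp
        then have "(\<lambda>n. (mollify (e (s n)) U x - u x) + u x) \<longlonglongrightarrow> 0 + u x"
          using elim(1) x by (intro tendsto_add tendsto_const) (simp add: w_def)
        then show "(\<lambda>n. mollify (e (s n)) U x) \<longlonglongrightarrow> u x" by simp
      qed
    qed
  qed
qed

text \<open>The constants \<open>c n\<close> are not controlled in advance. If |c n| tended to
  infinity, then (v n x - c n)^2 would do so almost everywhere on \<Omega>, against Fatou's lemma
  and E0 < \<infinity>. So a subsequence of the constants converges, and Fatou's lemma along it
  gives the bound.\<close>

lemma Fatou_mod_constants:
  fixes v :: "nat \<Rightarrow> 'a \<Rightarrow> real"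
  assumes v [measurable]: "\<And>n. (\<lambda>x. indicator (A n) x * (v n x - c n)) \<in> borel_measurable M"
    and \<Omega> [measurable]: "\<Omega> \<in> sets M" "emeasure M \<Omega> > 0"
    and lim: "AE x in M. x \<in> \<Omega> \<longrightarrow> (\<lambda>n. v n x) \<longlonglongrightarrow> u x \<and> eventually (\<lambda>n. x \<in> A n) sequentially"
    and bd: "\<And>n. (\<integral>\<^sup>+x\<in>A n. ennreal ((v n x - c n)\<^sup>2) \<partial>M) \<le> E n"
    and E: "E \<longlonglongrightarrow> E0" "E0 < \<infinity>"
  shows "\<exists>c. (\<integral>\<^sup>+x\<in>\<Omega>. ennreal ((u x - c)\<^sup>2) \<partial>M) \<le> E0"
proof -
  define f where "f = (\<lambda>n x. ennreal ((indicator (A n) x * (v n x - c n))\<^sup>2))"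
  have f [measurable]: "f n \<in> borel_measurable M" for n unfolding f_def by measurable
  have fE: "(\<integral>\<^sup>+x. f n x \<partial>M) \<le> E n" for n
  proof -
    have "(\<integral>\<^sup>+x. f n x \<partial>M) = (\<integral>\<^sup>+x\<in>A n. ennreal ((v n x - c n)\<^sup>2) \<partial>M)"
      by (intro nn_integral_cong) (auto simp: f_def indicator_def)
    then show ?thesis using bd by simp
  qed
  have Fatou: "(\<integral>\<^sup>+x. liminf (\<lambda>n. f (s n) x) \<partial>M) \<le> E0" if s: "strict_mono s" for s
  proof -
    have "(\<integral>\<^sup>+x. liminf (\<lambda>n. f (s n) x) \<partial>M) \<le> liminf (\<lambda>n. \<integral>\<^sup>+x. f (s n) x \<partial>M)"
      by (rule nn_integral_liminf) measurable
    also have "\<dots> \<le> liminf (\<lambda>n. E (s n))" by (rule Liminf_mono) (simp add: fE)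
    also have "\<dots> = E0"
      using LIMSEQ_subseq_LIMSEQ[OF E(1) s] by (intro lim_imp_Liminf) (auto simp: o_def)
    finally show ?thesis .
  qed
  have "\<not> filterlim (\<lambda>n. \<bar>c n\<bar>) at_top sequentially"
  proof
    assume c: "filterlim (\<lambda>n. \<bar>c n\<bar>) at_top sequentially"
    have "AE x in M. \<infinity> * indicator \<Omega> x \<le> liminf (\<lambda>n. f n x)"
      using lim
    proof eventually_elim
      case (elim x)
      show ?case
      proof (cases "x \<in> \<Omega>")
        case True
        then have vx: "(\<lambda>n. v n x) \<longlonglongrightarrow> u x" and ev: "eventually (\<lambda>n. x \<in> A n) sequentially"
          using elim by auto
        have "filterlim (\<lambda>n. - \<bar>v n x\<bar> + \<bar>c n\<bar>) at_top sequentially"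
          by (rule filterlim_tendsto_add_at_top[OF tendsto_minus[OF tendsto_rabs[OF vx]] c])
        then have "filterlim (\<lambda>n. (- \<bar>v n x\<bar> + \<bar>c n\<bar>) ^ 2) at_top sequentially"
          by (intro filterlim_pow_at_top) auto
        moreover have "eventually (\<lambda>n. (- \<bar>v n x\<bar> + \<bar>c n\<bar>) ^ 2 \<le> (v n x - c n)\<^sup>2) sequentially"
          by (rule always_eventually) (auto intro!: abs_le_square_iff[THEN iffD1])
        ultimately have "filterlim (\<lambda>n. (v n x - c n)\<^sup>2) at_top sequentially"
          by (rule filterlim_at_top_mono)
        then have "(\<lambda>n. ennreal ((v n x - c n)\<^sup>2)) \<longlonglongrightarrow> \<infinity>"
          by (simp add: ennreal_tendsto_top_eq_at_top)
        moreover have "eventually (\<lambda>n. ennreal ((v n x - c n)\<^sup>2) = f n x) sequentially"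
          using ev by eventually_elim (simp add: f_def)
        ultimately have "(\<lambda>n. f n x) \<longlonglongrightarrow> \<infinity>" by (rule Lim_transform_eventually)
        then show ?thesis using True by (simp add: lim_imp_Liminf)
      qed simp
    qed
    then have "(\<integral>\<^sup>+x. \<infinity> * indicator \<Omega> x \<partial>M) \<le> (\<integral>\<^sup>+x. liminf (\<lambda>n. f n x) \<partial>M)"
      by (rule nn_integral_mono_AE)
    also have "\<dots> \<le> E0" using Fatou[of id] by (simp add: strict_mono_def)
    finally have "\<infinity> * emeasure M \<Omega> \<le> E0" by (subst (asm) nn_integral_cmult_indicator) auto
    then show False using E(2) \<Omega>(2) by (auto simp: ennreal_top_mult top_unique split: if_splits)
  qed
  then obtain B where "\<not> eventually (\<lambda>n. B \<le> \<bar>c n\<bar>) sequentially"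
    unfolding filterlim_at_top by blast
  then have B: "\<exists>\<^sub>F n in sequentially. \<bar>c n\<bar> < B"
    by (simp add: not_eventually not_le)
  \<comment> \<open>Infinitely many constants lie below \<open>B\<close> in absolute value; their
    indices form the subsequence to which compactness is applied.\<close>
  define s where "s = enumerate {n. \<bar>c n\<bar> < B}"
  have inf: "infinite {n. \<bar>c n\<bar> < B}" using B by (simp add: frequently_cofinite cofinite_eq_sequentially[symmetric])
  have s: "strict_mono s" "\<And>n. \<bar>c (s n)\<bar> < B"
    using enumerate_in_set[OF inf] strict_mono_enumerate[OF inf] by (auto simp: s_def)
  have "\<forall>n. c (s n) \<in> cball 0 B" using s(2) by (auto simp: less_imp_le)
  then obtain c0 t where t: "strict_mono t" "((\<lambda>n. c (s n)) \<circ> t) \<longlonglongrightarrow> c0"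
    using compact_cball[of "0::real" B] unfolding compact_def by metis
  have st: "strict_mono (s \<circ> t)" using s t by (simp add: strict_mono_o)
  have "AE x in M. ennreal ((u x - c0)\<^sup>2) * indicator \<Omega> x \<le> liminf (\<lambda>n. f ((s \<circ> t) n) x)"
    using lim
  proof eventually_elim
    case (elim x)
    show ?case
    proof (cases "x \<in> \<Omega>")
      case True
      then have vx: "(\<lambda>n. v n x) \<longlonglongrightarrow> u x" and ev: "eventually (\<lambda>n. x \<in> A n) sequentially"
        using elim by auto
      have "(\<lambda>n. v ((s \<circ> t) n) x) \<longlonglongrightarrow> u x"
        using LIMSEQ_subseq_LIMSEQ[OF vx st] by (simp add: o_def)
      then have "(\<lambda>n. ennreal ((v ((s \<circ> t) n) x - c ((s \<circ> t) n))\<^sup>2)) \<longlonglongrightarrow> ennreal ((u x - c0)\<^sup>2)"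
        using t(2) by (intro tendsto_ennrealI tendsto_power tendsto_diff) (auto simp: o_def)
      moreover have "eventually (\<lambda>n. ennreal ((v ((s \<circ> t) n) x - c ((s \<circ> t) n))\<^sup>2) = f ((s \<circ> t) n) x) sequentially"
        using eventually_subseq[OF st ev] by eventually_elim (simp add: f_def)
      ultimately have "(\<lambda>n. f ((s \<circ> t) n) x) \<longlonglongrightarrow> ennreal ((u x - c0)\<^sup>2)" by (rule Lim_transform_eventually)
      then show ?thesis using True by (simp add: lim_imp_Liminf)
    qed simp
  qed
  then have "(\<integral>\<^sup>+x\<in>\<Omega>. ennreal ((u x - c0)\<^sup>2) \<partial>M) \<le> (\<integral>\<^sup>+x. liminf (\<lambda>n. f ((s \<circ> t) n) x) \<partial>M)"
    by (rule nn_integral_mono_AE)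
  also have "\<dots> \<le> E0" by (rule Fatou[OF st])
  finally show ?thesis by blast
qed

section \<open>Shrinking the domain\<close>

text \<open>A segment from \<open>x\<close> to a point outside \<open>S\<close> meets the frontier,
  hence is at least as long as the distance to it.\<close>

lemma ball_infdist_frontier_subset:
  fixes x :: "'a::euclidean_space"
  assumes "x \<in> S" shows "ball x (infdist x (frontier S)) \<subseteq> S"
proof
  fix p assume p: "p \<in> ball x (infdist x (frontier S))"
  show "p \<in> S"
  proof (rule ccontr)
    assume "p \<notin> S"
    then have "closed_segment x p \<inter> frontier S \<noteq> {}"
      using assms by (intro connected_Int_frontier) auto
    then obtain q where q: "q \<in> closed_segment x p" "q \<in> frontier S" by blast
    have "infdist x (frontier S) \<le> dist x q" using q(2) by (rule infdist_le)
    also have "\<dots> \<le> dist x p" using segment_bound(1)[OF q(1)] by (simp add: dist_norm norm_minus_commute)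
    finally show False using p by simp
  qed
qed

lemma emeasure_lborel_open_pos:
  fixes S :: "'a::euclidean_space set"
  assumes "open S" "S \<noteq> {}" shows "emeasure lborel S > 0"
  using open_not_negligible[OF assms] assms(1)
  by (simp add: negligible_iff_emeasure0 zero_less_iff_neq_zero)

lemma nn_integral_vec_chart:
  fixes F :: "real^2 \<Rightarrow> ennreal"
  assumes [measurable]: "F \<in> borel_measurable borel"
  shows "(\<integral>\<^sup>+z. F (a + vec_of_complex z) \<partial>lborel) = (\<integral>\<^sup>+x. F x \<partial>lborel)"
proof -
  have "(\<integral>\<^sup>+z. F (a + vec_of_complex z) \<partial>lborel) = (\<integral>\<^sup>+x. F (a + x) \<partial>lborel)"
    by (subst nn_integral_complex_of_vec) auto
  also have "\<dots> = (\<integral>\<^sup>+x. F x \<partial>distr lborel borel ((+) a))"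
    by (subst nn_integral_distr) auto
  finally show ?thesis by (simp add: lborel_distr_plus)
qed

text \<open>The isometric chart \<psi> carries \<open>improved_poincare_smooth\<close> over from the
  complex plane; the boundedness required there comes from continuity on the compact closure of
  \<open>S\<close>.\<close>

lemma improved_poincare_smooth_vec:
  fixes S :: "(real^2) set" and v :: "real^2 \<Rightarrow> real" and G :: "real^2 \<Rightarrow> real^2"
  assumes S: "open S" "r > 0" "star_shaped_wrt S (ball a r)" "S \<subseteq> ball a R"
    and dv: "\<And>x. x \<in> S \<Longrightarrow> (v has_derivative (\<lambda>h. h \<bullet> G x)) (at x)"
    and cv: "continuous_on UNIV v" "continuous_on UNIV G"
    and e: "e > 0"
  shows "\<exists>c. (\<integral>\<^sup>+x\<in>S. ennreal ((v x - c)\<^sup>2) \<partial>lborel)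
      \<le> ennreal (16 * (R / r + sqrt ((R / r)\<^sup>2 - 1))\<^sup>2)
          * (\<integral>\<^sup>+x\<in>S. ennreal ((infdist x (frontier S))\<^sup>2 * (norm (G x))\<^sup>2) \<partial>lborel) + ennreal e"
proof -
  define \<psi> where "\<psi> = (\<lambda>z. a + vec_of_complex z)"
  define \<phi> where "\<phi> = (\<lambda>x. complex_of_vec (x - a))"
  have inv [simp]: "\<phi> (\<psi> z) = z" "\<psi> (\<phi> x) = x" for z x by (simp_all add: \<phi>_def \<psi>_def)
  have c\<psi>: "continuous_on T \<psi>" and c\<phi>: "continuous_on U \<phi>" for T U
    unfolding \<psi>_def \<phi>_def
    by (intro continuous_intros continuous_on_vec_of_complex continuous_on_compose2[OF continuous_on_complex_of_vec[of UNIV]] | simp)+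
  have iso: "dist (\<psi> z) x = dist z (\<phi> x)" for z x
    by (metis (no_types) \<phi>_def \<psi>_def add_diff_cancel_left' add_diff_eq diff_add_cancel dist_norm inv(1) linear_diff linear_complex_of_vec norm_complex_of_vec)
  define \<Omega> where "\<Omega> = \<psi> -` S"
  have \<Omega>: "z \<in> \<Omega> \<longleftrightarrow> \<psi> z \<in> S" for z by (simp add: \<Omega>_def)
  interpret star_domain \<Omega> r R
  proof
    show "open \<Omega>" unfolding \<Omega>_def using S(1) c\<psi> by (simp add: open_vimage)
    show "r > 0" by fact
    have nb: "\<psi> z \<in> ball a s \<longleftrightarrow> z \<in> ball 0 s" for z s by (simp add: \<psi>_def dist_norm)
    show "ball 0 r \<subseteq> \<Omega>" using S(3) nb unfolding star_shaped_wrt_def \<Omega>_def by blast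
    show "\<Omega> \<subseteq> ball 0 R" using S(4) nb unfolding \<Omega>_def by blast
    fix x y :: complex assume xy: "x \<in> \<Omega>" "y \<in> ball 0 r"
    show "closed_segment x y \<subseteq> \<Omega>"
    proof
      fix z assume "z \<in> closed_segment x y"
      then obtain t where t: "0 \<le> t" "t \<le> 1" "z = (1 - t) *\<^sub>R x + t *\<^sub>R y" by (auto simp: in_segment)
      have "\<psi> z = (1 - t) *\<^sub>R \<psi> x + t *\<^sub>R \<psi> y"
        by (simp add: \<psi>_def t(3) linear_add[OF linear_vec_of_complex] linear_diff[OF linear_vec_of_complex] linear_scale[OF linear_vec_of_complex] algebra_simps)
      then have "\<psi> z \<in> closed_segment (\<psi> x) (\<psi> y)" using t by (auto simp: in_segment)
      then show "z \<in> \<Omega>" using S(3) xy nb[of y r] unfolding star_shaped_wrt_def \<Omega>_def by blast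
    qed
  qed
  have S0: "S \<noteq> {}" using S(2,3) by (auto simp: star_shaped_wrt_def)
  have "bounded S" using S(4) bounded_ball bounded_subset by blast
  then have fne: "frontier S \<noteq> {}" using S0 not_bounded_UNIV by (auto simp: frontier_eq_empty)
  \<comment> \<open>One inequality suffices, because the distance stands on the larger side: \<phi>
    maps a nearest frontier point of \<open>S\<close> to a frontier point of \<Omega>.\<close>
  have fr: "infdist z (frontier \<Omega>) \<le> infdist (\<psi> z) (frontier S)" for z
  proof -
    obtain q where q: "q \<in> frontier S" "infdist (\<psi> z) (frontier S) = dist (\<psi> z) q"
      using infdist_attains_inf[OF frontier_closed fne] by metis
    have "\<phi> ` S = \<Omega>" by (auto simp: \<Omega> image_iff) (metis inv(1))
    then have "\<phi> q \<in> closure \<Omega>"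
      using continuous_image_closure_subset[OF c\<phi>[of UNIV], of S] q(1) by (auto simp: frontier_def)
    moreover have "\<phi> q \<notin> \<Omega>" using q(1) S(1) by (simp add: \<Omega> frontier_def interior_open)
    ultimately have "\<phi> q \<in> frontier \<Omega>" using open_\<Omega> by (simp add: frontier_def interior_open)
    then show ?thesis unfolding q(2) iso by (rule infdist_le)
  qed
  define G' where "G' = (\<lambda>z. complex_of_vec (G (\<psi> z)))"
  have du: "((\<lambda>z. v (\<psi> z)) has_derivative (\<lambda>h. h \<bullet> G' z)) (at z)" if "z \<in> \<Omega>" for z
  proof -
    have "(\<psi> has_derivative vec_of_complex) (at z)"
      unfolding \<psi>_def
      by (auto intro!: derivative_eq_intros bounded_linear_imp_has_derivative bounded_linear_vec_of_complex)
    from has_derivative_compose[OF this dv] show ?thesis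
      using that inner_complex_of_vec[of "vec_of_complex _"] by (simp add: \<Omega> G'_def)
  qed
  have cG: "continuous_on \<Omega> G'"
    unfolding G'_def
    by (intro continuous_on_compose2[OF continuous_on_complex_of_vec[of UNIV]] continuous_on_compose2[OF cv(2) c\<psi>]) auto
  obtain B where "\<And>x. x \<in> closure S \<Longrightarrow> norm (v x) \<le> B"
  proof -
    have "compact (v ` closure S)"
      using \<open>bounded S\<close> cv(1) by (intro compact_continuous_image) (auto intro: continuous_on_subset)
    then show ?thesis using that by (meson bounded_iff compact_imp_bounded image_eqI)
  qed
  then have bd: "\<bar>v (\<psi> z)\<bar> \<le> B" if "z \<in> \<Omega>" for z using that closure_subset by (fastforce simp: \<Omega>)
  obtain c where c: "(\<integral>\<^sup>+z\<in>\<Omega>. ennreal ((v (\<psi> z) - c)\<^sup>2) \<partial>lborel)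
      \<le> ennreal (16 * friedrichs_const) * (\<integral>\<^sup>+z\<in>\<Omega>. ennreal ((infdist z (frontier \<Omega>))\<^sup>2 * (norm (G' z))\<^sup>2) \<partial>lborel) + ennreal e"
    using improved_poincare_smooth[OF du cG bd e] by blast
  have [measurable]: "S \<in> sets borel" "v \<in> borel_measurable borel" "G \<in> borel_measurable borel"
    "(\<lambda>x. infdist x (frontier S)) \<in> borel_measurable borel"
    using S(1) cv by (auto intro!: borel_measurable_continuous_onI continuous_intros)
  define F where "F = (\<lambda>x. ennreal ((infdist x (frontier S))\<^sup>2 * (norm (G x))\<^sup>2) * indicator S x)"
  have "(\<integral>\<^sup>+x\<in>S. ennreal ((v x - c)\<^sup>2) \<partial>lborel) = (\<integral>\<^sup>+z\<in>\<Omega>. ennreal ((v (\<psi> z) - c)\<^sup>2) \<partial>lborel)"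
    by (subst nn_integral_vec_chart[of _ a, symmetric]) (simp_all add: \<psi>_def[symmetric, THEN fun_cong] \<Omega> indicator_def)
  moreover have "(\<integral>\<^sup>+z\<in>\<Omega>. ennreal ((infdist z (frontier \<Omega>))\<^sup>2 * (norm (G' z))\<^sup>2) \<partial>lborel) \<le> (\<integral>\<^sup>+z. F (\<psi> z) \<partial>lborel)"
    by (intro nn_integral_mono)
      (auto simp: F_def \<Omega> G'_def indicator_def infdist_nonneg intro!: ennreal_leI mult_right_mono power_mono fr)
  moreover have "(\<integral>\<^sup>+z. F (\<psi> z) \<partial>lborel) = (\<integral>\<^sup>+x. F x \<partial>lborel)"
    unfolding \<psi>_def by (rule nn_integral_vec_chart) (simp add: F_def)
  ultimately have "(\<integral>\<^sup>+x\<in>S. ennreal ((v x - c)\<^sup>2) \<partial>lborel) \<le> ennreal (16 * friedrichs_const) * (\<integral>\<^sup>+x. F x \<partial>lborel) + ennreal e"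
    by (auto intro!: order_trans[OF c] add_right_mono mult_left_mono)
  then show ?thesis unfolding friedrichs_const_def F_def by blast
qed

section \<open>Dilations of a star-shaped domain\<close>

text \<open>For t > 0 this is the image of \<open>S\<close> under x \<mapsto> a + t (x - a), written
  as a preimage so that openness and membership are immediate.\<close>

definition dilation :: "'a::real_vector \<Rightarrow> real \<Rightarrow> 'a set \<Rightarrow> 'a set" where
  "dilation a t S = {x. a + (1 / t) *\<^sub>R (x - a) \<in> S}"

lemma open_dilation:
  fixes S :: "'a::real_normed_vector set"
  assumes "open S" shows "open (dilation a t S)"
proof -
  have "open ((\<lambda>x. a + (1 / t) *\<^sub>R (x - a)) -` S)"
    by (intro open_vimage assms continuous_intros)
  then show ?thesis by (simp add: dilation_def vimage_def)
qed

lemma dilation_ball: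
  fixes a :: "'a::real_normed_vector"
  assumes "t > 0" shows "dilation a t (ball a s) = ball a (t * s)"
proof -
  have "dist a (a + (1 / t) *\<^sub>R (x - a)) = dist a x / t" for x
    using assms by (simp add: dist_norm norm_minus_commute)
  then have "dilation a t (ball a s) = {x. dist a x / t < s}" by (simp add: dilation_def)
  then show ?thesis using assms by (auto simp: field_simps)
qed

lemma dilation_mono: "S \<subseteq> T \<Longrightarrow> dilation a t S \<subseteq> dilation a t T"
  by (auto simp: dilation_def)

lemma star_shaped_wrt_dilation:
  assumes "star_shaped_wrt S B" shows "star_shaped_wrt (dilation a t S) (dilation a t B)"
  unfolding star_shaped_wrt_def
proof (intro conjI ballI subsetI)
  show "x \<in> dilation a t S" if "x \<in> dilation a t B" for x
    using assms that by (auto simp: star_shaped_wrt_def dilation_def)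
  fix x y z assume x: "x \<in> dilation a t S" and y: "y \<in> dilation a t B" and "z \<in> closed_segment x y"
  then obtain s where s: "0 \<le> s" "s \<le> 1" "z = (1 - s) *\<^sub>R x + s *\<^sub>R y" by (auto simp: in_segment)
  let ?p = "\<lambda>x. a + (1 / t) *\<^sub>R (x - a)"
  have "a + w *\<^sub>R (z - a) = (1 - s) *\<^sub>R (a + w *\<^sub>R (x - a)) + s *\<^sub>R (a + w *\<^sub>R (y - a))" for w
    unfolding s(3) by (simp add: algebra_simps)
  then have "?p z \<in> closed_segment (?p x) (?p y)" unfolding in_segment using s(1,2) by blast
  then show "z \<in> dilation a t S" using assms x y unfolding star_shaped_wrt_def dilation_def by blast
qed

text \<open>x + b is the convex combination t x' + (1 - t) y of a point x' of \<open>S\<close> and a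
  point y of the disc. The dilated domain thus keeps distance (1 - t) r from the complement of
  \<open>S\<close>.\<close>

lemma star_shaped_dilation_margin:
  fixes S :: "'a::euclidean_space set"
  assumes S: "star_shaped_wrt S (ball a r)" and t: "0 < t" "t < 1"
    and x: "x \<in> dilation a t S" and b: "norm b < (1 - t) * r"
  shows "x + b \<in> S"
proof -
  define y where "y = a + (1 / (1 - t)) *\<^sub>R b"
  define x' where "x' = a + (1 / t) *\<^sub>R (x - a)"
  have "y \<in> ball a r" using b t by (simp add: y_def dist_norm field_simps)
  moreover have "x' \<in> S" using x by (simp add: dilation_def x'_def)
  moreover have "x + b = t *\<^sub>R x' + (1 - t) *\<^sub>R y"
    using t by (simp add: x'_def y_def scaleR_add_right) (simp add: algebra_simps)
  then have "x + b \<in> closed_segment x' y"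
    unfolding in_segment using t by (intro exI[of _ "1 - t"]) auto
  ultimately show ?thesis using S unfolding star_shaped_wrt_def by blast
qed

text \<open>Let q be the frontier point of \<open>S\<close> nearest to y. If |q - y| were below the
  distance from x to the frontier of the dilated domain, then x + (q - y) would still lie in that
  domain, and the margin, which exceeds |y - x|, would put q into the open set
  \<open>S\<close>.\<close>

lemma infdist_frontier_dilation_le:
  fixes S :: "'a::euclidean_space set"
  assumes S: "open S" "frontier S \<noteq> {}" "star_shaped_wrt S (ball a r)" and t: "0 < t" "t < 1"
    and x: "x \<in> dilation a t S" and y: "dist x y < (1 - t) * r"
  shows "infdist x (frontier (dilation a t S)) \<le> infdist y (frontier S)"
proof -
  obtain q where q: "q \<in> frontier S" "infdist y (frontier S) = dist y q"
    using infdist_attains_inf[OF frontier_closed S(2)] by metis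
  have "q \<notin> S" using q(1) S(1) by (simp add: frontier_def interior_open)
  have "\<not> dist y q < infdist x (frontier (dilation a t S))"
  proof
    assume "dist y q < infdist x (frontier (dilation a t S))"
    then have "x + (q - y) \<in> ball x (infdist x (frontier (dilation a t S)))"
      by (simp add: dist_norm norm_minus_commute)
    then have "x + (q - y) \<in> dilation a t S" using ball_infdist_frontier_subset[OF x] by blast
    from star_shaped_dilation_margin[OF S(3) t this, of "y - x"] y have "q \<in> S"
      by (simp add: dist_norm norm_minus_commute)
    with \<open>q \<notin> S\<close> show False ..
  qed
  then show ?thesis by (simp add: q(2))
qed

lemma compact_thickened_dilation:
  fixes S :: "'a::euclidean_space set"
  assumes S: "star_shaped_wrt S (ball a r)" "bounded S" and t: "0 < t" "t < 1" and r: "r > 0"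
  obtains K where "compact K" "K \<subseteq> S"
    "\<And>x. x \<in> dilation a t S \<Longrightarrow> cball x ((1 - t) * r / 2) \<subseteq> K"
proof -
  \<comment> \<open>Half of the available margin; the other half absorbs the passage to the
    closure.\<close>
  let ?e = "(1 - t) * r / 2"
  define K where "K = {x + y |x y. x \<in> closure (dilation a t S) \<and> y \<in> cball 0 ?e}"
  have e: "?e > 0" using t r by simp
  have "bounded (dilation a t S)"
  proof -
    obtain s where "S \<subseteq> ball a s" using S(2) bounded_subset_ballD by blast
    then have "dilation a t S \<subseteq> ball a (t * s)" using dilation_mono dilation_ball[OF t(1)] by metis
    then show ?thesis using bounded_ball bounded_subset by blast
  qed
  then have "compact K" unfolding K_def by (intro compact_sums) auto
  moreover have "K \<subseteq> S"
  proof
    fix z assume "z \<in> K"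
    then obtain x y where xy: "z = x + y" "x \<in> closure (dilation a t S)" "norm y \<le> ?e"
      by (auto simp: K_def)
    then obtain s where s: "s \<in> dilation a t S" "dist s x < ?e"
      using e closure_approachable by blast
    have "norm (x - s + y) \<le> norm (x - s) + norm y" by (rule norm_triangle_ineq)
    also have "\<dots> < (1 - t) * r" using s(2) xy(3) by (simp add: dist_norm norm_minus_commute)
    finally have "s + (x - s + y) \<in> S" by (rule star_shaped_dilation_margin[OF S(1) t s(1)])
    then show "z \<in> S" by (simp add: xy(1))
  qed
  moreover have "cball x ?e \<subseteq> K" if "x \<in> dilation a t S" for x
  proof
    fix p assume "p \<in> cball x ?e"
    then have "p = x + (p - x)" "p - x \<in> cball 0 ?e" by (simp_all add: dist_norm norm_minus_commute)
    then show "p \<in> K" using that closure_subset unfolding K_def by blast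
  qed
  ultimately show ?thesis by (rule that)
qed

text \<open>Dilation multiplies r and R by the same factor, so the constant is unchanged.
  Mollifications are smooth on the dilated domain, their weighted energy is bounded by that of
  \<open>g\<close> through \<open>infdist_frontier_dilation_le\<close>, and
  \<open>Fatou_mod_constants\<close> passes to the limit.\<close>

lemma improved_poincare_dilation:
  fixes \<Omega> :: "(real^2) set"
  assumes \<Omega>: "open \<Omega>" "r > 0" "star_shaped_wrt \<Omega> (ball a r)" "\<Omega> \<subseteq> ball a R"
    and u: "L1_loc \<Omega> u" "weak_gradient \<Omega> u g"
    and fin: "(\<integral>\<^sup>+x\<in>\<Omega>. ennreal ((boundary_dist \<Omega> x)\<^sup>2 * (norm (g x))\<^sup>2) \<partial>lebesgue) < \<infinity>" (is "?E < \<infinity>")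
    and t: "0 < t" "t < 1"
  shows "\<exists>c. (\<integral>\<^sup>+x\<in>dilation a t \<Omega>. ennreal ((u x - c)\<^sup>2) \<partial>lebesgue)
    \<le> ennreal (16 * (R / r + sqrt ((R / r)\<^sup>2 - 1))\<^sup>2) * ?E"
proof -
  define S where "S = dilation a t \<Omega>"
  define P where "P = 16 * (R / r + sqrt ((R / r)\<^sup>2 - 1))\<^sup>2"
  have bd: "bounded \<Omega>" using \<Omega>(4) bounded_ball bounded_subset by blast
  have fr: "frontier \<Omega> \<noteq> {}"
    using \<Omega>(2,3) bd not_bounded_UNIV by (auto simp: frontier_eq_empty star_shaped_wrt_def)
  have S: "open S" "t * r > 0" "star_shaped_wrt S (ball a (t * r))" "S \<subseteq> ball a (t * R)"
    using open_dilation[OF \<Omega>(1)] \<Omega>(2) t star_shaped_wrt_dilation[OF \<Omega>(3), of a t] dilation_mono[OF \<Omega>(4), of a t]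
    by (simp_all add: S_def dilation_ball)
  have [measurable]: "S \<in> sets borel" using S(1) by simp
  obtain K where K: "compact K" "K \<subseteq> \<Omega>" "\<And>x. x \<in> S \<Longrightarrow> cball x ((1 - t) * r / 2) \<subseteq> K"
    by (rule compact_thickened_dilation[OF \<Omega>(3) bd t \<Omega>(2), folded S_def]) (rule that)
  have e0: "(1 - t) * r / 2 > 0" using t \<Omega>(2) by simp
  obtain v G where v: "\<And>n x. x \<in> S \<Longrightarrow> (v n has_derivative (\<lambda>h. h \<bullet> G n x)) (at x)"
    "\<And>n::nat. continuous_on UNIV (v n)" "\<And>n. continuous_on UNIV (G n)"
    and vE: "\<And>n. (\<integral>\<^sup>+x\<in>S. ennreal ((infdist x (frontier S))\<^sup>2 * (norm (G n x))\<^sup>2) \<partial>lborel) \<le> ?E"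
    and vu: "AE x in lborel. x \<in> S \<longrightarrow> (\<lambda>n. v n x) \<longlonglongrightarrow> u x"
  proof (rule smooth_approximation[OF \<Omega>(1) u K(1,2) _ _ e0 K(3), where D = "\<lambda>x. infdist x (frontier S)" and d = "boundary_dist \<Omega>"])
    show "S \<in> sets borel" by simp
    show "bounded S" using S(4) bounded_ball bounded_subset by blast
    show "(\<lambda>x. infdist x (frontier S)) \<in> borel_measurable borel" "boundary_dist \<Omega> \<in> borel_measurable borel"
      unfolding boundary_dist_def by (intro borel_measurable_continuous_onI continuous_intros)+
    fix x y assume "x \<in> S" "dist x y < (1 - t) * r / 2"
    then show "0 \<le> infdist x (frontier S) \<and> infdist x (frontier S) \<le> boundary_dist \<Omega> y"
      using infdist_frontier_dilation_le[OF \<Omega>(1) fr \<Omega>(3) t, of x y] e0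
      by (simp add: S_def boundary_dist_def infdist_nonneg)
  qed (assumption, rule that)
  have rat: "(t * R) / (t * r) = R / r" using t by simp
  have "\<exists>c. (\<integral>\<^sup>+x\<in>S. ennreal ((v n x - c)\<^sup>2) \<partial>lborel) \<le> ennreal P * ?E + ennreal (1 / Suc n)" for n
  proof -
    have "1 / real (Suc n) > 0" by simp
    from improved_poincare_smooth_vec[OF S v(1) v(2) v(3) this, of n, unfolded rat, folded P_def]
    obtain c where "(\<integral>\<^sup>+x\<in>S. ennreal ((v n x - c)\<^sup>2) \<partial>lborel)
      \<le> ennreal P * (\<integral>\<^sup>+x\<in>S. ennreal ((infdist x (frontier S))\<^sup>2 * (norm (G n x))\<^sup>2) \<partial>lborel) + ennreal (1 / Suc n)" by blast
    also have "\<dots> \<le> ennreal P * ?E + ennreal (1 / Suc n)" by (intro add_right_mono mult_left_mono vE) simp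
    finally show ?thesis by blast
  qed
  then have "\<exists>c. \<forall>n. (\<integral>\<^sup>+x\<in>S. ennreal ((v n x - c n)\<^sup>2) \<partial>lborel) \<le> ennreal P * ?E + ennreal (1 / Suc n)"
    by (intro choice allI)
  then obtain c where c: "\<And>n. (\<integral>\<^sup>+x\<in>S. ennreal ((v n x - c n)\<^sup>2) \<partial>lborel) \<le> ennreal P * ?E + ennreal (1 / Suc n)"
    by blast
  have "\<exists>c. (\<integral>\<^sup>+x\<in>S. ennreal ((u x - c)\<^sup>2) \<partial>lborel) \<le> ennreal P * ?E"
  proof (rule Fatou_mod_constants[where A = "\<lambda>_. S" and v = v and c = c])
    have [measurable]: "v n \<in> borel_measurable borel" for n using v(2) by (rule borel_measurable_continuous_onI)
    show "(\<lambda>x. indicator S x * (v n x - c n)) \<in> borel_measurable lborel" for n by measurable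
    show "S \<in> sets lborel" by simp
    show "emeasure lborel S > 0"
      using S by (intro emeasure_lborel_open_pos) (auto simp: star_shaped_wrt_def)
    show "AE x in lborel. x \<in> S \<longrightarrow> (\<lambda>n. v n x) \<longlonglongrightarrow> u x \<and> (\<forall>\<^sub>F n in sequentially. x \<in> S)"
      using vu by eventually_elim simp
    show "(\<integral>\<^sup>+x\<in>S. ennreal ((v n x - c n)\<^sup>2) \<partial>lborel) \<le> ennreal P * ?E + ennreal (1 / Suc n)" for n by (rule c)
    have "(\<lambda>n. ennreal P * ?E + ennreal (1 / Suc n)) \<longlonglongrightarrow> ennreal P * ?E + ennreal 0"
      using LIMSEQ_inverse_real_of_nat by (intro tendsto_add tendsto_const tendsto_ennrealI) (simp add: inverse_eq_divide)
    then show "(\<lambda>n. ennreal P * ?E + ennreal (1 / Suc n)) \<longlonglongrightarrow> ennreal P * ?E" by simp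
    show "ennreal P * ?E < \<infinity>" using fin by (simp add: ennreal_mult_less_top)
  qed
  then show ?thesis by (simp add: S_def P_def nn_integral_completion)
qed

text \<open>The mean minimises the mean square distance to constants. Square integrability of w = u
  - c on a set of finite measure makes \<open>u\<close> integrable there, so
  \<open>integral_mean\<close> is a genuine mean; then (w - J/V)^2 has the integral of w^2 minus J^2
  / V.\<close>

lemma nn_integral_mean_le:
  fixes u :: "'a::euclidean_space \<Rightarrow> real"
  assumes \<Omega> [measurable]: "\<Omega> \<in> sets lebesgue" and fin: "emeasure lebesgue \<Omega> < \<infinity>" "emeasure lebesgue \<Omega> > 0"
    and um [measurable]: "(\<lambda>x. indicator \<Omega> x * u x) \<in> borel_measurable lebesgue"
    and sq: "(\<integral>\<^sup>+x\<in>\<Omega>. ennreal ((u x - c)\<^sup>2) \<partial>lebesgue) < \<infinity>"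
  shows "(\<integral>\<^sup>+x\<in>\<Omega>. ennreal ((u x - integral_mean \<Omega> u)\<^sup>2) \<partial>lebesgue)
    \<le> (\<integral>\<^sup>+x\<in>\<Omega>. ennreal ((u x - c)\<^sup>2) \<partial>lebesgue)"
proof -
  define w where "w = (\<lambda>x. indicator \<Omega> x * u x - c * indicator \<Omega> x)"
  define V where "V = measure lebesgue \<Omega>"
  have V: "V > 0" using fin by (simp add: V_def measure_def enn2real_positive_iff)
  have wm [measurable]: "w \<in> borel_measurable lebesgue" unfolding w_def by measurable
  have wi: "w x = indicator \<Omega> x * (u x - c)" for x by (simp add: w_def indicator_def)
  have I1: "integrable lebesgue (indicator \<Omega> :: 'a \<Rightarrow> real)" using \<Omega> fin by (simp add: integrable_indicator_iff)
  have w2: "integrable lebesgue (\<lambda>x. (w x)\<^sup>2)"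
  proof (rule integrableI_bounded)
    have "(\<integral>\<^sup>+x. ennreal (norm ((w x)\<^sup>2)) \<partial>lebesgue) = (\<integral>\<^sup>+x\<in>\<Omega>. ennreal ((u x - c)\<^sup>2) \<partial>lebesgue)"
      by (intro nn_integral_cong) (auto simp: wi indicator_def)
    then show "(\<integral>\<^sup>+x. ennreal (norm ((w x)\<^sup>2)) \<partial>lebesgue) < \<infinity>" using sq by simp
  qed simp
  have w1: "integrable lebesgue w"
  proof (rule Bochner_Integration.integrable_bound[OF Bochner_Integration.integrable_add[OF I1 w2] wm])
    have "\<bar>y\<bar> \<le> 1 + y\<^sup>2" for y :: real
      using power2_sum[of "\<bar>y\<bar>" "-1"] zero_le_power2[of "\<bar>y\<bar> - 1"] by (simp add: power2_eq_square algebra_simps)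
    then show "AE x in lebesgue. norm (w x) \<le> norm (indicator \<Omega> x + (w x)\<^sup>2)"
      by (intro AE_I2) (auto simp: wi indicator_def)
  qed
  define J where "J = (LINT x|lebesgue. w x)"
  have mean: "integral_mean \<Omega> u = c + J / V"
  proof -
    have "(LINT x:\<Omega>|lebesgue. u x) = (LINT x|lebesgue. w x + c * indicator \<Omega> x)"
      unfolding set_lebesgue_integral_def by (intro Bochner_Integration.integral_cong) (auto simp: w_def)
    also have "\<dots> = J + c * V" using w1 I1 by (simp add: J_def V_def)
    finally show ?thesis using V by (simp add: integral_mean_def V_def field_simps)
  qed
  define t where "t = J / V"
  have int: "integrable lebesgue (\<lambda>x. (w x)\<^sup>2 - 2 * t * w x + t\<^sup>2 * indicator \<Omega> x)"
    using w1 w2 I1 by simp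
  have pt: "(w x)\<^sup>2 - 2 * t * w x + t\<^sup>2 * indicator \<Omega> x = indicator \<Omega> x * (u x - integral_mean \<Omega> u)\<^sup>2" for x
    unfolding mean t_def[symmetric] by (auto simp: wi indicator_def power2_eq_square algebra_simps)
  have "(\<integral>\<^sup>+x\<in>\<Omega>. ennreal ((u x - integral_mean \<Omega> u)\<^sup>2) \<partial>lebesgue)
      = (\<integral>\<^sup>+x. ennreal ((w x)\<^sup>2 - 2 * t * w x + t\<^sup>2 * indicator \<Omega> x) \<partial>lebesgue)"
    unfolding pt by (intro nn_integral_cong) (auto simp: indicator_def)
  also have "\<dots> = ennreal (LINT x|lebesgue. (w x)\<^sup>2 - 2 * t * w x + t\<^sup>2 * indicator \<Omega> x)"
    by (rule nn_integral_eq_integral[OF int]) (simp add: pt)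
  also have "(LINT x|lebesgue. (w x)\<^sup>2 - 2 * t * w x + t\<^sup>2 * indicator \<Omega> x) = (LINT x|lebesgue. (w x)\<^sup>2) - t * J"
  proof -
    have "t\<^sup>2 * V = t * J" using V by (simp add: t_def power2_eq_square)
    then show ?thesis using w1 w2 I1 by (simp add: J_def V_def)
  qed
  also have "ennreal ((LINT x|lebesgue. (w x)\<^sup>2) - t * J) \<le> ennreal (LINT x|lebesgue. (w x)\<^sup>2)"
    using V by (intro ennreal_leI) (simp add: t_def)
  also have "\<dots> = (\<integral>\<^sup>+x. ennreal ((w x)\<^sup>2) \<partial>lebesgue)"
    by (rule nn_integral_eq_integral[symmetric, OF w2]) simp
  also have "\<dots> = (\<integral>\<^sup>+x\<in>\<Omega>. ennreal ((u x - c)\<^sup>2) \<partial>lebesgue)"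
    by (intro nn_integral_cong) (auto simp: wi indicator_def)
  finally show ?thesis .
qed

text \<open>Dilations with factors tending to 1 exhaust \<Omega> with one and the same bound.
  \<open>Fatou_mod_constants\<close> is used again, now with a fixed function and varying domains,
  and the mean finally replaces the limit constant.\<close>

lemma improved_poincare_ineq_star_shaped:
  fixes \<Omega> :: "(real^2) set"
  assumes \<Omega>: "open \<Omega>" "r > 0" "star_shaped_wrt \<Omega> (ball a r)" "\<Omega> \<subseteq> ball a R"
  shows "improved_poincare_ineq \<Omega> (16 * (R / r + sqrt ((R / r)\<^sup>2 - 1))\<^sup>2)"
  unfolding improved_poincare_ineq_def
proof (intro allI impI, elim conjE)
  fix u g
  assume u: "L1_loc \<Omega> u" "weak_gradient \<Omega> u g"
    and "L2_norm_sq \<Omega> (\<lambda>x. boundary_dist \<Omega> x *\<^sub>R g x) < \<infinity>"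
  define P where "P = 16 * (R / r + sqrt ((R / r)\<^sup>2 - 1))\<^sup>2"
  define E where "E = (\<integral>\<^sup>+x\<in>\<Omega>. ennreal ((boundary_dist \<Omega> x)\<^sup>2 * (norm (g x))\<^sup>2) \<partial>lebesgue)"
  have E: "L2_norm_sq \<Omega> (\<lambda>x. boundary_dist \<Omega> x *\<^sub>R g x) = E"
    by (simp add: L2_norm_sq_def E_def power_mult_distrib)
  with \<open>L2_norm_sq \<Omega> _ < \<infinity>\<close> have fin: "E < \<infinity>" by simp
  have bd: "bounded \<Omega>" using \<Omega>(4) bounded_ball bounded_subset by blast
  have [measurable]: "\<Omega> \<in> sets borel" using \<Omega>(1) by simp
  have pos: "emeasure lebesgue \<Omega> > 0"
    using \<Omega> by (subst emeasure_completion) (auto intro!: emeasure_lborel_open_pos simp: star_shaped_wrt_def)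
  have finite: "emeasure lebesgue \<Omega> < \<infinity>" using emeasure_bounded_finite[OF bd] by simp
  \<comment> \<open>The summand 2 keeps the factor positive at n = 0, where it is 1/2.\<close>
  define t where "t = (\<lambda>n::nat. 1 - 1 / (real n + 2))"
  have t: "0 < t n" "t n < 1" for n by (auto simp: t_def field_simps)
  define A where "A n = dilation a (t n) \<Omega>" for n
  have [measurable]: "A n \<in> sets borel" for n using open_dilation[OF \<Omega>(1)] by (simp add: A_def)
  obtain K where K: "\<And>n. compact (K n)" "\<And>n. K n \<subseteq> \<Omega>" "\<And>n. A n \<subseteq> K n"
  proof -
    have "\<exists>K. compact K \<and> K \<subseteq> \<Omega> \<and> A n \<subseteq> K" for n
    proof -
      obtain K where "compact K" "K \<subseteq> \<Omega>" and K: "\<And>x. x \<in> A n \<Longrightarrow> cball x ((1 - t n) * r / 2) \<subseteq> K"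
        by (rule compact_thickened_dilation[OF \<Omega>(3) bd t(1)[of n] t(2)[of n] \<Omega>(2), folded A_def]) (rule that)
      moreover have "A n \<subseteq> K"
      proof
        fix x assume "x \<in> A n"
        then have "cball x ((1 - t n) * r / 2) \<subseteq> K" by (rule K)
        moreover have "x \<in> cball x ((1 - t n) * r / 2)" using t(2)[of n] \<Omega>(2) by simp
        ultimately show "x \<in> K" by blast
      qed
      ultimately show ?thesis by blast
    qed
    then show ?thesis using that by metis
  qed
  have Am [measurable]: "(\<lambda>x. indicator (A n) x * u x) \<in> borel_measurable lebesgue" for n
  proof -
    have "u absolutely_integrable_on K n" using u(1) K unfolding L1_loc_def by blast
    then have "(\<lambda>x. indicator (K n) x * u x) \<in> borel_measurable lebesgue" (is "?w \<in> _")
      unfolding set_integrable_def by (auto dest: borel_measurable_integrable)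
    then have "(\<lambda>x. indicator (A n) x * (indicator (K n) x * u x)) \<in> borel_measurable lebesgue"
      by (intro borel_measurable_times[of _ _ ?w] borel_measurable_indicator) auto
    also have "(\<lambda>x. indicator (A n) x * (indicator (K n) x * u x)) = (\<lambda>x. indicator (A n) x * u x)"
      using K(3)[of n] by (intro ext) (auto simp: indicator_def)
    finally show ?thesis .
  qed
  have ev: "\<forall>\<^sub>F n in sequentially. x \<in> A n" if "x \<in> \<Omega>" for x
  proof -
    have "t \<longlonglongrightarrow> 1" unfolding t_def by real_asymp
    then have "(\<lambda>n. a + (1 / t n) *\<^sub>R (x - a)) \<longlonglongrightarrow> a + (1 / 1) *\<^sub>R (x - a)"
      by (intro tendsto_intros) auto
    then show ?thesis using topological_tendstoD[OF _ \<Omega>(1)] that by (fastforce simp: A_def dilation_def)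
  qed
  \<comment> \<open>Local integrability yields measurability on compact subsets; the cut-off to
    \<Omega> is the pointwise limit of the cut-offs to the dilations.\<close>
  have um: "(\<lambda>x. indicator \<Omega> x * u x) \<in> borel_measurable lebesgue"
  proof (rule borel_measurable_LIMSEQ_metric[OF Am])
    fix x
    show "(\<lambda>n. indicator (A n) x * u x) \<longlonglongrightarrow> indicator \<Omega> x * u x"
    proof (cases "x \<in> \<Omega>")
      case True
      have "\<forall>\<^sub>F n in sequentially. indicator (A n) x * u x = indicator \<Omega> x * u x"
        using ev[OF True] by eventually_elim (simp add: True)
      then show ?thesis by (rule tendsto_eventually)
    next
      case False
      then have "x \<notin> A n" for n using K(2,3) by blast
      then show ?thesis using False by simp
    qed
  qed
  have "\<exists>c. (\<integral>\<^sup>+x\<in>A n. ennreal ((u x - c)\<^sup>2) \<partial>lebesgue) \<le> ennreal P * E" for n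
    using improved_poincare_dilation[OF \<Omega> u fin[unfolded E_def] t] by (simp add: A_def P_def E_def)
  then have "\<exists>c. \<forall>n. (\<integral>\<^sup>+x\<in>A n. ennreal ((u x - c n)\<^sup>2) \<partial>lebesgue) \<le> ennreal P * E"
    by (intro choice allI)
  then obtain c where c: "\<And>n. (\<integral>\<^sup>+x\<in>A n. ennreal ((u x - c n)\<^sup>2) \<partial>lebesgue) \<le> ennreal P * E"
    by blast
  have PE: "ennreal P * E < \<infinity>" using fin by (simp add: ennreal_mult_less_top)
  have "\<exists>c. (\<integral>\<^sup>+x\<in>\<Omega>. ennreal ((u x - c)\<^sup>2) \<partial>lebesgue) \<le> ennreal P * E"
  proof (rule Fatou_mod_constants[where A = A and v = "\<lambda>_. u" and c = c and E = "\<lambda>_. ennreal P * E"])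
    show "(\<lambda>x. indicator (A n) x * (u x - c n)) \<in> borel_measurable lebesgue" for n
      unfolding right_diff_distrib
      by (rule borel_measurable_diff[OF Am]) (intro borel_measurable_times borel_measurable_indicator; simp)
    show "AE x in lebesgue. x \<in> \<Omega> \<longrightarrow> (\<lambda>n. u x) \<longlonglongrightarrow> u x \<and> (\<forall>\<^sub>F n in sequentially. x \<in> A n)"
      using ev by simp
  qed (use pos c PE in auto)
  then obtain c where c: "(\<integral>\<^sup>+x\<in>\<Omega>. ennreal ((u x - c)\<^sup>2) \<partial>lebesgue) \<le> ennreal P * E" by blast
  have "L2_norm_sq \<Omega> (\<lambda>x. u x - integral_mean \<Omega> u) = (\<integral>\<^sup>+x\<in>\<Omega>. ennreal ((u x - integral_mean \<Omega> u)\<^sup>2) \<partial>lebesgue)"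
    by (simp add: L2_norm_sq_def)
  also have "\<dots> \<le> (\<integral>\<^sup>+x\<in>\<Omega>. ennreal ((u x - c)\<^sup>2) \<partial>lebesgue)"
    by (rule nn_integral_mean_le[OF _ finite pos um]) (use c PE in auto)
  also note c
  finally show "L2_norm_sq \<Omega> (\<lambda>x. u x - integral_mean \<Omega> u)
      \<le> ennreal (16 * (R / r + sqrt ((R / r)\<^sup>2 - 1))\<^sup>2) * L2_norm_sq \<Omega> (\<lambda>x. boundary_dist \<Omega> x *\<^sub>R g x)"
    unfolding E P_def .
qed

theorem mainTheorem5:
  fixes \<Omega> :: "(real^2) set" and a :: "real^2" and r R \<eta> :: real
  assumes "open \<Omega>" and "connected \<Omega>" and "\<Omega> \<noteq> {}"
    and "r > 0"
    and "star_shaped_wrt \<Omega> (ball a r)"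
    and "\<Omega> \<subseteq> ball a R"
    and "\<eta> = R / r"
  shows "improved_poincare_constant \<Omega> \<le> ennreal (16 * (\<eta> + sqrt (\<eta>\<^sup>2 - 1))\<^sup>2)
    \<and> 16 * (\<eta> + sqrt (\<eta>\<^sup>2 - 1))\<^sup>2 \<le> 64 * \<eta>\<^sup>2"
proof
  \<comment> \<open>The inclusion gives \<eta> \<ge> 1, so that the square root is taken of a
    nonnegative number.\<close>
  have "ball a r \<subseteq> ball a R" using assms(5,6) by (auto simp: star_shaped_wrt_def)
  then have "r \<le> R" using assms(4) by (simp add: ball_subset_ball_iff)
  then have \<eta>: "\<eta> \<ge> 1" using assms(4,7) by simp
  then have s: "0 \<le> sqrt (\<eta>\<^sup>2 - 1)" "sqrt (\<eta>\<^sup>2 - 1) \<le> \<eta>"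
    by (auto simp: real_le_lsqrt intro!: real_le_lsqrt)
  \<comment> \<open>The infimum in \<open>improved_poincare_constant\<close> runs over positive
    constants only.\<close>
  have "0 < \<eta> + sqrt (\<eta>\<^sup>2 - 1)" using \<eta> s(1) by linarith
  then have "0 < 16 * (\<eta> + sqrt (\<eta>\<^sup>2 - 1))\<^sup>2" by simp
  moreover have "improved_poincare_ineq \<Omega> (16 * (\<eta> + sqrt (\<eta>\<^sup>2 - 1))\<^sup>2)"
    unfolding assms(7) by (rule improved_poincare_ineq_star_shaped[OF assms(1,4,5,6)])
  ultimately show "improved_poincare_constant \<Omega> \<le> ennreal (16 * (\<eta> + sqrt (\<eta>\<^sup>2 - 1))\<^sup>2)"
    unfolding improved_poincare_constant_def by (intro INF_lower) simp
  have "(\<eta> + sqrt (\<eta>\<^sup>2 - 1))\<^sup>2 \<le> (2 * \<eta>)\<^sup>2" using \<eta> s by (intro power_mono) auto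
  then show "16 * (\<eta> + sqrt (\<eta>\<^sup>2 - 1))\<^sup>2 \<le> 64 * \<eta>\<^sup>2" by (simp add: power_mult_distrib)
qed

end
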